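(* Let $\mathbb{D}$ be a division ring with finite dimension $d$ over a central subfield $\mathbb{F}$, and assume that $\mathbb{D}$ is of quadratic type over $\mathbb{F}$. Let $V$ be a right $\mathbb{D}$-vector space of finite dimension $n>0$, with $|\mathbb{F}|\geq nd$. Then every irreducible optimal trivial spectrum subspace of $\operatorname{End}_{\mathbb{D}}(V)$ equals $\mathcal{A}_{b,\mathbb{D}}$ for some nonisotropic $\mathbb{F}$-bilinear form $b:V\times V\to\mathbb{F}$. Moreover, for two nonisotropic $\mathbb{F}$-bilinear forms $b$ and $b'$ on $V$ such that $\mathcal{A}_{b,\mathbb{D}}$ and $\mathcal{A}_{b',\mathbb{D}}$ are irreducible optimal trivial spectrum subspaces of $\operatorname{End}_{\mathbb{D}}(V)$, the equality $\mathcal{A}_{b,\mathbb{D}}=\mathcal{A}_{b',\mathbb{D}}$ holds if and only if $b'$ is a scalar multiple of $b$ (with scalar in $\mathbb{F}$).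
   Context: A central subfield of $\mathbb{D}$ is a subfield contained in the center of $\mathbb{D}$. $\operatorname{End}_{\mathbb{D}}(V)$ is the $\mathbb{F}$-algebra of $\mathbb{D}$-linear endomorphisms of $V$. An $\mathbb{F}$-linear subspace $S$ of $\operatorname{End}_{\mathbb{D}}(V)$ has trivial spectrum if $\operatorname{id}_V-u$ is invertible for all $u\in S$; it is optimal if it has the greatest possible dimension over $\mathbb{F}$ among all trivial spectrum $\mathbb{F}$-linear subspaces of $\operatorname{End}_{\mathbb{D}}(V)$. A subset $\mathcal{X}$ of $\operatorname{End}_{\mathbb{D}}(V)$ is irreducible if $V\neq\{0\}$ and the only $\mathbb{D}$-linear subspaces of $V$ invariant under all elements of $\mathcal{X}$ are $\{0\}$ and $V$. An $\mathbb{F}$-bilinear form $b:V\times V\to\mathbb{F}$ is nonisotropic if $b(x,x)\neq 0$ for all $x\in V\setminus\{0\}$. $\mathcal{A}_{b,\mathbb{D}}$ is the set of all $u\in\operatorname{End}_{\mathbb{D}}(V)$ such that $b(x,u(x))=0$ for all $x\in V$. $\mathbb{D}$ is of quadratic type over $\mathbb{F}$ if one of the following holds: (i) $d=1$; (ii) $d=2$ and $\mathbb{D}$ is a separable field extension of $\mathbb{F}$; (iii) $d=4$ and $\mathbb{D}$ is a quaternion algebra over $\mathbb{F}$; (iv) $d=2^m$ for some $m\geq 1$, $\operatorname{char}(\mathbb{F})=2$, $\mathbb{D}$ is a field and $x^2\in\mathbb{F}$ for all $x\in\mathbb{D}$. *)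

theory Defs
  imports
    "HOL-Computational_Algebra.Computational_Algebra"
    "HOL-Library.Function_Algebras"
begin

section \<open>Division rings over a central subfield\<close>

text \<open>
  The central subfield F of the division ring D is given as a field type together with an
  embedding \<open>\<iota>\<close> into D (a unital ring homomorphism, automatically injective) with central image;
  an element of F is identified with its image under \<open>\<iota>\<close>.
\<close>

locale central_subfield =
  fixes \<iota> :: "'f::field \<Rightarrow> 'd::division_ring"
  assumes embed_add: "\<iota> (a + b) = \<iota> a + \<iota> b"
    and embed_mult: "\<iota> (a * b) = \<iota> a * \<iota> b"
    and embed_one: "\<iota> 1 = 1"
    and embed_central: "\<iota> a * x = x * \<iota> a"

definition ring_scale :: "('f::field \<Rightarrow> 'd::division_ring) \<Rightarrow> 'f \<Rightarrow> 'd \<Rightarrow> 'd" where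
  "ring_scale \<iota> a x = \<iota> a * x"

lemma (in central_subfield) vector_space_ring_scale: "vector_space (ring_scale \<iota>)"
  by unfold_locales
    (simp_all add: ring_scale_def embed_add embed_mult embed_one algebra_simps)

definition has_dimension :: "('f::field \<Rightarrow> 'a::ab_group_add \<Rightarrow> 'a) \<Rightarrow> nat \<Rightarrow> bool" where
  "has_dimension s k \<longleftrightarrow> (\<exists>B. finite_dimensional_vector_space s B \<and> card B = k)"

definition commutative_ring :: "'d::division_ring itself \<Rightarrow> bool" where
  "commutative_ring _ \<longleftrightarrow> (\<forall>x y :: 'd. x * y = y * x)"

definition eval_poly :: "('f::field \<Rightarrow> 'd::division_ring) \<Rightarrow> 'f poly \<Rightarrow> 'd \<Rightarrow> 'd" where
  "eval_poly \<iota> p x = (\<Sum>i\<le>degree p. \<iota> (coeff p i) * x ^ i)"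

definition is_minimal_polynomial ::
    "('f::field \<Rightarrow> 'd::division_ring) \<Rightarrow> 'd \<Rightarrow> 'f poly \<Rightarrow> bool" where
  "is_minimal_polynomial \<iota> x p \<longleftrightarrow>
     lead_coeff p = 1 \<and> eval_poly \<iota> p x = 0 \<and>
     (\<forall>q. q \<noteq> 0 \<and> eval_poly \<iota> q x = 0 \<longrightarrow> degree p \<le> degree q)"

definition separable_polynomial :: "'f::field poly \<Rightarrow> bool" where
  "separable_polynomial p \<longleftrightarrow> coprime p (pderiv p)"

definition separable_field_extension :: "('f::field \<Rightarrow> 'd::division_ring) \<Rightarrow> bool" where
  "separable_field_extension \<iota> \<longleftrightarrow>
     commutative_ring TYPE('d) \<and>
     (\<forall>x. \<exists>p. is_minimal_polynomial \<iota> x p \<and> separable_polynomial p)"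

definition ring_center :: "'d::division_ring set" where
  "ring_center = {z. \<forall>x. z * x = x * z}"

text \<open>
  A quaternion algebra is a central simple algebra of dimension 4. A division ring is simple,
  so only centrality and the dimension have to be stated.
\<close>

definition quaternion_algebra :: "('f::field \<Rightarrow> 'd::division_ring) \<Rightarrow> bool" where
  "quaternion_algebra \<iota> \<longleftrightarrow> has_dimension (ring_scale \<iota>) 4 \<and> ring_center = range \<iota>"

definition quadratic_type :: "('f::field \<Rightarrow> 'd::division_ring) \<Rightarrow> nat \<Rightarrow> bool" where
  "quadratic_type \<iota> d \<longleftrightarrow>
     d = 1
   \<or> d = 2 \<and> separable_field_extension \<iota>
   \<or> d = 4 \<and> quaternion_algebra \<iota>
   \<or> (\<exists>m\<ge>1. d = 2 ^ m) \<and> CHAR('f) = 2 \<and> commutative_ring TYPE('d) \<and>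
       (\<forall>x. x ^ 2 \<in> range \<iota>)"


section \<open>Right vector spaces over a division ring\<close>

locale right_vector_space =
  fixes smul :: "'v::ab_group_add \<Rightarrow> 'd::division_ring \<Rightarrow> 'v"  (infixl "\<cdot>" 70)
  assumes smul_add_left: "(v + w) \<cdot> x = v \<cdot> x + w \<cdot> x"
    and smul_add_right: "v \<cdot> (x + y) = v \<cdot> x + v \<cdot> y"
    and smul_mult: "v \<cdot> (x * y) = (v \<cdot> x) \<cdot> y"
    and smul_one: "v \<cdot> 1 = v"

definition right_basis :: "('v::ab_group_add \<Rightarrow> 'd::division_ring \<Rightarrow> 'v) \<Rightarrow> 'v set \<Rightarrow> bool" where
  "right_basis smul B \<longleftrightarrow>
     finite B \<and>
     (\<forall>c. (\<Sum>b\<in>B. smul b (c b)) = 0 \<longrightarrow> (\<forall>b\<in>B. c b = 0)) \<and>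
     (\<forall>v. \<exists>c. v = (\<Sum>b\<in>B. smul b (c b)))"

definition right_has_dimension ::
    "('v::ab_group_add \<Rightarrow> 'd::division_ring \<Rightarrow> 'v) \<Rightarrow> nat \<Rightarrow> bool" where
  "right_has_dimension smul k \<longleftrightarrow> (\<exists>B. right_basis smul B \<and> card B = k)"

definition right_subspace :: "('v::ab_group_add \<Rightarrow> 'd::division_ring \<Rightarrow> 'v) \<Rightarrow> 'v set \<Rightarrow> bool" where
  "right_subspace smul W \<longleftrightarrow>
     0 \<in> W \<and> (\<forall>v\<in>W. \<forall>w\<in>W. v + w \<in> W) \<and> (\<forall>v\<in>W. \<forall>x. smul v x \<in> W)"

definition End :: "('v::ab_group_add \<Rightarrow> 'd::division_ring \<Rightarrow> 'v) \<Rightarrow> ('v \<Rightarrow> 'v) set" where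
  "End smul = {u. (\<forall>v w. u (v + w) = u v + u w) \<and> (\<forall>v x. u (smul v x) = smul (u v) x)}"


section \<open>Spaces of endomorphisms over the central subfield\<close>

definition vec_scale ::
    "('f::field \<Rightarrow> 'd::division_ring) \<Rightarrow> ('v::ab_group_add \<Rightarrow> 'd \<Rightarrow> 'v) \<Rightarrow> 'f \<Rightarrow> 'v \<Rightarrow> 'v" where
  "vec_scale \<iota> smul a v = smul v (\<iota> a)"

text \<open>
  The pointwise F-scaling is given on all functions from V to V (with pointwise addition);
  the F-linear subspaces of interest are those contained in \<^term>\<open>End smul\<close>.
\<close>

definition end_scale ::
    "('f::field \<Rightarrow> 'd::division_ring) \<Rightarrow> ('v::ab_group_add \<Rightarrow> 'd \<Rightarrow> 'v) \<Rightarrow>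
     'f \<Rightarrow> ('v \<Rightarrow> 'v) \<Rightarrow> ('v \<Rightarrow> 'v)" where
  "end_scale \<iota> smul a u = (\<lambda>v. vec_scale \<iota> smul a (u v))"

lemma vector_space_vec_scale:
  assumes "central_subfield \<iota>" and "right_vector_space smul"
  shows "vector_space (vec_scale \<iota> smul)"
proof -
  interpret central_subfield \<iota> by fact
  interpret right_vector_space smul by fact
  have "smul v (\<iota> (a * b)) = smul (smul v (\<iota> b)) (\<iota> a)" for a b v
    by (metis embed_mult smul_mult mult.commute)
  then show ?thesis
    by unfold_locales
      (simp_all add: vec_scale_def smul_add_left smul_add_right embed_add embed_one smul_one)
qed

lemma vector_space_end_scale:
  assumes "central_subfield \<iota>" and "right_vector_space smul"
  shows "vector_space (end_scale \<iota> smul)"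
proof -
  interpret vector_space "vec_scale \<iota> smul" by (rule vector_space_vec_scale) fact+
  show ?thesis
    by unfold_locales
      (simp_all add: end_scale_def fun_eq_iff scale_right_distrib scale_left_distrib)
qed

lemma subspace_End:
  assumes "central_subfield \<iota>" and "right_vector_space smul"
  shows "module.subspace (end_scale \<iota> smul) (End smul)"
proof -
  interpret central_subfield \<iota> by fact
  interpret right_vector_space smul by fact
  interpret E: vector_space "end_scale \<iota> smul" by (rule vector_space_end_scale) fact+
  have zero: "smul 0 x = 0" for x
    using smul_add_left[of 0 0 x] by simp
  have comm: "smul (smul v x) (\<iota> a) = smul (smul v (\<iota> a)) x" for v x a
    by (metis smul_mult embed_central)
  show ?thesis
    by (rule E.subspaceI)
      (simp_all add: End_def end_scale_def vec_scale_def smul_add_left zero comm add_ac)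
qed

definition trivial_spectrum_subspace ::
    "('f::field \<Rightarrow> 'd::division_ring) \<Rightarrow> ('v::ab_group_add \<Rightarrow> 'd \<Rightarrow> 'v) \<Rightarrow> ('v \<Rightarrow> 'v) set \<Rightarrow> bool" where
  "trivial_spectrum_subspace \<iota> smul S \<longleftrightarrow>
     S \<subseteq> End smul \<and> module.subspace (end_scale \<iota> smul) S \<and>
     (\<forall>u\<in>S. \<exists>w\<in>End smul. w \<circ> (id - u) = id \<and> (id - u) \<circ> w = id)"

definition optimal_trivial_spectrum_subspace ::
    "('f::field \<Rightarrow> 'd::division_ring) \<Rightarrow> ('v::ab_group_add \<Rightarrow> 'd \<Rightarrow> 'v) \<Rightarrow> ('v \<Rightarrow> 'v) set \<Rightarrow> bool" where
  "optimal_trivial_spectrum_subspace \<iota> smul S \<longleftrightarrow>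
     trivial_spectrum_subspace \<iota> smul S \<and>
     (\<forall>T. trivial_spectrum_subspace \<iota> smul T \<longrightarrow>
        vector_space.dim (end_scale \<iota> smul) T \<le> vector_space.dim (end_scale \<iota> smul) S)"

definition irreducible_endos ::
    "('v::ab_group_add \<Rightarrow> 'd::division_ring \<Rightarrow> 'v) \<Rightarrow> ('v \<Rightarrow> 'v) set \<Rightarrow> bool" where
  "irreducible_endos smul X \<longleftrightarrow>
     (UNIV :: 'v set) \<noteq> {0} \<and>
     (\<forall>W. right_subspace smul W \<and> (\<forall>u\<in>X. u ` W \<subseteq> W) \<longrightarrow> W = {0} \<or> W = UNIV)"


section \<open>Bilinear forms\<close>

definition bilinear_form ::
    "('f::field \<Rightarrow> 'd::division_ring) \<Rightarrow> ('v::ab_group_add \<Rightarrow> 'd \<Rightarrow> 'v) \<Rightarrow> ('v \<Rightarrow> 'v \<Rightarrow> 'f) \<Rightarrow> bool" where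
  "bilinear_form \<iota> smul b \<longleftrightarrow>
     (\<forall>x. Vector_Spaces.linear (vec_scale \<iota> smul) (*) (\<lambda>y. b x y)) \<and>
     (\<forall>y. Vector_Spaces.linear (vec_scale \<iota> smul) (*) (\<lambda>x. b x y))"

definition nonisotropic :: "('v::ab_group_add \<Rightarrow> 'v \<Rightarrow> 'f::field) \<Rightarrow> bool" where
  "nonisotropic b \<longleftrightarrow> (\<forall>x. x \<noteq> 0 \<longrightarrow> b x x \<noteq> 0)"

definition alternating_endos ::
    "('v::ab_group_add \<Rightarrow> 'd::division_ring \<Rightarrow> 'v) \<Rightarrow> ('v \<Rightarrow> 'v \<Rightarrow> 'f::field) \<Rightarrow> ('v \<Rightarrow> 'v) set" where
  "alternating_endos smul b = {u \<in> End smul. \<forall>x. b x (u x) = 0}"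

end

theory Submission
  imports Defs
begin

text \<open>
  Let \<open>N = n d\<close>. If \<open>x\<close> maximizes the dimension \<open>r\<close> of \<open>S x\<close>, then \<open>r \<le> N - 1\<close> because \<open>x \<notin> S x\<close>, and a pencil
  argument (using \<open>r < |F|\<close>) shows that every \<open>u \<in> S\<close> with \<open>u x = 0\<close> has its image in \<open>S x\<close>. Choosing a linear
  form \<open>\<phi>\<close> that vanishes on \<open>S x\<close> but not at \<open>x\<close>, these \<open>u\<close> act on the \<open>D\<close>-hyperplane
  \<open>K = {v. \<phi> (v D) = 0}\<close>, a complement of \<open>x D\<close>; by induction \<open>dim S\<close> is at most the sum of the \<open>j d - 1\<close> for \<open>j \<le> n\<close>.
  Optimal spaces attain this bound. If \<open>S\<close> is moreover irreducible, then so is the kernel of the evaluation at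
  \<open>x\<close>, as a space of endomorphisms of \<open>K\<close>, and it follows that \<open>S x\<close> is a hyperplane for every \<open>x \<noteq> 0\<close>, say the
  kernel of \<open>\<Phi> x\<close>. For \<open>x, y\<close> independent over \<open>D\<close>, the forms \<open>\<Phi> (x + y)\<close> and \<open>\<Phi> y\<close> are proportional on \<open>K\<close>,
  and symmetrically with \<open>x\<close> and \<open>y\<close> exchanged, so \<open>\<Phi> (x + y)\<close> is a combination of \<open>\<Phi> x\<close> and \<open>\<Phi> y\<close>; for dependent
  \<open>x, y\<close> the same holds since every element of \<open>D\<close> is quadratic over \<open>F\<close>. Hence the map \<open>x \<mapsto> \<Phi> x\<close> between
  projective spaces is induced by a linear map, which is the required bilinear form.
\<close>

section \<open>Linear algebra without finite-dimensional ambient spaces\<close>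

text \<open>The bound is rigid, and both structural steps rest on that. The evaluation kernel at
  \<open>x\<close> already has the largest dimension possible on \<open>K\<close>, so an operator on
  \<open>K\<close> that can be adjoined to it without creating a fixed vector lies in
  \<open>S\<close>. For irreducibility of the kernel: a stable \<open>W\<close> in \<open>K\<close>
  puts into \<open>S\<close> every operator on \<open>K\<close> that maps into \<open>W\<close> and
  kills \<open>W\<close>, and the absence of fixed vectors then confines the resolvents of each
  \<open>v\<close> in \<open>S\<close>, applied to \<open>W\<close>, to \<open>W + x D\<close>. For
  the hyperplane property: a vector with too small an evaluation space forces rank-one operators
  into \<open>S\<close>, and Schur complements turn one of them into many others, until
  \<open>S\<close> stabilizes \<open>K\<close>. The size of \<open>F\<close> always enters in the
  same way: vectors that are eigenvectors for distinct scalars, up to multiples of one fixed vector,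
  are independent, so a family indexed by enough scalars does not fit into a small space. The last
  step does not go through a general theorem on projective spaces, and no field automorphism
  appears: the scalars of the forms \<open>\<Phi> h\<close> are normalized against one fixed
  \<open>x\<close>, and additivity is then checked directly.\<close>

definition card_ge :: "'f itself \<Rightarrow> nat \<Rightarrow> bool" where
  "card_ge _ m \<longleftrightarrow> infinite (UNIV :: 'f set) \<or> m \<le> card (UNIV :: 'f set)"

lemma card_ge_obtain:
  assumes "card_ge TYPE('f) m"
  obtains T :: "'f set" where "finite T" "card T = m"
proof (cases "finite (UNIV :: 'f set)")
  case True
  with assms have "m \<le> card (UNIV :: 'f set)" by (simp add: card_ge_def)
  then show ?thesis using that obtain_subset_with_card_n[of m "UNIV :: 'f set"] True
    by (metis finite_subset subset_UNIV)
next
  case False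
  then show ?thesis using that infinite_arbitrarily_large[of "UNIV :: 'f set" m] by blast
qed

lemma card_ge_mono: "card_ge TYPE('f) m \<Longrightarrow> k \<le> m \<Longrightarrow> card_ge TYPE('f) k"
  by (auto simp: card_ge_def)

text \<open>A copy of \<open>vector_space\<close>: names added to that locale itself would be shadowed by those of its global
  interpretation \<open>real_vector\<close>.\<close>

locale linear_space = vector_space scale
  for scale :: "'a::field \<Rightarrow> 'b::ab_group_add \<Rightarrow> 'b"
begin

definition fin_gen :: "'b set \<Rightarrow> bool" where
  "fin_gen S \<longleftrightarrow> (\<exists>B. finite B \<and> S \<subseteq> span B)"

lemma fin_gen_mono: "S \<subseteq> T \<Longrightarrow> fin_gen T \<Longrightarrow> fin_gen S"
  by (auto simp: fin_gen_def)

lemma fin_gen_independent: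
  assumes "fin_gen S" "B \<subseteq> S" "independent B"
  shows "finite B \<and> card B \<le> dim S"
proof -
  obtain C where C: "finite C" "S \<subseteq> span C" using assms by (auto simp: fin_gen_def)
  have fin: "finite B'" if "B' \<subseteq> S" "independent B'" for B'
    using independent_span_bound[OF C(1) that(2)] C that by blast
  obtain A where A: "B \<subseteq> A" "A \<subseteq> S" "independent A" "S \<subseteq> span A"
    using maximal_independent_subset_extend[OF assms(2,3)] by blast
  have "card A = dim S" using A basis_card_eq_dim by blast
  with fin A assms card_mono[of A B] show ?thesis by metis
qed

lemma fin_gen_basis:
  assumes "fin_gen S"
  obtains B where "B \<subseteq> S" "finite B" "independent B" "S \<subseteq> span B" "card B = dim S"
  using basis_exists[of S] fin_gen_independent[OF assms] by metis

lemma fin_gen_dim_mono: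
  assumes "S \<subseteq> T" "fin_gen T"
  shows "dim S \<le> dim T"
proof -
  obtain B where "B \<subseteq> S" "finite B" "independent B" "S \<subseteq> span B" "card B = dim S"
    using fin_gen_basis fin_gen_mono[OF assms] by metis
  then show ?thesis using fin_gen_independent[OF assms(2), of B] assms by auto
qed

lemma fin_gen_dim_eq:
  assumes "subspace S" "S \<subseteq> T" "fin_gen T" "dim T \<le> dim S"
  shows "S = T"
proof (rule ccontr)
  assume "S \<noteq> T"
  then obtain t where t: "t \<in> T" "t \<notin> S" using assms by blast
  obtain B where B: "B \<subseteq> S" "finite B" "independent B" "S \<subseteq> span B" "card B = dim S"
    using fin_gen_basis fin_gen_mono[OF assms(2,3)] by metis
  have sp: "span B = S" using B assms(1) by (simp add: span_subspace)
  have "independent (insert t B)" using B t sp independent_insertI by blast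
  then have "card (insert t B) \<le> dim T"
    using fin_gen_independent[OF assms(3), of "insert t B"] t B assms(2) by auto
  moreover have "t \<notin> B" using t B by auto
  ultimately show False using B assms(4) by auto
qed

lemma fin_gen_dim_0:
  assumes "subspace S" "fin_gen S" "dim S = 0"
  shows "S = {0}"
  using fin_gen_dim_eq[of "{0}" S] assms subspace_0 by auto

text \<open>Holds over every field, even the one with two elements: if \<open>a\<close> and
  \<open>b\<close> each escape one of the subspaces, their sum can lie in neither.\<close>

lemma subspace_cover:
  assumes "subspace S" "subspace A" "subspace B" "S \<subseteq> A \<union> B"
  shows "S \<subseteq> A \<or> S \<subseteq> B"
proof (rule ccontr)
  assume "\<not> ?thesis"
  then obtain a b where ab: "a \<in> S" "a \<notin> A" "b \<in> S" "b \<notin> B" by blast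
  then have "a \<in> B" "b \<in> A" "a + b \<in> S" using assms by (auto intro: subspace_add)
  then show False using assms ab subspace_diff[OF assms(2), of "a + b" b]
      subspace_diff[OF assms(3), of "a + b" a] by auto
qed

text \<open>The third hypothesis is what survives of \<open>q t\<close> being an eigenvector for
  \<open>\<mu> t\<close>: a linear map applied to a relation multiplies its coefficients by the
  \<open>\<mu> t\<close>. In the uses, the vectors are eigenvectors only up to multiples of a fixed
  vector. The induction is the classical one on the number of nonzero coefficients.\<close>

lemma eigenvector_family_zero:
  assumes "finite T"
    and "inj_on \<mu> T"
    and "\<And>\<alpha>. (\<Sum>t\<in>T. scale (\<alpha> t) (q t)) = 0 \<Longrightarrow> (\<Sum>t\<in>T. scale (\<mu> t * \<alpha> t) (q t)) = 0"
    and "\<And>t. t \<in> T \<Longrightarrow> q t \<noteq> 0"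
    and "(\<Sum>t\<in>T. scale (\<alpha> t) (q t)) = 0" and "t \<in> T"
  shows "\<alpha> t = 0"
  using assms(5,6)
proof (induction "card {t \<in> T. \<alpha> t \<noteq> 0}" arbitrary: \<alpha> t rule: less_induct)
  case less
  show ?case
  proof (rule ccontr)
    assume nz: "\<alpha> t \<noteq> 0"
    define \<beta> where "\<beta> s = (\<mu> s - \<mu> t) * \<alpha> s" for s
    have "{s \<in> T. \<beta> s \<noteq> 0} \<subset> {s \<in> T. \<alpha> s \<noteq> 0}"
      using nz less.prems by (auto simp: \<beta>_def)
    then have lt: "card {s \<in> T. \<beta> s \<noteq> 0} < card {s \<in> T. \<alpha> s \<noteq> 0}"
      using assms(1) by (auto intro: psubset_card_mono)
    have "(\<Sum>s\<in>T. scale (\<beta> s) (q s)) =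
        (\<Sum>s\<in>T. scale (\<mu> s * \<alpha> s) (q s)) - scale (\<mu> t) (\<Sum>s\<in>T. scale (\<alpha> s) (q s))"
      by (simp add: \<beta>_def scale_sum_right sum_subtractf[symmetric] scale_left_diff_distrib left_diff_distrib)
    also have "\<dots> = 0" using assms(3)[OF less.prems(1)] less.prems(1) by simp
    finally have \<beta>0: "\<beta> s = 0" if "s \<in> T" for s using less.hyps[OF lt] that by blast
    have "\<alpha> s = 0" if "s \<in> T" "s \<noteq> t" for s
    proof -
      have "\<mu> s \<noteq> \<mu> t" using assms(2) that less.prems(2) by (auto dest: inj_onD)
      then show ?thesis using \<beta>0[OF that(1)] by (simp add: \<beta>_def)
    qed
    then have "(\<Sum>s\<in>T. scale (\<alpha> s) (q s)) = (\<Sum>s\<in>{t}. scale (\<alpha> s) (q s))"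
      using assms(1) less.prems(2) by (intro sum.mono_neutral_right) auto
    then show False using less.prems assms(4) nz by auto
  qed
qed

lemma eigenvector_family_card:
  assumes "finite T"
    and "inj_on \<mu> T"
    and "\<And>\<alpha>. (\<Sum>t\<in>T. scale (\<alpha> t) (q t)) = 0 \<Longrightarrow> (\<Sum>t\<in>T. scale (\<mu> t * \<alpha> t) (q t)) = 0"
    and "\<And>t. t \<in> T \<Longrightarrow> q t \<noteq> 0"
    and "fin_gen Q" "\<And>t. t \<in> T \<Longrightarrow> q t \<in> Q"
  shows "card T \<le> dim Q"
proof -
  note z = eigenvector_family_zero[OF assms(1-4)]
  have inj: "inj_on q T"
  proof (rule inj_onI, rule ccontr)
    fix s t assume st: "s \<in> T" "t \<in> T" "q s = q t" "s \<noteq> t"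
    \<comment> \<open>A coincidence \<open>q s = q t\<close> is itself a linear relation, with
      coefficients 1 and -1.\<close>
    define \<alpha> where "\<alpha> r = (if r = s then 1 else if r = t then - 1 else 0 :: 'a)" for r
    have "(\<Sum>r\<in>T. scale (\<alpha> r) (q r)) = (\<Sum>r\<in>{s,t}. scale (\<alpha> r) (q r))"
      using assms(1) st by (intro sum.mono_neutral_right) (auto simp: \<alpha>_def)
    also have "\<dots> = 0" using st by (simp add: \<alpha>_def)
    finally show False using z[of \<alpha> s] st by (simp add: \<alpha>_def)
  qed
  have "independent (q ` T)"
  proof (rule independent_if_scalars_zero)
    fix f x assume f: "(\<Sum>x\<in>q ` T. scale (f x) x) = 0" and x: "x \<in> q ` T"
    from f have "(\<Sum>t\<in>T. scale (f (q t)) (q t)) = 0"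
      by (simp add: sum.reindex[OF inj])
    then show "f x = 0" using z[of "\<lambda>t. f (q t)"] x by auto
  qed (use assms in auto)
  then have "card (q ` T) \<le> dim Q" using fin_gen_independent[OF assms(5)] assms(6) by blast
  then show ?thesis by (simp add: card_image[OF inj])
qed

end

section \<open>Rank-nullity and pencils of linear maps\<close>

lemma linear_space_field: "linear_space ((*) :: 'f::field \<Rightarrow> 'f \<Rightarrow> 'f)"
  by unfold_locales (auto simp: algebra_simps)

locale linear_space_pair = vs1: linear_space s1 + vs2: linear_space s2
  for s1 :: "'a::field \<Rightarrow> 'b::ab_group_add \<Rightarrow> 'b"
    and s2 :: "'a::field \<Rightarrow> 'c::ab_group_add \<Rightarrow> 'c"
begin

sublocale vector_space_pair s1 s2 ..

lemma fin_gen_image: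
  assumes "Vector_Spaces.linear s1 s2 f" "vs1.fin_gen S"
  shows "vs2.fin_gen (f ` S)"
  using assms unfolding vs1.fin_gen_def vs2.fin_gen_def
  by (metis finite_imageI linear_spans_image)

text \<open>\<open>S\<close> may lie in an infinite-dimensional space. A right inverse
  \<open>g\<close> of \<open>f\<close> on the image of \<open>S\<close> carries a basis of that
  image back into \<open>S\<close>, where it completes a basis of the kernel.\<close>

lemma rank_nullity:
  assumes f: "Vector_Spaces.linear s1 s2 f" and S: "vs1.subspace S" "vs1.fin_gen S"
  shows "vs1.dim S = vs2.dim (f ` S) + vs1.dim {u \<in> S. f u = 0}"
proof -
  interpret f: Vector_Spaces.linear s1 s2 f by fact
  let ?K = "{u \<in> S. f u = 0}"
  have K: "vs1.subspace ?K" "vs1.fin_gen ?K"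
  proof -
    have "?K = S \<inter> {u. f u = 0}" by blast
    then show "vs1.subspace ?K" using vs1.subspace_inter[OF S(1) f.subspace_kernel] by simp
    show "vs1.fin_gen ?K" by (rule vs1.fin_gen_mono[OF _ S(2)]) blast
  qed
  obtain B where B: "B \<subseteq> ?K" "finite B" "vs1.independent B" "?K \<subseteq> vs1.span B" "card B = vs1.dim ?K"
    by (rule vs1.fin_gen_basis[OF K(2)])
  obtain g where g: "range g \<subseteq> S" "Vector_Spaces.linear s2 s1 g" "\<forall>v\<in>f ` S. f (g v) = v"
    using linear_exists_right_inverse_on[OF f S(1)] by blast
  interpret g: Vector_Spaces.linear s2 s1 g by fact
  have Q: "vs2.subspace (f ` S)" "vs2.fin_gen (f ` S)"
    using S fin_gen_image[OF f] f.subspace_image by auto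
  obtain C where C: "C \<subseteq> f ` S" "finite C" "vs2.independent C" "f ` S \<subseteq> vs2.span C" "card C = vs2.dim (f ` S)"
    by (rule vs2.fin_gen_basis[OF Q(2)])
  have spC: "vs2.span C = f ` S" using C Q by (simp add: vs2.span_subspace)
  have spB: "vs1.span B = ?K" using B K by (simp add: vs1.span_subspace)
  have injg: "inj_on g (vs2.span C)" using g(3) spC by (metis inj_on_inverseI)
  then have igC: "vs1.independent (g ` C)" using C g.independent_injective_image by blast
  have spgC: "vs1.span (g ` C) = g ` (f ` S)" using g.span_image spC by metis
  have disj: "w = 0" if w: "w \<in> vs1.span B" "w \<in> vs1.span (g ` C)" for w
  proof -
    obtain y where y: "y \<in> f ` S" "w = g y" using w(2) spgC by blast
    have "f w = 0" using w(1) spB by blast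
    then have "y = 0" using g(3) y by simp
    then show ?thesis using y g.zero by simp
  qed
  have dj: "B \<inter> g ` C = {}"
  proof (rule ccontr)
    assume "B \<inter> g ` C \<noteq> {}"
    then obtain w where w: "w \<in> B" "w \<in> g ` C" by blast
    have "w = 0" by (intro disj vs1.span_base w)
    then show False using w(1) B(3) vs1.dependent_zero by metis
  qed
  have ind: "vs1.independent (B \<union> g ` C)"
  proof (rule vs1.independent_if_scalars_zero)
    fix h x assume h: "(\<Sum>x\<in>B \<union> g ` C. s1 (h x) x) = 0" and x: "x \<in> B \<union> g ` C"
    have s: "(\<Sum>x\<in>B. s1 (h x) x) + (\<Sum>x\<in>g ` C. s1 (h x) x) = 0"
      using h sum.union_disjoint[OF B(2) finite_imageI[OF C(2)] dj] by metis
    have m1: "(\<Sum>x\<in>B. s1 (h x) x) \<in> vs1.span B" by (intro vs1.span_sum vs1.span_scale vs1.span_base)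
    have m2: "(\<Sum>x\<in>g ` C. s1 (h x) x) \<in> vs1.span (g ` C)"
      by (intro vs1.span_sum vs1.span_scale vs1.span_base)
    have "(\<Sum>x\<in>B. s1 (h x) x) = - (\<Sum>x\<in>g ` C. s1 (h x) x)" using s by (simp add: eq_neg_iff_add_eq_0)
    then have "(\<Sum>x\<in>B. s1 (h x) x) \<in> vs1.span (g ` C)" using m2 vs1.span_neg by simp
    then have z: "(\<Sum>x\<in>B. s1 (h x) x) = 0" using m1 disj by metis
    then have z': "(\<Sum>x\<in>g ` C. s1 (h x) x) = 0" using s by simp
    show "h x = 0"
    proof (cases "x \<in> B")
      case True
      then show ?thesis by (rule vs1.independentD[OF B(3) B(2) subset_refl z])
    next
      case False
      then have "x \<in> g ` C" using x by blast
      then show ?thesis by (rule vs1.independentD[OF igC finite_imageI[OF C(2)] subset_refl z'])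
    qed
  qed (use B C in auto)
  have sub: "B \<union> g ` C \<subseteq> S" using B g by auto
  have "S \<subseteq> vs1.span (B \<union> g ` C)"
  proof
    fix u assume u: "u \<in> S"
    have "u - g (f u) \<in> ?K" using u g S by (auto simp: f.diff intro: vs1.subspace_diff)
    then have 1: "u - g (f u) \<in> vs1.span (B \<union> g ` C)" using spB vs1.span_mono[of B "B \<union> g ` C"] by auto
    have "g (f u) \<in> vs1.span (g ` C)" using spgC u by auto
    then have "g (f u) \<in> vs1.span (B \<union> g ` C)" using vs1.span_mono[of "g ` C" "B \<union> g ` C"] by auto
    from vs1.span_add[OF 1 this] show "u \<in> vs1.span (B \<union> g ` C)" by simp
  qed
  then have "vs1.dim S = card (B \<union> g ` C)"
    using vs1.basis_card_eq_dim[OF sub _ ind] by simp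
  also have "\<dots> = card B + card (g ` C)" using B C dj by (simp add: card_Un_disjoint)
  also have "card (g ` C) = card C"
    using injg vs2.span_superset by (intro card_image) (auto intro: inj_on_subset)
  finally show ?thesis using B C by simp
qed

lemma dim_image_eq_gen:
  assumes "Vector_Spaces.linear s1 s2 f" "vs1.subspace S" "vs1.fin_gen S" "\<And>u. u \<in> S \<Longrightarrow> f u = 0 \<Longrightarrow> u = 0"
  shows "vs2.dim (f ` S) = vs1.dim S"
proof -
  have "{u \<in> S. f u = 0} = {0}" using assms vs1.subspace_0 linear_0[OF assms(1)] by auto
  moreover have "vs1.dim {0} = 0" using vs1.dim_le_card[of "{0}" "{}"] by simp
  ultimately show ?thesis using rank_nullity[OF assms(1-3)] by simp
qed

text \<open>If \<open>B u\<close> were outside the image of \<open>A\<close>, then \<open>u\<close>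
  together with a copy of that image in \<open>S\<close> would span a space of dimension above
  \<open>r\<close>, on which each \<open>s A + B\<close> has a nonzero kernel vector. The images
  \<open>q s\<close> of these vectors under \<open>A\<close> are eigenvectors of one map modulo
  \<open>B u\<close>, with eigenvalue \<open>s\<close>, so \<open>r + 1\<close> of them are
  independent in a space of dimension \<open>r\<close>.\<close>

lemma pencil_kernel:
  assumes A: "Vector_Spaces.linear s1 s2 A" and B: "Vector_Spaces.linear s1 s2 B"
    and S: "vs1.subspace S" "vs1.fin_gen S"
    and r: "\<And>s. vs2.dim ((\<lambda>u. s2 s (A u) + B u) ` S) \<le> r"
    and rA: "vs2.dim (A ` S) = r"
    and big: "card_ge TYPE('a) (Suc r)"
    and u: "u \<in> S" "A u = 0"
  shows "B u \<in> A ` S"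
proof (rule ccontr)
  assume nin: "B u \<notin> A ` S"
  interpret A: Vector_Spaces.linear s1 s2 A by fact
  interpret B: Vector_Spaces.linear s1 s2 B by fact
  have Q: "vs2.subspace (A ` S)" "vs2.fin_gen (A ` S)"
    using S fin_gen_image[OF A] A.subspace_image by auto
  obtain g where g: "range g \<subseteq> S" "Vector_Spaces.linear s2 s1 g" "\<forall>v\<in>A ` S. A (g v) = v"
    using linear_exists_right_inverse_on[OF A S(1)] by blast
  interpret g: Vector_Spaces.linear s2 s1 g by fact
  have gA: "A (g v) = v" if "v \<in> A ` S" for v using g(3) that by blast
  interpret P21: linear_space_pair s2 s1 by unfold_locales
  have u0: "u \<noteq> 0" using nin Q vs2.subspace_0 B.zero by metis
  let ?E = "g ` (A ` S)"
  let ?E' = "{e + s1 c u | e c. e \<in> ?E}"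
  have E: "vs1.subspace ?E" using Q g.subspace_image by blast
  have E': "vs1.subspace ?E'"
  proof -
    have eq: "?E' = {x + y | x y. x \<in> ?E \<and> y \<in> vs1.span {u}}" by (auto simp: vs1.span_singleton)
    show ?thesis unfolding eq by (rule vs1.subspace_sums[OF E vs1.subspace_span])
  qed
  have E'S: "?E' \<subseteq> S" using g(1) u S by (auto intro!: vs1.subspace_add vs1.subspace_scale)
  have fE': "vs1.fin_gen ?E'" using vs1.fin_gen_mono[OF E'S S(2)] .
  have AE': "A ` ?E' = A ` S"
  proof
    show "A ` ?E' \<subseteq> A ` S" using E'S by blast
    show "A ` S \<subseteq> A ` ?E'"
    proof
      fix y assume y: "y \<in> A ` S"
      have "g y + s1 0 u \<in> ?E'" using y by blast
      moreover have "y = A (g y + s1 0 u)" using gA[OF y] by simp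
      ultimately show "y \<in> A ` ?E'" by (rule rev_image_eqI)
    qed
  qed
  have "vs1.dim ?E' = r + vs1.dim {w \<in> ?E'. A w = 0}"
    using rank_nullity[OF A E' fE'] AE' rA by simp
  moreover have "vs1.dim {w \<in> ?E'. A w = 0} \<noteq> 0"
  proof
    assume z: "vs1.dim {w \<in> ?E'. A w = 0} = 0"
    have "vs1.subspace {w \<in> ?E'. A w = 0}"
    proof -
      have eq: "{w \<in> ?E'. A w = 0} = ?E' \<inter> {w. A w = 0}" by blast
      show ?thesis unfolding eq by (rule vs1.subspace_inter[OF E' A.subspace_kernel])
    qed
    then have "{w \<in> ?E'. A w = 0} = {0}"
      using vs1.fin_gen_dim_0 vs1.fin_gen_mono[OF _ fE', of "{w \<in> ?E'. A w = 0}"] z by blast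
    moreover have "u \<in> ?E'"
    proof -
      have "0 \<in> ?E" using E vs1.subspace_0 by blast
      then have "0 + s1 1 u \<in> ?E'" by blast
      then show ?thesis by simp
    qed
    ultimately show False using u u0 by auto
  qed
  ultimately have dE': "vs1.dim ?E' > r" by simp
  have ex: "\<exists>q c. q \<in> A ` S \<and> q \<noteq> 0 \<and> s2 s q + B (g q) + s2 c (B u) = 0" for s
  proof -
    let ?L = "\<lambda>u. s2 s (A u) + B u"
    have L: "Vector_Spaces.linear s1 s2 ?L"
      by (intro linear_compose_add linear_compose_scale_right A B)
    interpret L: Vector_Spaces.linear s1 s2 ?L by fact
    have "vs2.dim (?L ` ?E') \<le> vs2.dim (?L ` S)"
      by (rule vs2.fin_gen_dim_mono[OF image_mono[OF E'S] fin_gen_image[OF L S(2)]])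
    then have "vs2.dim (?L ` ?E') < vs1.dim ?E'" using r[of s] dE' by simp
    then obtain w where w: "w \<in> ?E'" "?L w = 0" "w \<noteq> 0"
      using dim_image_eq_gen[OF L E' fE'] by fastforce
    then obtain q c where qc: "q \<in> A ` S" "w = g q + s1 c u" by auto
    have "s2 s q + B (g q) + s2 c (B u) = 0"
      using w(2) gA[OF qc(1)] unfolding qc(2) by (simp add: u A.add A.scale B.add B.scale add.assoc)
    \<comment> \<open>With \<open>q = 0\<close> only \<open>c B u = 0\<close> is left, hence
      \<open>c = 0\<close> and \<open>w = 0\<close>.\<close>
    moreover have "q \<noteq> 0"
    proof
      assume "q = 0"
      then have "s2 c (B u) = 0" using calculation by (simp add: g.zero B.zero)
      then have "c = 0" using nin Q vs2.subspace_0 by auto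
      then show False using w(3) qc \<open>q = 0\<close> by (simp add: g.zero)
    qed
    ultimately show ?thesis using qc by blast
  qed
  then obtain q c where q: "\<And>s. q s \<in> A ` S" "\<And>s. q s \<noteq> 0"
    and eq: "\<And>s. s2 s (q s) + B (g (q s)) + s2 (c s) (B u) = 0" by metis
  obtain T :: "'a set" where T: "finite T" "card T = Suc r" using card_ge_obtain[OF big] .
  have "card T \<le> vs2.dim (A ` S)"
  proof (rule vs2.eigenvector_family_card[OF T(1), of "\<lambda>s. s" q])
    fix \<alpha> assume z: "(\<Sum>t\<in>T. s2 (\<alpha> t) (q t)) = 0"
    let ?x = "\<Sum>t\<in>T. s2 (t * \<alpha> t) (q t)"
    have "B (g (\<Sum>t\<in>T. s2 (\<alpha> t) (q t))) = (\<Sum>t\<in>T. s2 (\<alpha> t) (B (g (q t))))"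
      by (simp add: g.sum g.scale B.sum B.scale)
    also have "\<dots> = (\<Sum>t\<in>T. - s2 (t * \<alpha> t) (q t) - s2 (\<alpha> t * c t) (B u))"
    proof (rule sum.cong)
      fix t
      have "B (g (q t)) = - s2 t (q t) - s2 (c t) (B u)" using eq[of t]
        by (simp add: eq_neg_iff_add_eq_0 eq_diff_eq algebra_simps)
      then show "s2 (\<alpha> t) (B (g (q t))) = - s2 (t * \<alpha> t) (q t) - s2 (\<alpha> t * c t) (B u)"
        by (simp add: vs2.scale_right_diff_distrib mult.commute)
    qed simp
    also have "\<dots> = - ?x - s2 (\<Sum>t\<in>T. \<alpha> t * c t) (B u)"
      by (simp add: sum_subtractf sum_negf vs2.scale_sum_left)
    finally have "- ?x = s2 (\<Sum>t\<in>T. \<alpha> t * c t) (B u)" using z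
      by (simp add: g.zero B.zero)
    then have eqx: "?x = - s2 (\<Sum>t\<in>T. \<alpha> t * c t) (B u)" by (metis minus_minus)
    have xin: "?x \<in> A ` S" using Q q by (intro vs2.subspace_sum vs2.subspace_scale) auto
    \<comment> \<open>\<open>?x\<close> lies in the image of \<open>A\<close> and \<open>B u\<close>
      does not, so both sides of \<open>eqx\<close> vanish.\<close>
    have "(\<Sum>t\<in>T. \<alpha> t * c t) = 0"
    proof (rule ccontr)
      assume nz: "(\<Sum>t\<in>T. \<alpha> t * c t) \<noteq> 0"
      then have "B u = s2 (- inverse (\<Sum>t\<in>T. \<alpha> t * c t)) ?x" by (simp add: eqx)
      moreover have "s2 (- inverse (\<Sum>t\<in>T. \<alpha> t * c t)) ?x \<in> A ` S"
        using Q(1) xin by (rule vs2.subspace_scale)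
      ultimately show False using nin by simp
    qed
    then show "?x = 0" using eqx by simp
  qed (use q Q in auto)
  then show False using rA T by simp
qed

end

section \<open>Linear forms and resolvents\<close>

context linear_space
begin

lemma dim_kernels:
  assumes "finite I" "subspace S" "fin_gen S" "\<And>i. i \<in> I \<Longrightarrow> Vector_Spaces.linear scale (*) (g i)"
  shows "dim S \<le> dim {u \<in> S. \<forall>i\<in>I. g i u = 0} + card I"
  using assms(1,4)
proof (induction I rule: finite_induct)
  case empty
  then show ?case by simp
next
  case (insert i I)
  interpret F: linear_space "(*) :: 'a \<Rightarrow> 'a \<Rightarrow> 'a" by (rule linear_space_field)
  interpret P: linear_space_pair scale "(*) :: 'a \<Rightarrow> 'a \<Rightarrow> 'a" by unfold_locales
  let ?S = "{u \<in> S. \<forall>i\<in>I. g i u = 0}"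
  have sub: "subspace ?S"
  proof (rule subspaceI)
    show "0 \<in> ?S" using assms(2) insert.prems by (auto intro: subspace_0 P.linear_0)
    show "x + y \<in> ?S" if "x \<in> ?S" "y \<in> ?S" for x y
      using that assms(2) insert.prems by (auto intro: subspace_add simp: P.linear_add)
    show "scale c x \<in> ?S" if "x \<in> ?S" for x c
      using that assms(2) insert.prems by (auto intro: subspace_scale simp: P.linear_scale)
  qed
  have fg: "fin_gen ?S" using assms(3) fin_gen_mono[of ?S S] by auto
  have "dim ?S = F.dim (g i ` ?S) + dim {u \<in> ?S. g i u = 0}"
    using insert.prems by (intro P.rank_nullity sub fg) auto
  moreover have "F.dim (g i ` ?S) \<le> card {1 :: 'a}"
  proof (rule F.dim_le_card)
    show "g i ` ?S \<subseteq> F.span {1}" by (auto simp: F.span_singleton)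
  qed simp
  moreover have "{u \<in> ?S. g i u = 0} = {u \<in> S. \<forall>j\<in>insert i I. g j u = 0}" by auto
  ultimately show ?case using insert by simp
qed

lemma form_exists:
  assumes "subspace Q" "w \<notin> Q"
  obtains \<phi> where "Vector_Spaces.linear scale (*) \<phi>" "\<And>v. v \<in> Q \<Longrightarrow> \<phi> v = (0::'a)" "\<phi> w = 1"
proof -
  interpret F: linear_space "(*) :: 'a \<Rightarrow> 'a \<Rightarrow> 'a" by (rule linear_space_field)
  interpret P: linear_space_pair scale "(*) :: 'a \<Rightarrow> 'a \<Rightarrow> 'a" by unfold_locales
  obtain B where B: "B \<subseteq> Q" "independent B" "Q \<subseteq> span B"
    using maximal_independent_subset by blast
  have sp: "span B = Q" using B assms by (simp add: span_subspace)
  then have ind: "independent (insert w B)" using B assms independent_insertI by blast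
  obtain \<phi> where \<phi>: "\<forall>x\<in>insert w B. \<phi> x = (if x = w then 1 else 0)" "Vector_Spaces.linear scale (*) \<phi>"
    using P.linear_independent_extend[OF ind, of "\<lambda>x. if x = w then 1 else 0"] by metis
  have "w \<notin> B" using B assms by auto
  then have "\<phi> b = 0" if "b \<in> B" for b using \<phi>(1) that by auto
  then have "\<phi> v = 0" if "v \<in> Q" for v using P.linear_eq_0_on_span[OF \<phi>(2)] sp that by blast
  then show ?thesis using that \<phi> by auto
qed

text \<open>Induction on the number of forms. If \<open>g i\<close> is nonzero at some common zero
  \<open>w\<close> of the others, subtracting \<open>k\<close> times \<open>g i\<close> makes
  \<open>\<alpha>\<close> vanish at \<open>w\<close>, and the others suffice for the difference;
  otherwise \<open>g i\<close> imposes no further condition.\<close>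

lemma form_in_combination:
  assumes "finite I" "\<And>i. i \<in> I \<Longrightarrow> Vector_Spaces.linear scale (*) (g i)" "Vector_Spaces.linear scale (*) \<alpha>"
    "\<And>v. (\<And>i. i \<in> I \<Longrightarrow> g i v = 0) \<Longrightarrow> \<alpha> v = (0::'a)"
  shows "\<exists>c. \<forall>v. \<alpha> v = (\<Sum>i\<in>I. c i * g i v)"
proof -
  interpret P: linear_space_pair scale "(*) :: 'a \<Rightarrow> 'a \<Rightarrow> 'a"
    using linear_space_field linear_space_axioms by (simp add: linear_space_pair_def)
  show ?thesis
    using assms(1,2,4,3)
  proof (induction I arbitrary: \<alpha> rule: finite_induct)
    case empty
    then show ?case by simp
  next
    case (insert i I)
    note l = insert.prems(1) insert.prems(3)
    show ?case
    proof (cases "\<exists>w. (\<forall>j\<in>I. g j w = 0) \<and> g i w \<noteq> 0")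
      case True
      then obtain w where w: "\<forall>j\<in>I. g j w = 0" "g i w \<noteq> 0" by blast
      define k where "k = \<alpha> w / g i w"
      have lin: "Vector_Spaces.linear scale (*) (\<lambda>v. \<alpha> v - k * g i v)"
        by (rule P.linear_compose_sub[OF l(2) P.linear_compose_scale_right[OF l(1)]]) simp
      have "\<exists>c. \<forall>v. \<alpha> v - k * g i v = (\<Sum>j\<in>I. c j * g j v)"
      proof (rule insert.IH[OF _ _ lin])
        fix v assume v: "\<And>j. j \<in> I \<Longrightarrow> g j v = 0"
        let ?v = "v - scale (g i v / g i w) w"
        have d: "h (v - scale a w) = h v - a * h w" if "Vector_Spaces.linear scale (*) h" for h :: "'b \<Rightarrow> 'a" and a
          using that by (simp add: P.linear_diff P.linear_scale)
        have "\<alpha> ?v = 0"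
        proof (rule insert.prems(2))
          fix j assume "j \<in> insert i I"
          then show "g j ?v = 0" using v w l d[of "g j"] by auto
        qed
        then have "\<alpha> v - g i v / g i w * \<alpha> w = 0" using d[OF l(2)] by simp
        then show "\<alpha> v - k * g i v = 0" by (simp add: k_def)
      qed (use l in auto)
      then obtain c where c: "\<forall>v. \<alpha> v - k * g i v = (\<Sum>j\<in>I. c j * g j v)" by blast
      have "\<alpha> v = (\<Sum>j\<in>insert i I. (c(i := k)) j * g j v)" for v
      proof -
        have "(\<Sum>j\<in>I. (c(i := k)) j * g j v) = (\<Sum>j\<in>I. c j * g j v)"
          using insert.hyps by (intro sum.cong) auto
        then show ?thesis using c[rule_format, of v] insert.hyps by (simp add: algebra_simps)
      qed
      then show ?thesis by blast
    next
      case False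
      have "\<exists>c. \<forall>v. \<alpha> v = (\<Sum>j\<in>I. c j * g j v)"
      proof (rule insert.IH[OF _ _ l(2)])
        fix v assume v: "\<And>j. j \<in> I \<Longrightarrow> g j v = 0"
        then have "g i v = 0" using False by blast
        then show "\<alpha> v = 0" using v insert.prems(2)[of v] by blast
      qed (use l in auto)
      then obtain c where c: "\<forall>v. \<alpha> v = (\<Sum>j\<in>I. c j * g j v)" by blast
      have "\<alpha> v = (\<Sum>j\<in>insert i I. (c(i := 0)) j * g j v)" for v
      proof -
        have "(\<Sum>j\<in>I. (c(i := 0)) j * g j v) = (\<Sum>j\<in>I. c j * g j v)"
          using insert.hyps by (intro sum.cong) auto
        then show ?thesis using c[rule_format, of v] insert.hyps by simp
      qed
      then show ?thesis by blast
    qed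
  qed
qed

text \<open>For distinct \<open>t\<close> the vectors \<open>(1 - t v)\<^sup>-\<^sup>1 w\<close> are eigenvectors of \<open>v\<close> modulo \<open>w\<close>,
  so they are too many to be contained in \<open>E\<close> unless their span is stable under \<open>v\<close>.\<close>

lemma resolvent_invariant:
  assumes v: "Vector_Spaces.linear scale scale v" and E: "subspace E" "fin_gen E"
    and big: "card_ge TYPE('a) (Suc (dim E))"
    and p: "\<And>t. p t \<in> E" "\<And>t. p t - scale t (v (p t)) = w"
  obtains C where "subspace C" "C \<subseteq> E" "w \<in> C" "\<And>c. c \<in> C \<Longrightarrow> v c \<in> C"
proof -
  interpret v: Vector_Spaces.linear scale scale v by fact
  let ?C1 = "span (p ` (UNIV - {0}))"
  have C1E: "?C1 \<subseteq> E" using p(1) E by (intro span_minimal) auto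
  have p0: "p 0 = w" using p(2)[of 0] by simp
  have vp: "v (p t) = scale (inverse t) (p t) - scale (inverse t) w" if "t \<noteq> 0" for t
  proof -
    have "scale (inverse t) (p t) - v (p t) = scale (inverse t) w"
      using that p(2)[of t] by (metis left_inverse scale_one scale_right_diff_distrib scale_scale)
    then show ?thesis by (metis diff_diff_eq2 add_diff_cancel_left' diff_add_cancel)
  qed
  have "w \<in> ?C1"
  proof (rule ccontr)
    assume nin: "w \<notin> ?C1"
    then have w0: "w \<noteq> 0" using span_zero by blast
    obtain T :: "'a set" where T: "finite T" "card T = Suc (dim E)" using card_ge_obtain[OF big] .
    \<comment> \<open>The eigenvalue equation \<open>vp\<close> requires
      \<open>t \<noteq> 0\<close>; dropping 0 still leaves at least \<open>dim E\<close>
      scalars.\<close>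
    let ?T = "T - {0}"
    have c1: "dim E \<le> card ?T" using T by (cases "0 \<in> T") auto
    have "card ?T \<le> dim ?C1"
    proof (rule eigenvector_family_card[of ?T inverse p])
      fix \<alpha> assume z: "(\<Sum>t\<in>?T. scale (\<alpha> t) (p t)) = 0"
      let ?x = "\<Sum>t\<in>?T. scale (inverse t * \<alpha> t) (p t)"
      have "v (\<Sum>t\<in>?T. scale (\<alpha> t) (p t)) = (\<Sum>t\<in>?T. scale (\<alpha> t) (v (p t)))"
        by (simp add: v.sum v.scale)
      also have "\<dots> = (\<Sum>t\<in>?T. scale (inverse t * \<alpha> t) (p t) - scale (inverse t * \<alpha> t) w)"
        by (rule sum.cong) (auto simp: vp scale_right_diff_distrib mult.commute)
      also have "\<dots> = ?x - scale (\<Sum>t\<in>?T. inverse t * \<alpha> t) w"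
        by (simp add: sum_subtractf scale_sum_left)
      finally have eqx: "?x = scale (\<Sum>t\<in>?T. inverse t * \<alpha> t) w" using z by (simp add: v.zero)
      have xin: "?x \<in> ?C1" by (intro span_sum span_scale span_base) auto
      have "(\<Sum>t\<in>?T. inverse t * \<alpha> t) = 0"
      proof (rule ccontr)
        assume nz: "(\<Sum>t\<in>?T. inverse t * \<alpha> t) \<noteq> 0"
        have "scale (inverse (\<Sum>t\<in>?T. inverse t * \<alpha> t)) ?x \<in> ?C1" using xin by (rule span_scale)
        then show False using nin nz unfolding eqx by simp
      qed
      then show "?x = 0" using eqx by simp
    next
      fix t show "p t \<noteq> 0" using p(2)[of t] w0 by (metis diff_zero scale_zero_right v.zero)
    qed (use T E C1E fin_gen_mono[OF C1E] in \<open>auto simp: inj_on_def intro: span_base\<close>)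
    \<comment> \<open>Independent vectors as many as \<open>dim E\<close> fill \<open>E\<close>,
      which contains \<open>w = p 0\<close>.\<close>
    then have "?C1 = E" using c1 C1E E fin_gen_dim_eq[of ?C1 E] by auto
    then show False using nin p(1)[of 0] p0 by simp
  qed
  moreover have "v c \<in> ?C1" if "c \<in> ?C1" for c
    using that
  proof (induction rule: span_induct_alt)
    case base
    then show ?case by (simp add: v.zero span_zero)
  next
    case (step a x y)
    then obtain t where t: "t \<noteq> 0" "x = p t" by auto
    have "v x \<in> ?C1" unfolding t vp[OF t(1)]
      using t \<open>w \<in> ?C1\<close> by (auto intro!: span_diff span_scale intro: span_base)
    then show ?case using step by (simp add: v.add v.scale span_add span_scale)
  qed
  ultimately show ?thesis using that[of ?C1] C1E by auto
qed

end

section \<open>Endomorphisms of a right vector space\<close>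

text \<open>For \<open>d > 0\<close> no subtraction truncates and the value is d k (k + 1) / 2 -
  k.\<close>

fun tri_dim :: "nat \<Rightarrow> nat \<Rightarrow> nat" where
  "tri_dim d 0 = 0"
| "tri_dim d (Suc k) = tri_dim d k + (Suc k * d - 1)"

text \<open>In finite dimension this is invertibility of \<open>id - u\<close> (see
  \<open>trivial_spectrum_iff\<close>), in a form that passes to kernels and corners without mention
  of inverses.\<close>

definition nofix :: "('v::ab_group_add \<Rightarrow> 'v) set \<Rightarrow> bool" where
  "nofix S \<longleftrightarrow> (\<forall>u\<in>S. \<forall>v. u v = v \<longrightarrow> v = 0)"

lemma sum_apply: "(\<Sum>i\<in>I. g i) x = (\<Sum>i\<in>I. g i x :: 'c::comm_monoid_add)"
  by (induction I rule: infinite_finite_induct) auto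

lemma linearI_space:
  assumes "linear_space s1" "linear_space s2" "\<And>x y. f (x + y) = f x + f y" "\<And>c x. f (s1 c x) = s2 c (f x)"
  shows "Vector_Spaces.linear s1 s2 f"
  using assms unfolding Vector_Spaces.linear_iff linear_space_def by blast

locale division_space = central_subfield \<iota> + right_vector_space smul
  for \<iota> :: "'f::field \<Rightarrow> 'd::division_ring" and smul :: "'v::ab_group_add \<Rightarrow> 'd \<Rightarrow> 'v" (infixl "\<cdot>" 70) +
  fixes BD :: "'d set" and BV :: "'v set"
  assumes fdD: "finite_dimensional_vector_space (ring_scale \<iota>) BD"
    and fdV: "finite_dimensional_vector_space (vec_scale \<iota> smul) BV"
begin

abbreviation "vs \<equiv> vec_scale \<iota> smul"
abbreviation "es \<equiv> end_scale \<iota> smul"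
abbreviation "ds \<equiv> ring_scale \<iota>"
abbreviation "d \<equiv> card BD"
abbreviation "form \<equiv> Vector_Spaces.linear vs ((*) :: 'f \<Rightarrow> 'f \<Rightarrow> 'f)"

lemma loc_ax: "central_subfield \<iota>" "right_vector_space smul"
  by unfold_locales

sublocale F: linear_space "(*) :: 'f \<Rightarrow> 'f \<Rightarrow> 'f" by (rule linear_space_field)
sublocale D: linear_space ds using fdD by (simp add: linear_space_def finite_dimensional_vector_space_def)
sublocale V: linear_space vs using fdV by (simp add: linear_space_def finite_dimensional_vector_space_def)
sublocale E: linear_space es using vector_space_end_scale[OF loc_ax] by (simp add: linear_space_def)
sublocale D: finite_dimensional_vector_space ds BD by (rule fdD)
sublocale V: finite_dimensional_vector_space vs BV by (rule fdV)
sublocale EV: linear_space_pair es vs ..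
sublocale EE: linear_space_pair es es ..
sublocale ED: linear_space_pair es ds ..
sublocale DE: linear_space_pair ds es ..
sublocale VE: linear_space_pair vs es ..
sublocale VV: linear_space_pair vs vs ..
sublocale VD: linear_space_pair vs ds ..
sublocale DV: linear_space_pair ds vs ..
sublocale VF: linear_space_pair vs "(*) :: 'f \<Rightarrow> 'f \<Rightarrow> 'f" ..
sublocale DF: linear_space_pair ds "(*) :: 'f \<Rightarrow> 'f \<Rightarrow> 'f" ..

lemmas spaces = F.linear_space_axioms D.linear_space_axioms V.linear_space_axioms E.linear_space_axioms

lemma V_fin_gen [simp]: "V.fin_gen S"
  unfolding V.fin_gen_def using V.finite_Basis V.span_Basis by blast

lemma D_fin_gen [simp]: "D.fin_gen S"
  unfolding D.fin_gen_def using D.finite_Basis D.span_Basis by blast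

lemma smul_zero [simp]: "0 \<cdot> q = 0" "v \<cdot> 0 = 0"
  using smul_add_left[of 0 0 q] smul_add_right[of v 0 0] by auto

lemma smul_minus [simp]: "(- v) \<cdot> q = - (v \<cdot> q)" "v \<cdot> (- q) = - (v \<cdot> q)"
  using smul_add_left[of v "- v" q] smul_add_right[of v q "- q"] by (auto simp: eq_neg_iff_add_eq_0 add.commute)

lemma smul_diff_left: "(v - w) \<cdot> q = v \<cdot> q - w \<cdot> q"
  using smul_add_left[of v "- w" q] by simp

lemma smul_diff_right: "v \<cdot> (p - q) = v \<cdot> p - v \<cdot> q"
  using smul_add_right[of v p "- q"] by simp

lemma smul_smul: "v \<cdot> p \<cdot> q = v \<cdot> (p * q)"
  by (simp add: smul_mult)

lemma smul_eq_0 [simp]: "v \<cdot> q = 0 \<longleftrightarrow> v = 0 \<or> q = 0"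
proof
  assume eq: "v \<cdot> q = 0"
  show "v = 0 \<or> q = 0"
  proof (rule disjCI)
    assume "q \<noteq> 0"
    then have "v \<cdot> q \<cdot> inverse q = v" by (simp add: smul_smul smul_one)
    then show "v = 0" by (simp add: eq)
  qed
qed auto

lemma smul_sum_right: "v \<cdot> (\<Sum>i\<in>I. g i) = (\<Sum>i\<in>I. v \<cdot> g i)"
  by (induction I rule: infinite_finite_induct) (auto simp: smul_add_right)

lemma smul_sum_left: "(\<Sum>i\<in>I. g i) \<cdot> q = (\<Sum>i\<in>I. g i \<cdot> q)"
  by (induction I rule: infinite_finite_induct) (auto simp: smul_add_left)

lemma embed_0 [simp]: "\<iota> 0 = 0"
  using embed_add[of 0 0] by simp

lemma embed_neg: "\<iota> (- a) = - \<iota> a"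
  using embed_add[of a "- a"] by (simp add: eq_neg_iff_add_eq_0 add.commute)

lemma embed_eq_0 [simp]: "\<iota> a = 0 \<longleftrightarrow> a = 0"
proof
  assume "\<iota> a = 0"
  then have "\<iota> (a * inverse a) = 0" by (simp add: embed_mult)
  then show "a = 0" using embed_one by (cases "a = 0") auto
qed simp

lemma embed_inverse: "\<iota> (inverse a) = inverse (\<iota> a)"
  by (cases "a = 0") (auto intro!: inverse_unique[symmetric] simp: embed_mult[symmetric] embed_one)

lemma d_pos: "d > 0"
proof (rule ccontr)
  assume "\<not> d > 0"
  then have "BD = {}" using D.finite_Basis by simp
  then have "(1::'d) \<in> {0}" using D.span_Basis D.span_empty by (metis UNIV_I)
  then show False by simp
qed

section \<open>D-linear forms and endomorphisms\<close>

definition dlin :: "('v \<Rightarrow> 'd) \<Rightarrow> bool" where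
  "dlin f \<longleftrightarrow> (\<forall>v w. f (v + w) = f v + f w) \<and> (\<forall>v q. f (v \<cdot> q) = f v * q)"

lemma dlin_add: "dlin f \<Longrightarrow> f (v + w) = f v + f w"
  and dlin_smul: "dlin f \<Longrightarrow> f (v \<cdot> q) = f v * q"
  by (auto simp: dlin_def)

lemma dlin_0: "dlin f \<Longrightarrow> f 0 = 0"
  using dlin_smul[of f 0 0] by simp

lemma dlin_diff: "dlin f \<Longrightarrow> f (v - w) = f v - f w"
  using dlin_add[of f "v - w" w] by (simp add: eq_diff_eq)

lemma dlin_linear: "dlin f \<Longrightarrow> Vector_Spaces.linear vs ds f"
  by (rule linearI_space) (auto simp: spaces dlin_def vec_scale_def ring_scale_def embed_central)

lemma End_add: "u \<in> End smul \<Longrightarrow> u (v + w) = u v + u w"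
  and End_smul: "u \<in> End smul \<Longrightarrow> u (v \<cdot> q) = u v \<cdot> q"
  by (auto simp: End_def)

lemma End_0: "u \<in> End smul \<Longrightarrow> u 0 = 0"
  using End_smul[of u 0 0] by simp

lemma End_diff: "u \<in> End smul \<Longrightarrow> u (v - w) = u v - u w"
  using End_add[of u "v - w" w] by (simp add: eq_diff_eq)

lemma End_linear: "u \<in> End smul \<Longrightarrow> Vector_Spaces.linear vs vs u"
  by (rule linearI_space) (auto simp: spaces End_def vec_scale_def)

lemma End_rank1: "dlin f \<Longrightarrow> (\<lambda>v. z \<cdot> f v) \<in> End smul"
  by (simp add: End_def dlin_add dlin_smul smul_add_right smul_smul)

lemma End_comp: "u \<in> End smul \<Longrightarrow> w \<in> End smul \<Longrightarrow> (\<lambda>v. u (w v)) \<in> End smul"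
  by (simp add: End_def)

lemma End_sub: "u \<in> End smul \<Longrightarrow> w \<in> End smul \<Longrightarrow> (\<lambda>v. u v - w v) \<in> End smul"
  by (simp add: End_def smul_diff_left)

lemma End_sum2: "u \<in> End smul \<Longrightarrow> w \<in> End smul \<Longrightarrow> (\<lambda>v. u v + w v) \<in> End smul"
  by (simp add: End_def smul_add_left)

lemma End_id: "(\<lambda>v. v) \<in> End smul"
  by (simp add: End_def)

lemma linear_eval: "Vector_Spaces.linear es vs (\<lambda>u. u x)"
  by (rule linearI_space) (auto simp: spaces end_scale_def)

lemma linear_precomp: "Vector_Spaces.linear es es (\<lambda>u v. u (g v))"
  by (rule linearI_space) (auto simp: spaces end_scale_def)

lemma linear_comp: "Vector_Spaces.linear s1 s2 f \<Longrightarrow> Vector_Spaces.linear s2 s3 g \<Longrightarrow> Vector_Spaces.linear s1 s3 (\<lambda>x. g (f x))"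
  using Vector_Spaces.linear_compose[of s1 s2 f s3 g] by (simp add: o_def)

lemma linear_postcomp: "Vector_Spaces.linear vs vs g \<Longrightarrow> Vector_Spaces.linear es es (\<lambda>u v. g (u v))"
  by (rule linearI_space) (auto simp: spaces end_scale_def VV.linear_add VV.linear_scale)

lemma linear_smul_right: "Vector_Spaces.linear ds vs (\<lambda>q. x \<cdot> q)"
  by (rule linearI_space) (auto simp: spaces smul_add_right vec_scale_def ring_scale_def embed_central smul_smul)

lemma linear_smul_left: "Vector_Spaces.linear vs vs (\<lambda>v. v \<cdot> q)"
  by (rule linearI_space) (auto simp: spaces smul_add_left vec_scale_def embed_central smul_smul)

lemma linear_rank1: "Vector_Spaces.linear vs es (\<lambda>z v. z \<cdot> f v)"
  by (rule linearI_space) (auto simp: spaces smul_add_left vec_scale_def end_scale_def embed_central smul_smul)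

lemma linear_rank1': "Vector_Spaces.linear ds es (\<lambda>p v. z \<cdot> (p * g v))"
  by (rule linearI_space)
    (simp_all add: spaces smul_add_right distrib_right ring_scale_def vec_scale_def end_scale_def smul_smul fun_eq_iff
      embed_central[symmetric] mult.assoc)

lemma form_smul: "form \<phi> \<Longrightarrow> form (\<lambda>v. \<phi> (v \<cdot> q))"
  by (rule linear_comp[OF linear_smul_left])

lemma form_smul_right: "form \<phi> \<Longrightarrow> Vector_Spaces.linear ds (*) (\<lambda>q. \<phi> (x \<cdot> q))"
  by (rule linear_comp[OF linear_smul_right])

lemma form_eval: "form \<phi> \<Longrightarrow> Vector_Spaces.linear es (*) (\<lambda>u. \<phi> (u x))"
  by (rule linear_comp[OF linear_eval])

lemma form_End: "form \<phi> \<Longrightarrow> u \<in> End smul \<Longrightarrow> form (\<lambda>v. \<phi> (u v))"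
  by (rule linear_comp[OF End_linear])

lemma form_add: "form \<phi> \<Longrightarrow> \<phi> (v + w) = \<phi> v + \<phi> w"
  and form_diff: "form \<phi> \<Longrightarrow> \<phi> (v - w) = \<phi> v - \<phi> w"
  and form_0: "form \<phi> \<Longrightarrow> \<phi> 0 = 0"
  and form_scale: "form \<phi> \<Longrightarrow> \<phi> (v \<cdot> \<iota> a) = a * \<phi> v"
  and form_sum: "form \<phi> \<Longrightarrow> \<phi> (\<Sum>i\<in>I. g i) = (\<Sum>i\<in>I. \<phi> (g i))"
  using VF.linear_scale[of \<phi> a v]
  by (auto simp: VF.linear_add VF.linear_diff VF.linear_0 VF.linear_sum vec_scale_def)

lemma right_subspace_subspace: "right_subspace smul W \<Longrightarrow> V.subspace W"
  by (auto simp: right_subspace_def V.subspace_def vec_scale_def)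

lemma End_subspace: "E.subspace (End smul)"
  by (rule subspace_End[OF loc_ax])

text \<open>The maps \<open>?E\<close> are matrix units over F. They need not be D-linear, but a
  finite set whose span contains \<open>End smul\<close> is enough.\<close>

lemma End_fin_gen: "E.fin_gen (End smul)"
proof -
  let ?E = "\<lambda>(b, b'). \<lambda>v. vs (V.representation BV v b) b'"
  have "u \<in> E.span (?E ` (BV \<times> BV))" if u: "u \<in> End smul" for u
  proof -
    interpret u: Vector_Spaces.linear vs vs u using End_linear[OF u] .
    have rep: "v = (\<Sum>b\<in>BV. vs (V.representation BV v b) b)" for v
      using V.sum_representation_eq[OF V.independent_Basis _ V.finite_Basis subset_refl, of v]
      by (simp only: V.span_Basis UNIV_I simp_thms)
    have eq: "u = (\<Sum>p\<in>BV \<times> BV. es (V.representation BV (u (fst p)) (snd p)) (?E p))"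
    proof
      fix v
      have "u v = u (\<Sum>b\<in>BV. vs (V.representation BV v b) b)" using rep by metis
      also have "\<dots> = (\<Sum>b\<in>BV. vs (V.representation BV v b) (u b))" by (simp add: u.sum u.scale)
      also have "\<dots> = (\<Sum>b\<in>BV. vs (V.representation BV v b) (\<Sum>b'\<in>BV. vs (V.representation BV (u b) b') b'))"
        using rep by metis
      also have "\<dots> = (\<Sum>b\<in>BV. \<Sum>b'\<in>BV. vs (V.representation BV (u b) b') (vs (V.representation BV v b) b'))"
        by (simp add: V.scale_sum_right mult.commute)
      also have "\<dots> = (\<Sum>p\<in>BV \<times> BV. es (V.representation BV (u (fst p)) (snd p)) (?E p) v)"
        by (simp add: sum.cartesian_product end_scale_def case_prod_unfold)
      also have "\<dots> = (\<Sum>p\<in>BV \<times> BV. es (V.representation BV (u (fst p)) (snd p)) (?E p)) v"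
        by (simp add: sum_apply)
      finally show "u v = \<dots>" .
    qed
    show ?thesis unfolding arg_cong[OF eq, of "\<lambda>w. w \<in> E.span (?E ` (BV \<times> BV))"]
      by (rule E.span_sum, rule E.span_scale, rule E.span_base, rule imageI)
  qed
  then show ?thesis unfolding E.fin_gen_def
    by (intro exI[of _ "?E ` (BV \<times> BV)"] conjI finite_imageI finite_cartesian_product V.finite_Basis subsetI)
qed

lemma End_sub_fin_gen: "S \<subseteq> End smul \<Longrightarrow> E.fin_gen S"
  using End_fin_gen E.fin_gen_mono by blast

lemma dim_line:
  assumes "x \<noteq> 0"
  shows "V.dim (range (\<lambda>q. x \<cdot> q)) = d"
proof -
  have "V.dim (range (\<lambda>q. x \<cdot> q)) = D.dim UNIV"
    using assms by (intro DV.dim_image_eq_gen[OF linear_smul_right]) auto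
  then show ?thesis by (simp only: D.dim_UNIV)
qed

text \<open>The pairing \<open>\<phi> (x \<cdot> p \<cdot> q)\<close> of \<open>p\<close> and
  \<open>q\<close> in D is nondegenerate, because D has inverses and
  \<open>\<phi> x \<noteq> 0\<close>. So each form \<open>q \<mapsto> \<phi> (v \<cdot> q)\<close>
  is represented by exactly one \<open>p\<close>, and this is \<open>f v\<close>. The kernel of
  \<open>f\<close> is the largest D-subspace inside the kernel of \<open>\<phi>\<close> and a
  complement of \<open>x D\<close>.\<close>

lemma form_split:
  assumes \<phi>: "form \<phi>" and x: "\<phi> x \<noteq> 0"
  obtains f where "dlin f" "f x = 1" "\<And>v. f v = 0 \<longleftrightarrow> (\<forall>q. \<phi> (v \<cdot> q) = 0)"
proof -
  have x0: "p = 0" if "\<And>q. \<phi> (x \<cdot> p \<cdot> q) = 0" for p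
  proof (rule ccontr)
    assume "p \<noteq> 0"
    then have "x \<cdot> p \<cdot> inverse p = x" by (simp add: smul_smul smul_one)
    then show False using that[of "inverse p"] x by simp
  qed
  have ex: "\<exists>p. \<forall>q. \<phi> ((v - x \<cdot> p) \<cdot> q) = 0" for v
  proof -
    have "\<exists>c. \<forall>q. \<phi> (v \<cdot> q) = (\<Sum>p\<in>BD. c p * \<phi> (x \<cdot> p \<cdot> q))"
    proof (rule D.form_in_combination)
      show "Vector_Spaces.linear ds (*) (\<lambda>q. \<phi> (x \<cdot> p \<cdot> q))" for p
        by (rule form_smul_right[OF \<phi>])
      show "Vector_Spaces.linear ds (*) (\<lambda>q. \<phi> (v \<cdot> q))" by (rule form_smul_right[OF \<phi>])
      fix q assume q: "\<And>p. p \<in> BD \<Longrightarrow> \<phi> (x \<cdot> p \<cdot> q) = 0"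
      have "\<phi> (x \<cdot> p \<cdot> q) = 0" for p
        using DF.linear_eq_0_on_span[OF form_smul_right[OF form_smul[OF \<phi>]], of BD x q p] q D.span_Basis
        by auto
      have "q = 0"
      proof (rule ccontr)
        assume "q \<noteq> 0"
        then have "x \<cdot> inverse q \<cdot> q = x" by (simp add: smul_smul smul_one)
        then show False using \<open>\<phi> (x \<cdot> inverse q \<cdot> q) = 0\<close> x by simp
      qed
      then show "\<phi> (v \<cdot> q) = 0" using form_0[OF \<phi>] by simp
    qed (rule D.finite_Basis)
    then obtain c where c: "\<forall>q. \<phi> (v \<cdot> q) = (\<Sum>p\<in>BD. c p * \<phi> (x \<cdot> p \<cdot> q))" by blast
    let ?p = "\<Sum>p\<in>BD. \<iota> (c p) * p"
    have "\<phi> (x \<cdot> ?p \<cdot> q) = \<phi> (v \<cdot> q)" for q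
    proof -
      have "x \<cdot> ?p \<cdot> q = (\<Sum>p\<in>BD. x \<cdot> p \<cdot> q \<cdot> \<iota> (c p))"
        by (simp add: smul_sum_right smul_sum_left smul_smul embed_central mult.assoc)
      then show ?thesis using c by (simp add: form_sum[OF \<phi>] form_scale[OF \<phi>])
    qed
    then show ?thesis by (intro exI[of _ ?p]) (simp add: smul_diff_left form_diff[OF \<phi>])
  qed
  then obtain f where f: "\<And>v q. \<phi> ((v - x \<cdot> f v) \<cdot> q) = 0" by metis
  have uniq: "f v = p" if "\<And>q. \<phi> ((v - x \<cdot> p) \<cdot> q) = 0" for v p
  proof -
    have "x \<cdot> (f v - p) = (v - x \<cdot> p) - (v - x \<cdot> f v)" by (simp add: smul_diff_right)
    then have "\<phi> (x \<cdot> (f v - p) \<cdot> q) = 0" for q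
      using that[of q] f[of v q] by (simp only: smul_diff_left[of "v - x \<cdot> p"] form_diff[OF \<phi>]) simp
    then show ?thesis using x0[of "f v - p"] by simp
  qed
  have add: "f (v + w) = f v + f w" for v w
  proof (rule uniq)
    fix q
    have "v + w - x \<cdot> (f v + f w) = (v - x \<cdot> f v) + (w - x \<cdot> f w)" by (simp add: smul_add_right)
    then show "\<phi> ((v + w - x \<cdot> (f v + f w)) \<cdot> q) = 0"
      using f by (simp only: smul_add_left form_add[OF \<phi>]) simp
  qed
  have sm: "f (v \<cdot> p) = f v * p" for v p
  proof (rule uniq)
    fix q
    have "(v \<cdot> p - x \<cdot> (f v * p)) \<cdot> q = (v - x \<cdot> f v) \<cdot> (p * q)"
      by (simp add: smul_diff_left smul_smul mult.assoc)
    then show "\<phi> ((v \<cdot> p - x \<cdot> (f v * p)) \<cdot> q) = 0" using f by simp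
  qed
  have "f x = 1" by (rule uniq) (simp add: smul_one form_0[OF \<phi>])
  moreover have "f v = 0 \<longleftrightarrow> (\<forall>q. \<phi> (v \<cdot> q) = 0)" for v
    using f[of v] uniq[of v 0] by auto
  moreover have "dlin f" using add sm by (simp add: dlin_def)
  ultimately show ?thesis using that by blast
qed

lemma End_inverse:
  assumes u: "u \<in> End smul" and inj: "\<And>v. u v = 0 \<Longrightarrow> v = 0"
  obtains w where "w \<in> End smul" "\<And>v. u (w v) = v" "\<And>v. w (u v) = v"
proof -
  have i: "inj u" unfolding VV.linear_inj_iff_eq_0[OF End_linear[OF u]] using inj by blast
  have s: "surj u" by (rule V.linear_inj_imp_surj[OF End_linear[OF u] i])
  have r: "u (inv u v) = v" for v using s by (rule surj_f_inv_f)
  have l: "inv u (u v) = v" for v using i by (rule inv_f_f)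
  have "inv u \<in> End smul" unfolding End_def
  proof (intro CollectI conjI allI)
    show "inv u (v + w) = inv u v + inv u w" for v w using l r End_add[OF u] by metis
    show "inv u (v \<cdot> q) = inv u v \<cdot> q" for v q using l r End_smul[OF u] by metis
  qed
  then show ?thesis using that l r by blast
qed

lemma trivial_spectrum_iff:
  "trivial_spectrum_subspace \<iota> smul S \<longleftrightarrow> S \<subseteq> End smul \<and> E.subspace S \<and> nofix S"
proof -
  have key: "(\<exists>w\<in>End smul. w \<circ> (id - u) = id \<and> (id - u) \<circ> w = id) \<longleftrightarrow> (\<forall>v. u v = v \<longrightarrow> v = 0)"
    if u: "u \<in> End smul" for u
  proof
    assume "\<exists>w\<in>End smul. w \<circ> (id - u) = id \<and> (id - u) \<circ> w = id"
    then obtain w where w: "w \<in> End smul" "\<And>v. w (v - u v) = v" by (auto simp: fun_eq_iff)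
    show "\<forall>v. u v = v \<longrightarrow> v = 0"
    proof (intro allI impI)
      fix v assume "u v = v"
      then show "v = 0" using w(2)[of v] End_0[OF w(1)] by simp
    qed
  next
    assume nf: "\<forall>v. u v = v \<longrightarrow> v = 0"
    let ?g = "id - u"
    have g: "?g \<in> End smul" using End_sub[OF End_id u] by (simp add: fun_diff_def id_def)
    obtain w where w: "w \<in> End smul" "\<And>v. ?g (w v) = v" "\<And>v. w (?g v) = v"
      by (rule End_inverse[OF g]) (use nf in auto)
    have "w \<circ> ?g = id" "?g \<circ> w = id" using w(2,3) by (auto simp: fun_eq_iff)
    with w(1) show "\<exists>w\<in>End smul. w \<circ> (id - u) = id \<and> (id - u) \<circ> w = id" by blast
  qed
  show ?thesis unfolding trivial_spectrum_subspace_def nofix_def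
    by (rule conj_cong[OF refl], rule conj_cong[OF refl], rule ball_cong[OF refl], rule key) blast
qed

section \<open>The dimension bound\<close>

definition idem :: "('v \<Rightarrow> 'v) \<Rightarrow> bool" where
  "idem e \<longleftrightarrow> e \<in> End smul \<and> (\<forall>v. e (e v) = e v)"

text \<open>This is \<open>e End e\<close>, the endomorphisms of the D-space \<open>range e\<close>,
  extended by zero on the kernel of \<open>e\<close>. Subspaces are encoded by idempotents so that
  the induction over hyperplanes stays inside one type.\<close>

definition corner :: "('v \<Rightarrow> 'v) \<Rightarrow> ('v \<Rightarrow> 'v) set" where
  "corner e = {u \<in> End smul. \<forall>v. e (u v) = u v \<and> u (e v) = u v}"

lemma corner_End: "S \<subseteq> corner e \<Longrightarrow> S \<subseteq> End smul"
  by (auto simp: corner_def)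

lemma corner_subspace: "idem e \<Longrightarrow> E.subspace (corner e)"
  unfolding corner_def idem_def
  using End_subspace
  by (auto simp: E.subspace_def End_0 End_add end_scale_def vec_scale_def End_smul)

lemma corner_fin_gen: "S \<subseteq> corner e \<Longrightarrow> E.fin_gen S"
  by (rule End_sub_fin_gen) (rule corner_End)

lemma End_range_subspace: "u \<in> End smul \<Longrightarrow> V.subspace (range u)"
  using VV.linear_subspace_image[OF End_linear] by simp

lemma eval_subspace: "E.subspace S \<Longrightarrow> V.subspace ((\<lambda>u. u x) ` S)"
  by (rule EV.linear_subspace_image[OF linear_eval])

lemma eval_corner: "S \<subseteq> corner e \<Longrightarrow> (\<lambda>u. u x) ` S \<subseteq> range e"
  unfolding corner_def by (auto intro: range_eqI[OF sym])

lemma kernel_subspace: "E.subspace S \<Longrightarrow> E.subspace {u \<in> S. u x = 0}"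
  by (auto simp: E.subspace_def end_scale_def vec_scale_def)

lemma eval_dim_less:
  assumes "E.subspace S" "S \<subseteq> corner e" "nofix S" "idem e" "e x = x" "x \<noteq> 0"
  shows "V.dim ((\<lambda>u. u x) ` S) < V.dim (range e)" "x \<notin> (\<lambda>u. u x) ` S"
proof -
  show nin: "x \<notin> (\<lambda>u. u x) ` S" using assms(3,6) by (auto simp: nofix_def)
  have "(\<lambda>u. u x) ` S \<noteq> range e" using nin assms(5) by (metis rangeI)
  then show "V.dim ((\<lambda>u. u x) ` S) < V.dim (range e)"
    using V.fin_gen_dim_eq[OF eval_subspace[OF assms(1)] eval_corner[OF assms(2)] V_fin_gen]
    by (meson not_le_imp_less)
qed

text \<open>Evaluation at \<open>x \<cdot> \<iota> s + e y\<close> is the pencil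
  \<open>s A + B\<close> of the evaluations \<open>A\<close> at \<open>x\<close> and
  \<open>B\<close> at \<open>e y\<close>; maximality of the rank at \<open>x\<close> bounds the
  whole pencil.\<close>

lemma eval_kernel_image:
  assumes S: "E.subspace S" "S \<subseteq> corner e" "nofix S" "idem e" "e x = x" "x \<noteq> 0"
    and big: "card_ge TYPE('f) (V.dim (range e))"
    and mx: "\<And>y. e y = y \<Longrightarrow> V.dim ((\<lambda>u. u y) ` S) \<le> V.dim ((\<lambda>u. u x) ` S)"
    and u: "u \<in> S" "u x = 0"
  shows "u y \<in> (\<lambda>u. u x) ` S"
proof -
  have ue: "u (e y) = u y" if "u \<in> S" for u y using S(2) that by (auto simp: corner_def)
  have "u (e y) \<in> (\<lambda>u. u x) ` S"
  proof (rule EV.pencil_kernel[OF linear_eval linear_eval S(1) corner_fin_gen[OF S(2)] _ refl _ u])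
    fix s
    let ?z = "x \<cdot> \<iota> s + e y"
    have "e ?z = ?z" using S(4,5) by (simp add: idem_def End_add End_smul)
    moreover have "(\<lambda>u. vs s (u x) + u (e y)) ` S = (\<lambda>u. u ?z) ` S"
      using S(2) by (intro image_cong refl) (auto simp: corner_def vec_scale_def End_add End_smul)
    ultimately show "V.dim ((\<lambda>u. vs s (u x) + u (e y)) ` S) \<le> V.dim ((\<lambda>u. u x) ` S)"
      using mx by metis
    show "card_ge TYPE('f) (Suc (V.dim ((\<lambda>u. u x) ` S)))"
      using eval_dim_less(1)[OF S] card_ge_mono[OF big] by simp
  qed
  then show ?thesis using ue[OF u(1)] by simp
qed

end

text \<open>\<open>Suc k\<close> is the D-dimension of \<open>range e\<close>. Maximality of the
  rank at \<open>x\<close> is left to the lemmas, so that the locale also serves with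
  \<open>S = {0}\<close> in the triangular construction.\<close>

locale pivot = division_space \<iota> smul BD BV
  for \<iota> :: "'f::field \<Rightarrow> 'd::division_ring" and smul :: "'v::ab_group_add \<Rightarrow> 'd \<Rightarrow> 'v" (infixl "\<cdot>" 70)
    and BD :: "'d set" and BV :: "'v set" +
  fixes e :: "'v \<Rightarrow> 'v" and S :: "('v \<Rightarrow> 'v) set" and k :: nat and x :: 'v
    and \<phi> :: "'v \<Rightarrow> 'f" and f :: "'v \<Rightarrow> 'd"
  assumes idem_e: "idem e" and dim_e: "V.dim (range e) = Suc k * d"
    and S_sub: "E.subspace S" and S_corner: "S \<subseteq> corner e" and S_nofix: "nofix S"
    and ex: "e x = x"
    and \<phi>_form: "form \<phi>" and \<phi>_e: "\<phi> (e v) = \<phi> v" and \<phi>_x: "\<phi> x = 1"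
    and \<phi>_S: "u \<in> S \<Longrightarrow> \<phi> (u x) = 0"
    and f_dlin: "dlin f" and f_x: "f x = 1" and f_0: "f v = 0 \<longleftrightarrow> (\<forall>q. \<phi> (v \<cdot> q) = 0)"
begin

text \<open>The projection of \<open>range e = x D + K\<close> onto \<open>K\<close> along
  \<open>x D\<close>, zero wherever \<open>e\<close> is.\<close>

definition "e' = (\<lambda>v. e v - x \<cdot> f v)"

abbreviation "Sx \<equiv> {u \<in> S. u x = 0}"

lemma x_nz: "x \<noteq> 0" using \<phi>_x form_0[OF \<phi>_form] by auto

lemma S_End: "u \<in> S \<Longrightarrow> u \<in> End smul"
  and S_e: "u \<in> S \<Longrightarrow> e (u v) = u v" "u \<in> S \<Longrightarrow> u (e v) = u v"
  using S_corner by (auto simp: corner_def)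

lemma e_End: "e \<in> End smul" and ee: "e (e v) = e v"
  using idem_e by (auto simp: idem_def)

lemmas e_simps = ee ex End_add[OF e_End] End_diff[OF e_End] End_smul[OF e_End] End_0[OF e_End]
lemmas f_simps = f_x dlin_add[OF f_dlin] dlin_diff[OF f_dlin] dlin_smul[OF f_dlin] dlin_0[OF f_dlin]
lemmas \<phi>_simps = \<phi>_e \<phi>_x form_add[OF \<phi>_form] form_diff[OF \<phi>_form] form_scale[OF \<phi>_form] form_0[OF \<phi>_form]

lemma f_e: "f (e v) = f v"
proof -
  have "f (v - e v) = 0" unfolding f_0
  proof
    fix q
    have "(v - e v) \<cdot> q = v \<cdot> q - e (v \<cdot> q)" by (simp add: smul_diff_left e_simps)
    then show "\<phi> ((v - e v) \<cdot> q) = 0" by (simp add: \<phi>_simps)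
  qed
  then show ?thesis by (simp add: f_simps)
qed

lemma \<phi>_f: "\<phi> v = \<phi> (x \<cdot> f v)"
proof -
  have "f (v - x \<cdot> f v) = 0" by (simp add: f_simps)
  then have "\<phi> ((v - x \<cdot> f v) \<cdot> 1) = 0" using f_0 by blast
  then show ?thesis by (simp add: smul_one \<phi>_simps)
qed

lemma f_e': "f (e' v) = 0"
  by (simp add: e'_def f_simps f_e)

lemma e_e': "e (e' v) = e' v" "e' (e v) = e' v"
  by (simp_all add: e'_def e_simps f_e)

lemma e'_x: "e' x = 0" by (simp add: e'_def ex f_x smul_one)

lemma e'_End: "e' \<in> End smul"
  unfolding e'_def by (intro End_sub e_End End_rank1 f_dlin)

lemma e'_e': "e' (e' v) = e' v"
  using e_e'(1)[of v] f_e'[of v] by (simp add: e'_def[THEN fun_cong, of "e' v"])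

lemma idem_e': "idem e'" by (simp add: idem_def e'_End e'_e')

lemma e'_fix: "e' v = v \<longleftrightarrow> e v = v \<and> f v = 0"
proof
  assume "e' v = v"
  then show "e v = v \<and> f v = 0" using e_e'(1)[of v] f_e'[of v] by simp
qed (simp add: e'_def)

lemma decomp: "e v = x \<cdot> f v + e' v" by (simp add: e'_def)

lemma dim_e': "V.dim (range e') = k * d"
proof -
  have "e' ` range e = range e'" using e_e'(2) by (auto simp: image_iff)
  moreover have "{v \<in> range e. e' v = 0} = range (\<lambda>q. x \<cdot> q)"
  proof
    show "{v \<in> range e. e' v = 0} \<subseteq> range (\<lambda>q. x \<cdot> q)"
    proof
      fix v assume "v \<in> {v \<in> range e. e' v = 0}"
      then have "e v = v" "e' v = 0" by (auto simp: ee)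
      then show "v \<in> range (\<lambda>q. x \<cdot> q)" using decomp[of v] by (auto intro: range_eqI[OF sym])
    qed
    have "e' (x \<cdot> q) = 0" "e (x \<cdot> q) = x \<cdot> q" for q by (simp_all add: End_smul[OF e'_End] e'_x e_simps)
    then show "range (\<lambda>q. x \<cdot> q) \<subseteq> {v \<in> range e. e' v = 0}" by (auto intro: range_eqI[OF sym])
  qed
  ultimately have "V.dim (range e) = V.dim (range e') + d"
    using VV.rank_nullity[OF End_linear[OF e'_End] End_range_subspace[OF e_End] V_fin_gen]
      dim_line[OF x_nz] by simp
  then show ?thesis using dim_e by simp
qed

text \<open>The image of \<open>u\<close> is a D-subspace inside the kernel of
  \<open>\<phi>\<close>, hence inside that of \<open>f\<close>.\<close>

lemma in_corner_e':
  assumes "u \<in> S" "u x = 0" "\<And>v. \<phi> (u v) = 0"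
  shows "u \<in> corner e'"
proof -
  have "f (u v) = 0" for v
    unfolding f_0 using assms(3) by (simp add: End_smul[OF S_End[OF assms(1)], symmetric])
  moreover have "u (e' v) = u v" for v
    using assms by (simp add: e'_def End_diff[OF S_End] End_smul[OF S_End] S_e)
  ultimately show ?thesis using assms S_End S_e by (auto simp: corner_def e'_def)
qed

lemma Sx_sub: "E.subspace Sx" by (rule kernel_subspace[OF S_sub])

lemma Sx_nofix: "nofix Sx" using S_nofix by (auto simp: nofix_def)

lemma Sx_corner_gen:
  assumes big: "card_ge TYPE('f) (Suc k * d)"
    and mx: "\<And>y. e y = y \<Longrightarrow> V.dim ((\<lambda>u. u y) ` S) \<le> V.dim ((\<lambda>u. u x) ` S)"
  shows "Sx \<subseteq> corner e'"
proof
  fix u assume u: "u \<in> Sx"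
  have "\<phi> (u v) = 0" for v
  proof -
    have "u v \<in> (\<lambda>u. u x) ` S"
      by (rule eval_kernel_image[OF S_sub S_corner S_nofix idem_e ex x_nz _ mx]) (use big u dim_e in auto)
    then show ?thesis using \<phi>_S by auto
  qed
  then show "u \<in> corner e'" using u by (intro in_corner_e') auto
qed

end

section \<open>The inductive dimension bound\<close>

context division_space
begin

lemma pivot_exists:
  assumes "idem e" "V.dim (range e) = Suc k * d"
    "E.subspace S" "S \<subseteq> corner e" "nofix S" "e x = x" "x \<noteq> 0"
  obtains \<phi> f where "pivot \<iota> smul BD BV e S k x \<phi> f"
proof -
  have e: "e \<in> End smul" "\<And>v. e (e v) = e v" using assms(1) by (auto simp: idem_def)
  obtain \<psi> where \<psi>: "form \<psi>" "\<And>v. v \<in> (\<lambda>u. u x) ` S \<Longrightarrow> \<psi> v = 0" "\<psi> x = 1"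
    using V.form_exists[OF eval_subspace[OF assms(3)] eval_dim_less(2)[OF assms(3,4,5,1,6,7)]] by metis
  \<comment> \<open>Composition with \<open>e\<close> makes the form, and with it \<open>f\<close>,
    ignore the kernel of \<open>e\<close>.\<close>
  let ?\<phi> = "\<lambda>v. \<psi> (e v)"
  have \<phi>: "form ?\<phi>" "?\<phi> x = 1" using form_End[OF \<psi>(1) e(1)] \<psi> assms(6) by auto
  obtain f where f: "dlin f" "f x = 1" "\<And>v. f v = 0 \<longleftrightarrow> (\<forall>q. ?\<phi> (v \<cdot> q) = 0)"
    using form_split[OF \<phi>(1), of x] \<phi>(2) by auto
  have "pivot \<iota> smul BD BV e S k x ?\<phi> f"
  proof (intro pivot.intro pivot_axioms.intro division_space_axioms assms \<phi> f)
    show "\<psi> (e (e v)) = \<psi> (e v)" for v by (simp add: e)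
    show "\<psi> (e (u x)) = 0" if u: "u \<in> S" for u
    proof -
      have "e (u x) = u x" using assms(4) u by (auto simp: corner_def)
      then show ?thesis using \<psi>(2) u by simp
    qed
  qed
  then show ?thesis using that by blast
qed

lemma max_eval_vector:
  assumes "idem e" "V.dim (range e) = Suc k * d" "S \<subseteq> corner e"
  obtains x where "e x = x" "x \<noteq> 0" "\<And>y. e y = y \<Longrightarrow> V.dim ((\<lambda>u. u y) ` S) \<le> V.dim ((\<lambda>u. u x) ` S)"
proof -
  let ?r = "\<lambda>y. V.dim ((\<lambda>u. u y) ` S)"
  have rb: "?r y \<le> Suc k * d" for y
    using V.fin_gen_dim_mono[OF eval_corner[OF assms(3)] V_fin_gen] assms(2) by metis
  have "\<not> range e \<subseteq> {0}"
  proof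
    assume "range e \<subseteq> {0}"
    then have "V.dim (range e) = 0" by (simp only: V.dim_eq_0)
    then show False using assms(2) d_pos by simp
  qed
  then obtain y0 where "e y0 \<noteq> 0" by blast
  then have x0: "e (e y0) = e y0 \<and> e y0 \<noteq> 0" using assms(1) by (simp add: idem_def)
  define x where "x = (ARG_MAX ?r y. e y = y \<and> y \<noteq> 0)"
  have x: "e x = x \<and> x \<noteq> 0" "\<And>y. e y = y \<and> y \<noteq> 0 \<Longrightarrow> ?r y \<le> ?r x"
    unfolding x_def
    using arg_max_nat_lemma[of "\<lambda>y. e y = y \<and> y \<noteq> 0" "e y0" ?r "Suc (Suc k * d)"] x0 rb
    by (auto simp: less_Suc_eq_le)
  \<comment> \<open>\<open>y = 0\<close> was left out of the maximization because \<open>x\<close>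
    must be nonzero; the rank there is 0.\<close>
  have "?r y \<le> ?r x" if "e y = y" for y
  proof (cases "y = 0")
    case True
    then have "(\<lambda>u. u y) ` S \<subseteq> {0}" using assms(3) by (auto simp: corner_def End_0)
    then have "?r y = 0" by (simp only: V.dim_eq_0)
    then show ?thesis by (metis le0)
  qed (use x that in auto)
  then show ?thesis using that x(1) by blast
qed

theorem corner_bound:
  assumes "idem e" "V.dim (range e) = k * d" "card_ge TYPE('f) (k * d)"
    "E.subspace S" "S \<subseteq> corner e" "nofix S"
  shows "E.dim S \<le> tri_dim d k"
  using assms
proof (induction k arbitrary: e S)
  case 0
  have "range e = {0}"
    using V.fin_gen_dim_0[OF End_range_subspace V_fin_gen] 0 by (auto simp: idem_def)
  then have e0: "e w = 0" for w using rangeI[of e w] by simp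
  have "u v = 0" if "u \<in> S" for u v
  proof -
    have "e (u v) = u v" using that 0 by (auto simp: corner_def)
    then show ?thesis using e0 by simp
  qed
  then have "S \<subseteq> {0}" by (auto simp: fun_eq_iff)
  then have "E.dim S \<le> card ({} :: ('v \<Rightarrow> 'v) set)" by (intro E.dim_le_card) auto
  then show ?case by simp
next
  case (Suc k)
  let ?r = "\<lambda>y. V.dim ((\<lambda>u. u y) ` S)"
  obtain x where x: "e x = x" "x \<noteq> 0" and mx: "\<And>y. e y = y \<Longrightarrow> ?r y \<le> ?r x"
    using max_eval_vector[OF Suc.prems(1,2,5)] by blast
  obtain \<phi> f where "pivot \<iota> smul BD BV e S k x \<phi> f"
    using pivot_exists[OF Suc.prems(1,2,4-6) x] by blast
  then interpret P: pivot \<iota> smul BD BV e S k x \<phi> f .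
  have "E.dim P.Sx \<le> tri_dim d k"
    by (rule Suc.IH[OF P.idem_e' P.dim_e' _ P.Sx_sub P.Sx_corner_gen P.Sx_nofix])
      (use Suc.prems mx card_ge_mono[of "Suc k * d" "k * d"] in auto)
  moreover have "?r x \<le> Suc k * d - 1"
    using eval_dim_less(1)[OF Suc.prems(4,5,6,1) x] Suc.prems(2) by simp
  moreover have "E.dim S = ?r x + E.dim P.Sx"
    by (rule EV.rank_nullity[OF linear_eval Suc.prems(4) corner_fin_gen[OF Suc.prems(5)]])
  ultimately show ?case by simp
qed

section \<open>Optimal spaces and Schur complements\<close>

text \<open>Extending \<open>G\<close> by the identity on the kernel of \<open>e\<close> gives
  \<open>H\<close>, invertible by the case \<open>t = 0\<close> of \<open>nf\<close>. For its
  inverse \<open>K\<close>, a fixed vector \<open>v\<close> of \<open>K t\<close> satisfies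
  \<open>e v = v\<close> and \<open>G v = t v\<close>, so the \<open>K t\<close> have none and
  \<open>corner_bound\<close> applies to them.\<close>

lemma corner_bound_affine:
  assumes e: "idem e" "V.dim (range e) = k * d" "card_ge TYPE('f) (k * d)"
    and T: "E.subspace T" "T \<subseteq> corner e"
    and G: "G \<in> End smul" "\<And>w. e w = w \<Longrightarrow> e (G w) = G w"
    and nf: "\<And>t w. t \<in> T \<Longrightarrow> e w = w \<Longrightarrow> G w = t w \<Longrightarrow> w = 0"
  shows "E.dim T \<le> tri_dim d k"
proof -
  have eE: "e \<in> End smul" and ee: "\<And>v. e (e v) = e v" using e(1) by (auto simp: idem_def)
  define H where "H v = v - e v + G (e v)" for v
  have HE: "H \<in> End smul"
    using End_sum2[OF End_sub[OF End_id eE] End_comp[OF G(1) eE]] by (simp add: H_def[abs_def])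
  have eH: "e (H v) = G (e v)" for v
    unfolding H_def by (simp add: End_add[OF eE] End_diff[OF eE] ee G(2))
  have Hfix: "e v = v" if "e (H v) = H v" for v
    using that eH[of v] by (simp add: H_def)
  have inj: "v = 0" if "H v = 0" for v
  proof -
    have "G (e v) = 0" using eH[of v] that End_0[OF eE] by simp
    then have "e v = 0" using nf[of 0 "e v"] E.subspace_0[OF T(1)] ee by simp
    moreover have "e v = v" by (rule Hfix) (simp add: that End_0[OF eE])
    ultimately show ?thesis by simp
  qed
  obtain K where K: "K \<in> End smul" "\<And>v. H (K v) = v" "\<And>v. K (H v) = v"
    using End_inverse[OF HE inj] by blast
  let ?f = "\<lambda>t v. K (t v)"
  have lin: "Vector_Spaces.linear es es ?f" by (rule linear_postcomp[OF End_linear[OF K(1)]])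
  have "E.dim (?f ` T) \<le> tri_dim d k"
  proof (rule corner_bound[OF e])
    show "E.subspace (?f ` T)" by (rule EE.linear_subspace_image[OF lin T(1)])
    have c: "e (K (t v)) = K (t v)" if "t \<in> T" for t v
      by (rule Hfix) (use T(2) that in \<open>auto simp: K corner_def\<close>)
    show "?f ` T \<subseteq> corner e"
      using T(2) c End_comp[OF K(1)] by (auto simp: corner_def)
    show "nofix (?f ` T)" unfolding nofix_def
    proof (intro ballI allI impI)
      fix u v assume "u \<in> ?f ` T" "u v = v"
      then obtain t where t: "t \<in> T" "K (t v) = v" by auto
      have ev: "e v = v" using c[OF t(1), of v] t(2) by simp
      have "t v = H v" using K(2)[of "t v"] t(2) by simp
      then have "G v = t v" using ev by (simp add: H_def)
      then show "v = 0" using nf t(1) ev by blast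
    qed
  qed
  moreover have "E.dim (?f ` T) = E.dim T"
  proof (rule EE.dim_image_eq_gen[OF lin T(1) corner_fin_gen[OF T(2)]])
    fix t assume "?f t = 0"
    then have "K (t v) = 0" for v by (metis zero_fun_def)
    then have "t v = 0" for v using K(2)[of "t v"] End_0[OF HE] by simp
    then show "t = 0" by auto
  qed
  ultimately show ?thesis by simp
qed

definition irreducible_on :: "('v \<Rightarrow> 'v) \<Rightarrow> ('v \<Rightarrow> 'v) set \<Rightarrow> bool" where
  "irreducible_on e S \<longleftrightarrow> (\<forall>W. right_subspace smul W \<and> W \<subseteq> range e \<and> (\<forall>u\<in>S. u ` W \<subseteq> W)
     \<longrightarrow> W = {0} \<or> W = range e)"

end

locale optimal_pivot = pivot \<iota> smul BD BV e S k x \<phi> f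
  for \<iota> :: "'f::field \<Rightarrow> 'd::division_ring" and smul :: "'v::ab_group_add \<Rightarrow> 'd \<Rightarrow> 'v" (infixl "\<cdot>" 70)
    and BD BV e S k x \<phi> f +
  assumes big: "card_ge TYPE('f) (Suc k * d)"
    and S_dim: "E.dim S = tri_dim d (Suc k)"
    and x_good: "V.dim ((\<lambda>u. u x) ` S) = Suc k * d - 1"
begin

section \<open>Rigidity at the maximal dimension\<close>

lemma eval_rank_le: "e y = y \<Longrightarrow> V.dim ((\<lambda>u. u y) ` S) \<le> Suc k * d - 1"
proof (cases "y = 0")
  case True
  then have "(\<lambda>u. u y) ` S \<subseteq> {0}" using End_0[OF S_End] by auto
  then have "V.dim ((\<lambda>u. u y) ` S) = 0" by (simp only: V.dim_eq_0)
  then show ?thesis by (metis le0)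
next
  case False
  assume "e y = y"
  then show ?thesis using eval_dim_less(1)[OF S_sub S_corner S_nofix idem_e _ False] dim_e by linarith
qed

lemma big': "card_ge TYPE('f) (k * d)"
  by (rule card_ge_mono[OF big]) simp

lemma Sx_corner: "Sx \<subseteq> corner e'"
  by (rule Sx_corner_gen[OF big]) (simp only: x_good eval_rank_le)

lemma Sx_dim: "E.dim Sx = tri_dim d k"
proof -
  have "E.dim S = V.dim ((\<lambda>u. u x) ` S) + E.dim Sx"
    by (rule EV.rank_nullity[OF linear_eval S_sub corner_fin_gen[OF S_corner]])
  then show ?thesis using x_good S_dim by simp
qed

lemma Sx_f: "u \<in> S \<Longrightarrow> u x = 0 \<Longrightarrow> f (u v) = 0"
  using Sx_corner f_e'[of "u v"] by (auto simp: corner_def)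

text \<open>This is how operators are shown to belong to \<open>S\<close>: they are adjoined to the
  evaluation kernel, and the dimension bound is shown to persist.\<close>

lemma Sx_maximal:
  assumes "E.subspace T" "T \<subseteq> corner e'" "E.dim T \<le> tri_dim d k" "Sx \<subseteq> T"
  shows "T = Sx"
  using E.fin_gen_dim_eq[OF Sx_sub assms(4) corner_fin_gen[OF assms(2)]] assms(3) Sx_dim by simp

lemma eval_x_image: "(\<lambda>u. u x) ` S = {v. e v = v \<and> \<phi> v = 0}"
proof (rule V.fin_gen_dim_eq[OF eval_subspace[OF S_sub] _ V_fin_gen])
  let ?K = "{v. e v = v \<and> \<phi> v = 0}"
  show "(\<lambda>u. u x) ` S \<subseteq> ?K" using S_e \<phi>_S by auto
  have sub: "V.subspace ?K"
    unfolding V.subspace_def by (simp add: e_simps \<phi>_simps vec_scale_def)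
  have "?K \<subseteq> range e" by (auto intro: range_eqI[OF sym])
  moreover have "?K \<noteq> range e"
  proof
    assume "?K = range e"
    then have "x \<in> ?K" using ex by (metis rangeI)
    then show False using \<phi>_x by simp
  qed
  ultimately have "V.dim ?K < V.dim (range e)"
    using V.fin_gen_dim_eq[OF sub _ V_fin_gen] by (meson not_le_imp_less)
  then show "V.dim ?K \<le> V.dim ((\<lambda>u. u x) ` S)" using x_good dim_e by simp
qed

text \<open>Otherwise \<open>\<phi> (u x) = \<phi> (x \<cdot> 1) = 1\<close>, whereas
  \<open>\<phi>\<close> kills \<open>S x\<close>.\<close>

lemma f_S_x: "u \<in> S \<Longrightarrow> 1 - f (u x) \<noteq> 0"
  using \<phi>_S[of u] \<phi>_f[of "u x"] \<phi>_x by (auto simp: smul_one)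

text \<open>The Schur complement of \<open>1 - v - s - c (z \<otimes> f)\<close> with respect to the coordinate \<open>x\<close> is
  \<open>G - s - c \<tau>\<close>, so that \<open>\<tau>\<close> may be adjoined to the kernel of the evaluation at \<open>x\<close>.\<close>

lemma schur_mem:
  assumes z: "e' z = z" "(\<lambda>v. z \<cdot> f v) \<in> S" and v: "v \<in> S"
  shows "(\<lambda>w. z \<cdot> (inverse (1 - f (v x)) * f (v (e' w)))) \<in> S"
proof -
  \<comment> \<open>Chosen so that, for \<open>w\<close> in \<open>K\<close>, \<open>id - v\<close>
    sends \<open>w + x \<cdot> q w\<close> into \<open>K\<close>.\<close>
  define q where "q w = inverse (1 - f (v x)) * f (v (e' w))" for w
  define \<tau> where "\<tau> = (\<lambda>w. z \<cdot> q w)"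
  define G where "G w = w + x \<cdot> q w - v (w + x \<cdot> q w)" for w
  have vE: "v \<in> End smul" by (rule S_End[OF v])
  have qd: "dlin q"
    by (simp add: dlin_def q_def End_add[OF e'_End] End_smul[OF e'_End] End_add[OF vE] End_smul[OF vE]
        f_simps distrib_left mult.assoc)
  have qe: "q (e' w) = q w" for w by (simp add: q_def e'_e')
  have qx: "q x = 0" by (simp add: q_def e'_x End_0[OF vE] f_simps)
  have pE: "(\<lambda>w. w + x \<cdot> q w) \<in> End smul" by (rule End_sum2[OF End_id End_rank1[OF qd]])
  have GE: "G \<in> End smul"
    using End_sub[OF pE End_comp[OF vE pE]] by (simp add: G_def[abs_def])
  have Gf: "e' (G w) = G w" if "e' w = w" for w
  proof -
    have w: "e w = w" "f w = 0" using that by (auto simp: e'_fix)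
    have "(1 - f (v x)) * q w = f (v w)" using f_S_x[OF v] that by (simp add: q_def mult.assoc[symmetric])
    then have "f (G w) = 0"
      by (simp add: G_def f_simps w End_add[OF vE] End_smul[OF vE] left_diff_distrib diff_eq_eq)
    moreover have "e (G w) = G w" by (simp add: G_def e_simps w S_e v)
    ultimately show ?thesis by (simp add: e'_fix)
  qed
  have \<tau>E: "\<tau> \<in> End smul" unfolding \<tau>_def by (rule End_rank1[OF qd])
  have \<tau>c: "\<tau> \<in> corner e'"
    using \<tau>E by (simp add: corner_def) (simp add: \<tau>_def qe z End_smul[OF e'_End])
  let ?T = "{a + b | a b. a \<in> Sx \<and> b \<in> E.span {\<tau>}}"
  have "?T = Sx"
  proof (rule Sx_maximal)
    show sub: "E.subspace ?T" by (rule E.subspace_sums[OF Sx_sub E.subspace_span])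
    have "E.span {\<tau>} \<subseteq> corner e'"
      using \<tau>c by (intro E.span_minimal corner_subspace idem_e') auto
    then show T: "?T \<subseteq> corner e'"
      using Sx_corner E.subspace_add[OF corner_subspace[OF idem_e']] by blast
    show "Sx \<subseteq> ?T"
    proof
      fix s assume "s \<in> Sx"
      then have "s + 0 \<in> ?T" using E.span_zero by blast
      then show "s \<in> ?T" by simp
    qed
    show "E.dim ?T \<le> tri_dim d k"
    proof (rule corner_bound_affine[OF idem_e' dim_e' big' sub T GE Gf])
      fix t w assume "t \<in> ?T" and w: "e' w = w" and eq: "G w = t w"
      then obtain s c where s: "s \<in> S" "s x = 0" and t: "t = s + es c \<tau>"
        by (auto simp: E.span_singleton)
      \<comment> \<open>If \<open>G w = t w\<close>, then \<open>?U\<close> fixes \<open>?p\<close>: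
        \<open>s\<close> kills \<open>x\<close>, and \<open>f ?p = q w\<close> turns
        \<open>z \<cdot> f\<close> at \<open>?p\<close> into \<open>\<tau>\<close> at
        \<open>w\<close>.\<close>
      let ?p = "w + x \<cdot> q w"
      let ?U = "v + s + es c (\<lambda>v. z \<cdot> f v)"
      have U: "?U \<in> S" using E.subspace_add[OF S_sub] E.subspace_scale[OF S_sub] v s z by blast
      have sp: "s ?p = s w" using s by (simp add: End_add[OF S_End] End_smul[OF S_End])
      have fp: "f ?p = q w" using w by (simp add: f_simps e'_fix)
      have "?U ?p = v ?p + (s w + es c \<tau> w)"
        by (simp add: sp end_scale_def fp \<tau>_def add.assoc)
      also have "\<dots> = v ?p + G w" by (simp add: eq t)
      also have "\<dots> = ?p" by (simp add: G_def)
      finally have "?p = 0" using S_nofix U unfolding nofix_def by blast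
      moreover from this have "q w = 0" using fp by (simp add: f_simps)
      ultimately show "w = 0" by simp
    qed
  qed
  moreover have "0 + \<tau> \<in> ?T" using E.subspace_0[OF Sx_sub] E.span_base[of \<tau> "{\<tau>}"] by blast
  ultimately have "\<tau> \<in> S" by simp
  then show ?thesis by (simp add: \<tau>_def q_def)
qed

section \<open>Irreducibility of evaluation kernels\<close>

text \<open>Suppose \<open>s + c t\<close> fixes \<open>v\<close>. Then \<open>(id - s) v\<close>
  lies in \<open>W\<close>; as \<open>id - s\<close> is injective and maps the finite-dimensional
  \<open>W\<close> into itself, \<open>v\<close> lies in \<open>W\<close>. So \<open>t v = 0\<close>
  and \<open>s v = v\<close>, whence \<open>v = 0\<close>, and \<open>t\<close> may be adjoined to
  \<open>Sx\<close>.\<close>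

lemma invariant_kernel_mem:
  assumes W: "right_subspace smul W" "W \<subseteq> range e'" "\<And>u. u \<in> Sx \<Longrightarrow> u ` W \<subseteq> W"
    and t: "t \<in> corner e'" "\<And>v. t v \<in> W" "\<And>w. w \<in> W \<Longrightarrow> t w = 0"
  shows "t \<in> S"
proof -
  note VW = right_subspace_subspace[OF W(1)]
  let ?T = "{a + b | a b. a \<in> Sx \<and> b \<in> E.span {t}}"
  have "?T = Sx"
  proof (rule Sx_maximal)
    show sub: "E.subspace ?T" by (rule E.subspace_sums[OF Sx_sub E.subspace_span])
    have "E.span {t} \<subseteq> corner e'"
      using t by (intro E.span_minimal corner_subspace idem_e') auto
    then show T: "?T \<subseteq> corner e'"
      using Sx_corner E.subspace_add[OF corner_subspace[OF idem_e']] by blast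
    show "Sx \<subseteq> ?T"
    proof
      fix s assume "s \<in> Sx"
      then have "s + 0 \<in> ?T" using E.span_zero by blast
      then show "s \<in> ?T" by simp
    qed
    show "E.dim ?T \<le> tri_dim d k"
    proof (rule corner_bound[OF idem_e' dim_e' big' sub T])
      show "nofix ?T" unfolding nofix_def
      proof (intro ballI allI impI)
        fix u v assume "u \<in> ?T" and uv: "u v = v"
        then obtain s c where s: "s \<in> Sx" and u: "u = s + es c t" by (auto simp: E.span_singleton)
        have sE: "s \<in> End smul" using s S_End by blast
        let ?g = "\<lambda>v. v - s v"
        have gE: "?g \<in> End smul" by (rule End_sub[OF End_id sE])
        have inj: "w = 0" if "?g w = 0" for w
          using S_nofix s that unfolding nofix_def by auto
        have gW: "?g ` W \<subseteq> W" using V.subspace_diff[OF VW] W(3)[OF s] by blast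
        have "?g ` W = W"
        proof (rule V.fin_gen_dim_eq[OF _ gW V_fin_gen])
          show "V.subspace (?g ` W)" by (rule VV.linear_subspace_image[OF End_linear[OF gE] VW])
          show "V.dim W \<le> V.dim (?g ` W)"
            using VV.dim_image_eq_gen[OF End_linear[OF gE] VW V_fin_gen inj] by simp
        qed
        moreover have "?g v = es c t v" using uv by (simp add: u diff_eq_eq add.commute)
        moreover have "es c t v \<in> W" using t(2)[of v] V.subspace_scale[OF VW] by (simp add: end_scale_def)
        ultimately obtain w where w: "w \<in> W" "?g w = ?g v" by (metis imageE)
        have "?g (v - w) = ?g v - ?g w" by (simp add: End_diff[OF sE] algebra_simps)
        then have "?g (v - w) = 0" using w(2) by simp
        then have "v = w" using inj[of "v - w"] by simp
        then have "s v = v" using uv t(3)[OF w(1)] by (simp add: u end_scale_def vec_scale_def)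
        then show "v = 0" using inj[of v] by simp
      qed
    qed
  qed
  moreover have "0 + t \<in> ?T" using E.subspace_0[OF Sx_sub] E.span_base[of t "{t}"] by blast
  ultimately show ?thesis by simp
qed

text \<open>Let \<open>W\<close> be a counterexample and \<open>R = W + x D\<close>. Each
  \<open>v\<close> in \<open>S\<close> maps \<open>W\<close> into \<open>W\<close> or
  \<open>x\<close> into \<open>R\<close>. By \<open>subspace_cover\<close> one alternative holds for
  all of \<open>S\<close>: the first contradicts \<open>irr\<close>, the second the fact that
  \<open>S x\<close> and \<open>x\<close> span \<open>range e\<close>.\<close>

lemma irreducible_descent:
  assumes irr: "irreducible_on e S"
  shows "irreducible_on e' Sx"
  unfolding irreducible_on_def
proof (intro allI impI, rule ccontr)
  fix W assume W: "right_subspace smul W \<and> W \<subseteq> range e' \<and> (\<forall>u\<in>Sx. u ` W \<subseteq> W)"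
    and nontriv: "\<not> (W = {0} \<or> W = range e')"
  have Wr: "right_subspace smul W" and We: "W \<subseteq> range e'" and Winv: "\<And>u. u \<in> Sx \<Longrightarrow> u ` W \<subseteq> W"
    using W by auto
  have We': "e' w = w" if "w \<in> W" for w using We that e'_e' by auto
  have Wsm: "w \<cdot> q \<in> W" if "w \<in> W" for w q using Wr that by (simp add: right_subspace_def)
  note VW = right_subspace_subspace[OF Wr]
  define R where "R = {w + x \<cdot> q | w q. w \<in> W}"
  have R1: "w + x \<cdot> q \<in> R" if "w \<in> W" for w q using that R_def by blast
  have RW: "w \<in> R" if "w \<in> W" for w using R1[OF that, of 0] by simp
  have xR: "x \<in> R" using R1[OF V.subspace_0[OF VW], of 1] by (simp add: smul_one)
  have Rr: "right_subspace smul R"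
    unfolding right_subspace_def
  proof (intro conjI ballI allI)
    show "0 \<in> R" using RW[OF V.subspace_0[OF VW]] .
    fix a assume "a \<in> R"
    then obtain w q where a: "a = w + x \<cdot> q" "w \<in> W" unfolding R_def by blast
    show "a \<cdot> p \<in> R" for p
      using R1[OF Wsm[OF a(2), of p], of "q * p"] by (simp add: a smul_add_left smul_smul)
    fix b assume "b \<in> R"
    then obtain w' q' where b: "b = w' + x \<cdot> q'" "w' \<in> W" unfolding R_def by blast
    show "a + b \<in> R"
      using R1[OF V.subspace_add[OF VW a(2) b(2)], of "q + q'"] by (simp add: a b smul_add_right algebra_simps)
  qed
  note VR = right_subspace_subspace[OF Rr]
  have Re: "R \<subseteq> range e"
  proof
    fix a assume "a \<in> R"
    then obtain w q where a: "a = w + x \<cdot> q" "w \<in> W" unfolding R_def by blast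
    have "e w = w" using We'[OF a(2)] by (simp add: e'_fix)
    then have "e a = a" by (simp add: a e_simps)
    then show "a \<in> range e" by (metis rangeI)
  qed
  have Rne: "R \<noteq> range e"
  proof
    assume eq: "R = range e"
    have "range e' \<subseteq> W"
    proof
      fix y assume "y \<in> range e'"
      then have y: "e y = y" "f y = 0" by (auto simp: e_e' f_e')
      then have "y \<in> R" using eq by (metis rangeI)
      then obtain w q where a: "y = w + x \<cdot> q" "w \<in> W" unfolding R_def by blast
      have "f w = 0" using We'[OF a(2)] by (simp add: e'_fix)
      then have "q = 0" using y(2) by (simp add: a f_simps)
      then show "y \<in> W" using a by simp
    qed
    then show False using We nontriv by blast
  qed
  have Rdim: "V.dim R < Suc k * d"
    using V.fin_gen_dim_eq[OF VR Re V_fin_gen] Rne dim_e by (metis not_le_imp_less)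
  \<comment> \<open>Resolvents of \<open>v\<close> at vectors of \<open>W\<close> stay in
    \<open>R\<close>: otherwise some D-linear \<open>g\<close> kills \<open>W\<close> and takes the
    value 1 at \<open>p\<close>, the operator \<open>w \<cdot> g\<close> belongs to
    \<open>S\<close>, and \<open>t v + w \<cdot> g\<close> fixes \<open>p\<close>.\<close>
  have res: "p \<in> R" if v: "v \<in> S" and w: "w \<in> W" and p: "p - vs t (v p) = w" for v w t p
  proof (rule ccontr)
    assume nin: "p \<notin> R"
    have pe: "e p = p"
    proof -
      have "p = w + vs t (v p)" using p by (simp add: diff_eq_eq)
      moreover have "e w = w" using We'[OF w] by (simp add: e'_fix)
      ultimately show ?thesis by (metis End_add[OF e_End] End_smul[OF e_End] S_e(1)[OF v] vec_scale_def)
    qed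
    have pn: "e' p \<notin> W"
    proof
      assume "e' p \<in> W"
      then have "e' p + x \<cdot> f p \<in> R" by (rule R1)
      then show False using nin decomp[of p] pe by (simp add: add.commute)
    qed
    obtain \<psi> where \<psi>: "form \<psi>" "\<And>v. v \<in> W \<Longrightarrow> \<psi> v = 0" "\<psi> (e' p) = 1"
      using V.form_exists[OF VW pn] by metis
    have "form (\<lambda>v. \<psi> (e' v))" by (rule form_End[OF \<psi>(1) e'_End])
    then obtain g where g: "dlin g" "g (e' p) = 1" "\<And>v. g v = 0 \<longleftrightarrow> (\<forall>q. \<psi> (e' (v \<cdot> q)) = 0)"
      using form_split[of "\<lambda>v. \<psi> (e' v)" "e' p"] \<psi>(3) e'_e' by auto
    have ge: "g (e' v) = g v" for v
    proof -
      have "g (v - e' v) = 0" unfolding g(3)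
        by (simp add: smul_diff_left End_diff[OF e'_End] End_smul[OF e'_End] e'_e' form_0[OF \<psi>(1)])
      then show ?thesis by (simp add: dlin_diff[OF g(1)])
    qed
    have gW: "g w = 0" if "w \<in> W" for w
      unfolding g(3) using \<psi>(2) Wsm[OF that] We' by simp
    let ?u = "\<lambda>v. w \<cdot> g v"
    have "?u \<in> S"
    proof (rule invariant_kernel_mem[OF Wr We Winv])
      show "?u \<in> corner e'"
        using End_rank1[OF g(1), of w] We'[OF w] by (simp add: corner_def ge End_smul[OF e'_End])
      show "w \<cdot> g v \<in> W" for v by (rule Wsm[OF w])
      show "w \<cdot> g w' = 0" if "w' \<in> W" for w' using gW[OF that] by simp
    qed
    then have U: "es t v + ?u \<in> S" using E.subspace_add[OF S_sub] E.subspace_scale[OF S_sub] v by blast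
    have "g p = 1" using g(2) ge by simp
    then have "(es t v + ?u) p = p" using p by (simp add: end_scale_def smul_one diff_eq_eq add.commute)
    then have "p = 0" using S_nofix U unfolding nofix_def by blast
    then show False using nin V.subspace_0[OF VR] by simp
  qed
  \<comment> \<open>By \<open>resolvent_invariant\<close>, \<open>w\<close> lies in a subspace of
    \<open>R\<close> that is stable under \<open>v\<close>.\<close>
  have powers: "v w \<in> R \<and> v (v w) \<in> R" if v: "v \<in> S" and w: "w \<in> W" for v w
  proof -
    have vE: "v \<in> End smul" by (rule S_End[OF v])
    have "\<exists>p. p - vs t (v p) = w" for t
    proof -
      have tv: "es t v \<in> S" by (rule E.subspace_scale[OF S_sub v])
      obtain h where h: "\<And>y. h y - es t v (h y) = y"
        using End_inverse[OF End_sub[OF End_id S_End[OF tv]]] S_nofix tv unfolding nofix_def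
        by (metis eq_iff_diff_eq_0)
      show ?thesis by (intro exI[of _ "h w"]) (use h[of w] in \<open>simp add: end_scale_def\<close>)
    qed
    then obtain p where p: "\<And>t. p t - vs t (v (p t)) = w" by metis
    obtain C where C: "C \<subseteq> R" "w \<in> C" "\<And>c. c \<in> C \<Longrightarrow> v c \<in> C"
      using V.resolvent_invariant[OF End_linear[OF vE] VR V_fin_gen _ res[OF v w p] p]
        card_ge_mono[OF big, of "Suc (V.dim R)"] Rdim by (metis Suc_leI)
    then show ?thesis by blast
  qed
  let ?A = "{v \<in> S. \<forall>w\<in>W. v w \<in> W}" and ?B = "{v \<in> S. v x \<in> R}"
  have sA: "E.subspace ?A"
    using S_sub VW by (auto simp: E.subspace_def V.subspace_def end_scale_def)
  have sB: "E.subspace ?B"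
    using S_sub VR by (auto simp: E.subspace_def V.subspace_def end_scale_def)
  have cover: "S \<subseteq> ?A \<union> ?B"
  proof
    fix v assume v: "v \<in> S"
    have vE: "v \<in> End smul" by (rule S_End[OF v])
    show "v \<in> ?A \<union> ?B"
    proof (cases "\<forall>w\<in>W. v w \<in> W")
      case False
      then obtain w where w: "w \<in> W" "v w \<notin> W" by blast
      then obtain w1 q where q: "v w = w1 + x \<cdot> q" "w1 \<in> W" using powers[OF v w(1)] unfolding R_def by blast
      have q0: "q \<noteq> 0" using q w(2) by auto
      \<comment> \<open>Both terms are in \<open>R\<close>, and their difference is
        \<open>v x \<cdot> q\<close> with \<open>q \<noteq> 0\<close>.\<close>
      have "v (v w) - v w1 \<in> R" using powers[OF v w(1)] powers[OF v q(2)] V.subspace_diff[OF VR] by blast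
      then have "v x \<cdot> q \<in> R" by (simp add: q(1) End_add[OF vE] End_smul[OF vE])
      then have "v x \<cdot> q \<cdot> inverse q \<in> R" using Rr by (simp add: right_subspace_def)
      then have "v x \<in> R" using q0 by (simp add: smul_smul smul_one)
      then show ?thesis using v by blast
    qed (use v in blast)
  qed
  have "\<not> S \<subseteq> ?B"
  proof
    assume SB: "S \<subseteq> ?B"
    have "range e \<subseteq> R"
    proof
      fix y assume "y \<in> range e"
      then have y: "e y = y" using ee by auto
      have "y - x \<cdot> \<iota> (\<phi> y) \<in> (\<lambda>u. u x) ` S"
        unfolding eval_x_image by (simp add: e_simps y \<phi>_simps)
      then have "y - x \<cdot> \<iota> (\<phi> y) \<in> R" using SB by auto
      moreover have "x \<cdot> \<iota> (\<phi> y) \<in> R" using xR Rr by (simp add: right_subspace_def)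
      ultimately show "y \<in> R" using V.subspace_add[OF VR] by fastforce
    qed
    then show False using Re Rne by blast
  qed
  then have "S \<subseteq> ?A" using E.subspace_cover[OF S_sub sA sB cover] by blast
  then have inv: "\<forall>u\<in>S. u ` W \<subseteq> W" by blast
  have "W \<subseteq> range e" using RW Re by blast
  then have "W = {0} \<or> W = range e"
    using irr[unfolded irreducible_on_def, rule_format, OF conjI[OF Wr conjI[OF _ inv]]] by blast
  then have "W = range e" using nontriv by blast
  then have "x \<in> W" using ex by (metis rangeI)
  then have "x = 0" using We'[of x] e'_x by simp
  then show False using x_nz by simp
qed

end

section \<open>Evaluations have hyperplane images\<close>

context pivot
begin

lemma no_fixed_vector: "u \<in> S \<Longrightarrow> u v = v \<Longrightarrow> v = 0"
  using S_nofix by (simp add: nofix_def)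

text \<open>If \<open>\<phi> (x \<cdot> (q * p))\<close> vanishes for all \<open>p\<close>, then
  \<open>f (x \<cdot> q) = q\<close> is zero. So the multiples of the single form
  \<open>q \<mapsto> \<phi> (x \<cdot> q)\<close> exhaust the dual of D.\<close>

lemma form_on_D:
  assumes "Vector_Spaces.linear ds (*) \<omega>"
  shows "\<exists>r. \<forall>q. \<omega> q = \<phi> (x \<cdot> (q * r))"
proof -
  have lin: "Vector_Spaces.linear ds (*) (\<lambda>q. \<phi> (x \<cdot> (q * p)))" for p
    using form_smul_right[OF form_smul[OF \<phi>_form, of p], of x] by (simp add: smul_smul)
  have "\<exists>c. \<forall>q. \<omega> q = (\<Sum>p\<in>BD. c p * \<phi> (x \<cdot> (q * p)))"
  proof (rule D.form_in_combination[OF D.finite_Basis lin assms])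
    fix q assume q: "\<And>p. p \<in> BD \<Longrightarrow> \<phi> (x \<cdot> (q * p)) = 0"
    have "\<phi> (x \<cdot> q \<cdot> p) = 0" for p
    proof (rule DF.linear_eq_0_on_span[OF form_smul_right[OF \<phi>_form]])
      show "\<phi> (x \<cdot> q \<cdot> b) = 0" if "b \<in> BD" for b using q[OF that] by (simp add: smul_smul)
      show "p \<in> D.span BD" by (simp only: D.span_Basis UNIV_I)
    qed
    then have "f (x \<cdot> q) = 0" unfolding f_0 by blast
    then have "q = 0" by (simp add: f_simps)
    then show "\<omega> q = 0" by (simp add: DF.linear_0[OF assms])
  qed
  then obtain c where c: "\<forall>q. \<omega> q = (\<Sum>p\<in>BD. c p * \<phi> (x \<cdot> (q * p)))" by blast
  have "\<phi> (x \<cdot> (q * (\<Sum>p\<in>BD. p * \<iota> (c p)))) = (\<Sum>p\<in>BD. c p * \<phi> (x \<cdot> (q * p)))" for q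
    by (simp add: sum_distrib_left smul_sum_right form_sum[OF \<phi>_form] smul_smul[symmetric]
        form_scale[OF \<phi>_form] mult.assoc[symmetric])
  then show ?thesis using c by metis
qed

lemma f_0_S: "u \<in> S \<Longrightarrow> (\<And>v. \<phi> (u v) = 0) \<Longrightarrow> f (u v) = 0"
  unfolding f_0 by (simp add: End_smul[OF S_End, symmetric])

end

section \<open>Rank-one operators in an optimal space\<close>

context optimal_pivot
begin

definition "SK = {u \<in> S. \<forall>v. \<phi> (u v) = 0}"

text \<open>These are the values at \<open>x\<close> of the operators of \<open>SK\<close> that
  vanish on \<open>K\<close>; such an operator is determined by that value.\<close>

definition "Z = {z. e' z = z \<and> (\<lambda>v. z \<cdot> f v) \<in> S}"

lemma SK_sub: "E.subspace SK"
  using S_sub unfolding SK_def by (auto simp: E.subspace_def end_scale_def vec_scale_def \<phi>_simps)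

lemma Z_sub: "V.subspace Z"
proof -
  have "Z = {z. e' z = z} \<inter> {z. (\<lambda>v. z \<cdot> f v) \<in> S}" by (auto simp: Z_def)
  moreover have "V.subspace {z. e' z = z}"
    by (simp add: V.subspace_def End_0[OF e'_End] End_add[OF e'_End] End_smul[OF e'_End] vec_scale_def)
  ultimately show ?thesis
    using V.subspace_inter VE.linear_subspace_linear_preimage[OF linear_rank1 S_sub] by simp
qed

text \<open>Restriction to \<open>K\<close> sends \<open>SK\<close> to a space of operators on
  \<open>K\<close> without fixed vectors, to which \<open>corner_bound\<close> applies;
  \<open>Z\<close> accounts for the kernel of the restriction.\<close>

lemma dim_SK_le: "E.dim SK \<le> tri_dim d k + V.dim Z"
proof -
  let ?\<rho> = "\<lambda>u v. u (e' v)"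
  have SKc: "SK \<subseteq> corner e" and SKS: "\<And>u. u \<in> SK \<Longrightarrow> u \<in> S" using S_corner by (auto simp: SK_def)
  have SKf: "e' (u v) = u v" if "u \<in> SK" for u v
    using f_0_S[of u v] that by (simp add: e'_fix SK_def S_e)
  have "E.dim SK = E.dim (?\<rho> ` SK) + E.dim {u \<in> SK. ?\<rho> u = 0}"
    by (rule EE.rank_nullity[OF linear_precomp SK_sub corner_fin_gen[OF SKc]])
  moreover have "E.dim (?\<rho> ` SK) \<le> tri_dim d k"
  proof (rule corner_bound[OF idem_e' dim_e' big' EE.linear_subspace_image[OF linear_precomp SK_sub]])
    show "?\<rho> ` SK \<subseteq> corner e'"
      using End_comp[OF S_End[OF SKS] e'_End] SKf e'_e' by (auto simp: corner_def)
    show "nofix (?\<rho> ` SK)" unfolding nofix_def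
    proof (intro ballI allI impI)
      fix w v assume "w \<in> ?\<rho> ` SK" "w v = v"
      then obtain u where u: "u \<in> SK" "u (e' v) = v" by auto
      then have "e' v = v" using SKf[of u "e' v"] by simp
      then show "v = 0" using u SKS S_nofix unfolding nofix_def by auto
    qed
  qed
  moreover have "E.dim {u \<in> SK. ?\<rho> u = 0} \<le> V.dim Z"
  proof -
    let ?N = "{u \<in> SK. ?\<rho> u = 0}"
    have uN: "u v = u x \<cdot> f v" if "u \<in> ?N" for u v
    proof -
      have uS: "u \<in> S" using that SKS by blast
      have "u v = u (x \<cdot> f v + e' v)" using S_e(2)[OF uS] decomp by metis
      moreover have "u (e' v) = 0" using that by (auto simp: fun_eq_iff)
      ultimately show ?thesis by (simp add: End_add[OF S_End[OF uS]] End_smul[OF S_End[OF uS]])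
    qed
    have Nsub: "E.subspace ?N"
      using E.subspace_inter[OF SK_sub EE.linear_subspace_kernel[OF linear_precomp[of e']]]
      by (simp add: Int_def)
    have Nfg: "E.fin_gen ?N" by (rule E.fin_gen_mono[OF _ corner_fin_gen[OF SKc]]) blast
    have "V.dim ((\<lambda>u. u x) ` ?N) = E.dim ?N"
    proof (rule EV.dim_image_eq_gen[OF linear_eval Nsub Nfg])
      fix u assume "u \<in> ?N" "u x = 0"
      then have "u v = 0" for v using uN[of u v] by simp
      then show "u = 0" by auto
    qed
    moreover have "(\<lambda>u. u x) ` ?N \<subseteq> Z"
    proof
      fix z assume "z \<in> (\<lambda>u. u x) ` ?N"
      then obtain u where u: "u \<in> ?N" "z = u x" by blast
      have "(\<lambda>v. z \<cdot> f v) = u"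
      proof
        show "z \<cdot> f v = u v" for v unfolding u(2) by (rule uN[OF u(1), symmetric])
      qed
      moreover have "u \<in> S" "e' z = z" using u SKf[of u x] SKS by auto
      ultimately show "z \<in> Z" by (simp add: Z_def)
    qed
    then have "V.dim ((\<lambda>u. u x) ` ?N) \<le> V.dim Z" by (rule V.fin_gen_dim_mono[OF _ V_fin_gen])
    ultimately show ?thesis by linarith
  qed
  ultimately show ?thesis by linarith
qed

lemma schur_Z: "z \<in> Z \<Longrightarrow> v \<in> S \<Longrightarrow> (\<lambda>w. z \<cdot> (inverse (1 - f (v x)) * f (v (e' w)))) \<in> S"
  unfolding Z_def by (rule schur_mem) auto

context
  assumes irr: "irreducible_on e S"
    and kernel_good: "\<And>z. e' z = z \<Longrightarrow> z \<noteq> 0 \<Longrightarrow> V.dim ((\<lambda>u. u z) ` Sx) = k * d - 1"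
begin

text \<open>\<open>kernel_good\<close> is the induction hypothesis of \<open>eval_hyperplane\<close>
  for \<open>Sx\<close> on \<open>K\<close>. It makes the rank maximal at every nonzero
  \<open>z\<close> of \<open>K\<close>, as \<open>eval_kernel_image\<close> requires.\<close>

lemma Sx_eval_kernel:
  assumes z: "e' z = z" "z \<noteq> 0" and u: "u \<in> Sx" "u z = 0"
  shows "u y \<in> (\<lambda>u. u z) ` Sx"
proof (rule eval_kernel_image[OF Sx_sub Sx_corner Sx_nofix idem_e' z _ _ u])
  show "card_ge TYPE('f) (V.dim (range e'))" using big' dim_e' by simp
  fix y assume y: "e' y = y"
  show "V.dim ((\<lambda>u. u y) ` Sx) \<le> V.dim ((\<lambda>u. u z) ` Sx)"
  proof (cases "y = 0")
    case True
    then have "(\<lambda>u. u y) ` Sx \<subseteq> {0}" using End_0[OF S_End] by auto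
    then have "V.dim ((\<lambda>u. u y) ` Sx) = 0" by (simp only: V.dim_eq_0)
    then show ?thesis by (metis le0)
  next
    case False
    then show ?thesis using kernel_good[OF y False] kernel_good[OF z] by simp
  qed
qed

text \<open>Suppose \<open>p\<close> is not in \<open>I\<close> and let
  \<open>q = inverse p\<close>. If \<open>\<phi> (x \<cdot> q) \<noteq> 0\<close>, a scalar multiple
  of \<open>q\<close> has the form \<open>1 - a\<close> with
  \<open>\<phi> (x \<cdot> a) = 0\<close>. Otherwise all \<open>inverse (1 - \<iota> t * q)\<close>
  are in \<open>I\<close>, so \<open>I\<close> contains a subspace through 1 that is stable under
  \<open>q\<close>; multiplication by \<open>q\<close> is onto there, which puts \<open>p\<close> in
  \<open>I\<close>.\<close>

lemma inverses_span_D: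
  assumes I: "D.subspace I" and inv: "\<And>a. \<phi> (x \<cdot> a) = 0 \<Longrightarrow> inverse (1 - a) \<in> I"
  shows "p \<in> I"
proof (rule ccontr)
  assume nin: "p \<notin> I"
  then have p0: "p \<noteq> 0" using D.subspace_0[OF I] by blast
  define q where "q = inverse p"
  have q0: "q \<noteq> 0" using p0 by (simp add: q_def)
  have \<phi>q: "\<phi> (x \<cdot> q) = 0"
  proof (rule ccontr)
    define c where "c = \<phi> (x \<cdot> q)"
    assume "\<phi> (x \<cdot> q) \<noteq> 0"
    then have c: "c \<noteq> 0" by (simp add: c_def)
    let ?a = "1 - q * \<iota> (inverse c)"
    have "\<phi> (x \<cdot> ?a) = 0"
      using c by (simp add: smul_diff_right smul_one smul_smul[symmetric] \<phi>_simps c_def)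
    then have "inverse (q * \<iota> (inverse c)) \<in> I" using inv[of ?a] by simp
    moreover have "inverse (q * \<iota> (inverse c)) = \<iota> c * p"
      using p0 c by (simp add: nonzero_inverse_mult_distrib q_def embed_inverse)
    ultimately have "ds (inverse c) (\<iota> c * p) \<in> I" using D.subspace_scale[OF I] by metis
    moreover have "ds (inverse c) (\<iota> c * p) = p"
      using c by (simp add: ring_scale_def embed_inverse mult.assoc[symmetric])
    ultimately show False using nin by simp
  qed
  have ne: "1 - \<iota> t * q \<noteq> 0" for t
  proof
    assume "1 - \<iota> t * q = 0"
    then have "\<phi> (x \<cdot> (q * \<iota> t)) = 1" using \<phi>_x by (simp add: embed_central smul_one)
    then show False by (simp add: smul_smul[symmetric] \<phi>_simps \<phi>q)
  qed
  have r: "inverse (1 - \<iota> t * q) \<in> I" for t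
    by (rule inv) (simp add: embed_central smul_smul[symmetric] \<phi>_simps \<phi>q)
  have lin: "Vector_Spaces.linear ds ds ((*) q)"
  proof (rule linearI_space)
    show "q * ds c r = ds c (q * r)" for c r
      unfolding ring_scale_def by (metis embed_central mult.assoc)
  qed (simp_all add: spaces distrib_left)
  have "D.dim I < D.dim UNIV"
    using D.fin_gen_dim_eq[OF I subset_UNIV D_fin_gen] nin by (metis UNIV_I not_le_imp_less)
  then have "Suc (D.dim I) \<le> Suc k * d" by (simp only: D.dim_UNIV) simp
  then have c: "card_ge TYPE('f) (Suc (D.dim I))" by (rule card_ge_mono[OF big])
  obtain C where C: "D.subspace C" "C \<subseteq> I" "1 \<in> C" "\<And>c. c \<in> C \<Longrightarrow> q * c \<in> C"
  proof (rule D.resolvent_invariant[OF lin I D_fin_gen c r])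
    show "inverse (1 - \<iota> t * q) - ds t (q * inverse (1 - \<iota> t * q)) = 1" for t
    proof -
      have "inverse (1 - \<iota> t * q) - ds t (q * inverse (1 - \<iota> t * q)) = (1 - \<iota> t * q) * inverse (1 - \<iota> t * q)"
        by (simp add: ring_scale_def left_diff_distrib mult.assoc)
      then show ?thesis using ne by simp
    qed
  qed blast
  interpret DD: linear_space_pair ds ds ..
  have "(*) q ` C = C"
  proof (rule D.fin_gen_dim_eq[OF DD.linear_subspace_image[OF lin C(1)] _ D_fin_gen])
    show "(*) q ` C \<subseteq> C" using C(4) by blast
    show "D.dim C \<le> D.dim ((*) q ` C)"
      using DD.dim_image_eq_gen[OF lin C(1) D_fin_gen] q0 by simp
  qed
  then obtain c where "c \<in> C" "q * c = 1" using C(3) by (metis imageE)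
  then have "c = p" using p0 by (metis inverse_inverse_eq inverse_unique q_def)
  then show False using C(2) \<open>c \<in> C\<close> nin by blast
qed

text \<open>For \<open>w x = x \<cdot> a\<close>, the Schur operators of \<open>w + u0\<close> and
  \<open>w\<close> differ by \<open>v \<mapsto> z \<cdot> (inverse (1 - a) * f (u0 v))\<close>. By
  \<open>inverses_span_D\<close>, any \<open>p\<close> may then replace the inverse. A suitable
  \<open>p\<close> would yield an operator fixing \<open>z\<close> unless
  \<open>f (u0 z) = 0\<close>; in that case these operators kill \<open>x\<close> and
  \<open>z\<close>, yet one of them has \<open>z\<close> in its image, against
  \<open>Sx_eval_kernel\<close>.\<close>

lemma row_zero:
  assumes z: "z \<in> Z" "z \<noteq> 0" and u0: "u0 \<in> S" "f (u0 x) = 0"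
  shows "f (u0 v) = 0"
proof (rule ccontr)
  assume nz: "f (u0 v) \<noteq> 0"
  have ez: "e' z = z" using z by (simp add: Z_def)
  let ?g = "\<lambda>p v. z \<cdot> (p * f (u0 v))"
  define I where "I = {p. ?g p \<in> S}"
  have u0E: "u0 \<in> End smul" by (rule S_End[OF u0(1)])
  have u0e: "f (u0 (e' w)) = f (u0 w)" for w
  proof -
    have "u0 (e' w) = u0 w - u0 x \<cdot> f w"
      unfolding e'_def by (simp add: End_diff[OF u0E] End_smul[OF u0E] S_e u0)
    then show ?thesis by (simp add: f_simps u0)
  qed
  have I: "D.subspace I"
    unfolding I_def by (rule DE.linear_subspace_linear_preimage[OF linear_rank1' S_sub])
  have I1: "p \<in> I" for p
  proof (rule inverses_span_D[OF I])
    fix a assume a: "\<phi> (x \<cdot> a) = 0"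
    then have "x \<cdot> a \<in> (\<lambda>u. u x) ` S" unfolding eval_x_image by (simp add: e_simps)
    then obtain w where w: "w \<in> S" "w x = x \<cdot> a" by auto
    have "f (w x) = a" by (simp add: w f_simps)
    moreover have "w + u0 \<in> S" using E.subspace_add[OF S_sub w(1) u0(1)] .
    ultimately have "(\<lambda>v. z \<cdot> (inverse (1 - a) * f ((w + u0) (e' v)))) \<in> S"
      "(\<lambda>v. z \<cdot> (inverse (1 - a) * f (w (e' v)))) \<in> S"
      using schur_Z[OF z(1), of "w + u0"] schur_Z[OF z(1) w(1)] by (simp_all add: f_simps u0)
    from E.subspace_diff[OF S_sub this]
    have "(\<lambda>v. z \<cdot> (inverse (1 - a) * f (u0 v))) \<in> S"
      by (simp add: fun_diff_def smul_diff_right[symmetric] f_simps u0e distrib_left)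
    then show "inverse (1 - a) \<in> I" by (simp add: I_def)
  qed
  have "f (u0 z) = 0"
  proof (rule ccontr)
    assume "f (u0 z) \<noteq> 0"
    then have "?g (inverse (f (u0 z))) z = z" by (simp add: smul_one)
    moreover have "?g (inverse (f (u0 z))) \<in> S"
      using I1[of "inverse (f (u0 z))"] unfolding I_def by (rule CollectD)
    ultimately have "z = 0" by (intro no_fixed_vector)
    then show False using z(2) by simp
  qed
  let ?u = "?g (inverse (f (u0 v)))"
  have "?u \<in> Sx" using I1[of "inverse (f (u0 v))"] by (simp add: I_def u0)
  moreover have "?u z = 0" using \<open>f (u0 z) = 0\<close> by simp
  ultimately have "?u v \<in> (\<lambda>u. u z) ` Sx" by (rule Sx_eval_kernel[OF ez z(2)])
  then have "z \<in> (\<lambda>u. u z) ` Sx" using nz by (simp add: smul_one)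
  then show False using eval_dim_less(2)[OF Sx_sub Sx_corner Sx_nofix idem_e' ez z(2)] by simp
qed

text \<open>By \<open>row_zero\<close>, a nonzero element of \<open>Z\<close> makes
  \<open>SK\<close> the kernel of \<open>u \<mapsto> f (u x)\<close>, whose image omits 1. Counting
  dimensions gives \<open>dim Z \<ge> k * d\<close>, so \<open>Z\<close> is all of \<open>K\<close>.
  Then no \<open>v\<close> in \<open>S\<close> can move \<open>K\<close> out of itself, and
  \<open>K\<close> contradicts \<open>irr\<close>.\<close>

lemma Z_trivial: "Z \<subseteq> {0}"
proof (rule ccontr)
  assume "\<not> Z \<subseteq> {0}"
  then obtain z0 where z0: "z0 \<in> Z" "z0 \<noteq> 0" by blast
  have Ze: "Z \<subseteq> range e'" by (auto simp: Z_def intro: range_eqI[OF sym])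
  have ez0: "e' z0 = z0" using z0 by (simp add: Z_def)
  let ?h = "\<lambda>u. f (u x)"
  have lin: "Vector_Spaces.linear es ds ?h" by (rule linear_comp[OF linear_eval dlin_linear[OF f_dlin]])
  have "E.dim S = D.dim (?h ` S) + E.dim {u \<in> S. ?h u = 0}"
    by (rule ED.rank_nullity[OF lin S_sub corner_fin_gen[OF S_corner]])
  moreover have "D.dim (?h ` S) < d"
  proof -
    have "1 \<notin> ?h ` S" using f_S_x by auto
    then have "?h ` S \<noteq> UNIV" by blast
    then have "D.dim (?h ` S) < D.dim UNIV"
      using D.fin_gen_dim_eq[OF ED.linear_subspace_image[OF lin S_sub] subset_UNIV D_fin_gen]
      by (meson not_le_imp_less)
    then show ?thesis by (simp only: D.dim_UNIV)
  qed
  moreover have "{u \<in> S. ?h u = 0} = SK"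
  proof
    show "{u \<in> S. ?h u = 0} \<subseteq> SK"
    proof
      fix u assume u: "u \<in> {u \<in> S. ?h u = 0}"
      then have "f (u v) = 0" for v using row_zero[OF z0] by blast
      then have "\<phi> (u v) = 0" for v using \<phi>_f[of "u v"] by (simp add: \<phi>_simps)
      then show "u \<in> SK" using u by (simp add: SK_def)
    qed
    show "SK \<subseteq> {u \<in> S. ?h u = 0}" using f_0_S by (auto simp: SK_def)
  qed
  ultimately have "tri_dim d (Suc k) < d + tri_dim d k + V.dim Z"
    using dim_SK_le S_dim by simp
  then have "k * d \<le> V.dim Z" using d_pos by simp
  then have Zeq: "Z = range e'"
    using V.fin_gen_dim_eq[OF Z_sub Ze V_fin_gen] dim_e' by simp
  have fv: "f (v w) = 0" if v: "v \<in> S" and w: "e' w = w" for v w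
  proof (rule ccontr)
    assume nz: "f (v w) \<noteq> 0"
    \<comment> \<open>Scaled so that the Schur operator built from \<open>?z = w \<cdot> r\<close>
      fixes \<open>?z\<close>.\<close>
    define r where "r = inverse (f (v w)) * (1 - f (v x))"
    have r0: "r \<noteq> 0" using nz f_S_x[OF v] by (simp add: r_def)
    have w0: "w \<noteq> 0" using nz End_0[OF S_End[OF v]] by (auto simp: f_simps)
    let ?z = "w \<cdot> r"
    have ez: "e' ?z = ?z" using w by (simp add: End_smul[OF e'_End])
    then have "?z \<in> Z" unfolding Zeq by (metis rangeI)
    then have U: "(\<lambda>w. ?z \<cdot> (inverse (1 - f (v x)) * f (v (e' w)))) \<in> S" using v by (rule schur_Z)
    have "inverse (1 - f (v x)) * f (v (e' ?z)) = 1"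
    proof -
      have "f (v (e' ?z)) = f (v w) * r" by (simp add: ez End_smul[OF S_End[OF v]] f_simps)
      also have "\<dots> = 1 - f (v x)" using nz by (simp add: r_def mult.assoc[symmetric])
      finally show ?thesis using f_S_x[OF v] by simp
    qed
    then have "?z = 0" by (intro no_fixed_vector[OF U]) (simp add: smul_one)
    then show False using w0 r0 by simp
  qed
  have rs: "right_subspace smul (range e')"
    unfolding right_subspace_def
    by (auto simp: End_add[OF e'_End, symmetric] End_smul[OF e'_End, symmetric] intro: range_eqI[of 0 e' 0])
      (metis End_0[OF e'_End] rangeI)
  have sub: "range e' \<subseteq> range e" using e_e' by (auto intro: range_eqI[OF sym])
  have inv: "\<forall>u\<in>S. u ` range e' \<subseteq> range e'"
  proof (intro ballI subsetI)
    fix u v assume u: "u \<in> S" and "v \<in> u ` range e'"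
    then obtain w where w: "v = u (e' w)" by auto
    have "e' v = v" unfolding w e'_fix using S_e(1)[OF u] fv[OF u e'_e'] by simp
    then show "v \<in> range e'" by (metis rangeI)
  qed
  have "range e' = {0} \<or> range e' = range e"
    using irr[unfolded irreducible_on_def, rule_format, OF conjI[OF rs conjI[OF sub inv]]] .
  then show False
  proof
    assume "range e' = {0}"
    then show False using ez0 z0(2) by (metis rangeI singletonD)
  next
    assume "range e' = range e"
    then obtain w where "x = e' w" using ex by (metis imageE rangeI)
    then have "e' x = x" using e'_e'[of w] by simp
    then show False using e'_x x_nz by simp
  qed
qed

text \<open>For a bad \<open>y\<close>, the form \<open>\<phi>\<close> also vanishes on
  \<open>S y2\<close> for some D-multiple \<open>y2\<close> of \<open>y\<close> outside the F-line
  of \<open>x\<close>. Membership in \<open>SK\<close> then costs at most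
  \<open>Suc k * d - 2\<close> linear conditions, and \<open>dim S\<close> falls below the bound
  because \<open>Z\<close> is trivial.\<close>

theorem all_vectors_good:
  assumes y: "e y = y" "y \<noteq> 0"
  shows "V.dim ((\<lambda>u. u y) ` S) = Suc k * d - 1"
proof (rule ccontr)
  assume "\<not> ?thesis"
  then have bad: "V.dim ((\<lambda>u. u y) ` S) < Suc k * d - 1" using eval_rank_le[OF y(1)] by simp
  let ?Y = "(\<lambda>u. u y) ` S" and ?y = "e' y"
  have dec: "y = x \<cdot> f y + ?y" using decomp[of y] y(1) by simp
  have y'0: "?y \<noteq> 0"
  proof
    assume "?y = 0"
    then have yx: "y = x \<cdot> f y" using dec by simp
    then have fy: "f y \<noteq> 0" using y(2) by auto
    have "?Y = (\<lambda>v. v \<cdot> f y) ` ((\<lambda>u. u x) ` S)"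
      unfolding image_image
    proof (rule image_cong[OF refl])
      fix u assume "u \<in> S"
      then show "u y = u x \<cdot> f y" using yx End_smul[OF S_End, of u x "f y"] by simp
    qed
    moreover have "V.dim ((\<lambda>v. v \<cdot> f y) ` ((\<lambda>u. u x) ` S)) = V.dim ((\<lambda>u. u x) ` S)"
      by (rule VV.dim_image_eq_gen[OF linear_smul_left eval_subspace[OF S_sub] V_fin_gen]) (use fy in auto)
    ultimately show False using bad x_good by simp
  qed
  have kd: "k * d > 0"
  proof (rule ccontr)
    assume "\<not> k * d > 0"
    then have "V.dim (range e') = 0" using dim_e' by simp
    then have "range e' \<subseteq> {0}" by (simp only: V.dim_eq_0)
    then show False using y'0 by blast
  qed
  \<comment> \<open>The kernel part contains the evaluation of \<open>Sx\<close> at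
    \<open>?y\<close>, of dimension \<open>k * d - 1\<close>, which leaves less than
    \<open>d\<close> for the image under \<open>f\<close>.\<close>
  have "V.dim ?Y = D.dim (f ` ?Y) + V.dim {v \<in> ?Y. f v = 0}"
    by (rule VD.rank_nullity[OF dlin_linear[OF f_dlin] eval_subspace[OF S_sub] V_fin_gen])
  moreover have "k * d - 1 \<le> V.dim {v \<in> ?Y. f v = 0}"
  proof -
    have "(\<lambda>u. u ?y) ` Sx \<subseteq> {v \<in> ?Y. f v = 0}"
    proof
      fix v assume "v \<in> (\<lambda>u. u ?y) ` Sx"
      then obtain u where u: "u \<in> S" "u x = 0" "v = u ?y" by auto
      have "u y = u (x \<cdot> f y + ?y)" using dec by simp
      then have "u y = v" using u by (simp add: End_add[OF S_End] End_smul[OF S_End])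
      then have "v \<in> ?Y" using u(1) by (intro image_eqI[of _ _ u]) auto
      then show "v \<in> {v \<in> ?Y. f v = 0}" using u Sx_f[OF u(1,2)] by auto
    qed
    then have "V.dim ((\<lambda>u. u ?y) ` Sx) \<le> V.dim {v \<in> ?Y. f v = 0}"
      by (rule V.fin_gen_dim_mono[OF _ V_fin_gen])
    then show ?thesis using kernel_good[OF e'_e' y'0] by simp
  qed
  ultimately have "D.dim (f ` ?Y) < d" using bad kd by simp
  then have "f ` ?Y \<noteq> UNIV" by (metis D.dim_UNIV less_irrefl)
  then obtain p where p: "p \<notin> f ` ?Y" by blast
  have "D.subspace (f ` ?Y)"
    by (rule VD.linear_subspace_image[OF dlin_linear[OF f_dlin] eval_subspace[OF S_sub]])
  then obtain \<omega> where \<omega>: "Vector_Spaces.linear ds (*) \<omega>" "\<And>q. q \<in> f ` ?Y \<Longrightarrow> \<omega> q = 0" "\<omega> p = 1"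
    using D.form_exists[OF _ p] by metis
  obtain r where r: "\<And>q. \<omega> q = \<phi> (x \<cdot> (q * r))" using form_on_D[OF \<omega>(1)] by blast
  have r0: "r \<noteq> 0" using \<omega>(3) r[of p] by (auto simp: \<phi>_simps)
  define y2 where "y2 = y \<cdot> r"
  have \<phi>y2: "\<phi> (u y2) = 0" if u: "u \<in> S" for u
  proof -
    have "\<phi> (u y2) = \<phi> (x \<cdot> (f (u y) * r))"
      using \<phi>_f[of "u y2"] by (simp add: y2_def End_smul[OF S_End[OF u]] f_simps)
    also have "\<dots> = \<omega> (f (u y))" by (simp add: r)
    also have "\<dots> = 0" using \<omega>(2) u by blast
    finally show ?thesis .
  qed
  have ey2: "e y2 = y2" by (simp add: y2_def e_simps y)
  have "y2 \<notin> V.span {x}"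
  proof
    assume "y2 \<in> V.span {x}"
    then obtain c where "y2 = x \<cdot> \<iota> c" by (auto simp: V.span_singleton vec_scale_def)
    then have "e' y2 = 0" by (simp add: End_smul[OF e'_End] e'_x)
    then show False using y'0 r0 by (simp add: y2_def End_smul[OF e'_End])
  qed
  moreover have "V.independent {x}" using x_nz by simp
  ultimately have ind: "V.independent {y2, x}" by (rule V.independent_insertI)
  have yx: "y2 \<noteq> x" using \<open>y2 \<notin> V.span {x}\<close> V.span_base by auto
  have "{y2, x} \<subseteq> range e" using ey2 ex by (metis empty_subsetI insert_subset rangeI)
  then obtain B where B: "{y2, x} \<subseteq> B" "B \<subseteq> range e" "V.independent B" "range e \<subseteq> V.span B"
    using V.maximal_independent_subset_extend[OF _ ind] by metis
  have Bf: "finite B" "card B = Suc k * d"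
    using V.fin_gen_independent[OF V_fin_gen B(2,3)] V.basis_card_eq_dim[OF B(2,4,3)] dim_e by auto
  let ?I = "B - {y2, x}"
  have "card ?I = Suc k * d - 2" using Bf B(1) yx by (simp add: card_Diff_subset)
  moreover have "E.dim S \<le> E.dim {u \<in> S. \<forall>b\<in>?I. \<phi> (u b) = 0} + card ?I"
    using Bf(1) by (intro E.dim_kernels S_sub corner_fin_gen[OF S_corner] form_eval \<phi>_form) auto
  moreover have "{u \<in> S. \<forall>b\<in>?I. \<phi> (u b) = 0} \<subseteq> SK"
  proof
    fix u assume u: "u \<in> {u \<in> S. \<forall>b\<in>?I. \<phi> (u b) = 0}"
    then have uS: "u \<in> S" by blast
    have b: "\<phi> (u b) = 0" if "b \<in> B" for b
      using u that \<phi>y2[OF uS] \<phi>_S[OF uS] by blast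
    have "\<phi> (u v) = 0" for v
    proof -
      have "e v \<in> V.span B" using B(4) by blast
      then have "\<phi> (u (e v)) = 0"
        using VF.linear_eq_0_on_span[OF form_End[OF \<phi>_form S_End[OF uS]] b] by blast
      then show ?thesis by (simp add: S_e uS)
    qed
    then show "u \<in> SK" using uS by (simp add: SK_def)
  qed
  then have "E.dim {u \<in> S. \<forall>b\<in>?I. \<phi> (u b) = 0} \<le> E.dim SK"
  proof (rule E.fin_gen_dim_mono)
    show "E.fin_gen SK" using S_corner by (intro corner_fin_gen[of _ e]) (auto simp: SK_def)
  qed
  moreover have "V.dim Z = 0" using Z_trivial by (simp only: V.dim_eq_0)
  moreover have "tri_dim d (Suc k) = tri_dim d k + (Suc k * d - 1)" by simp
  moreover have "Suc k * d \<ge> 2" using kd d_pos unfolding mult_Suc by linarith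
  ultimately show False using dim_SK_le S_dim by linarith
qed

end

end

section \<open>Induction on the D-dimension\<close>

context division_space
begin

lemma optimal_pivot_exists:
  assumes e: "idem e" "V.dim (range e) = Suc k * d" "card_ge TYPE('f) (Suc k * d)"
    and S: "E.subspace S" "S \<subseteq> corner e" "nofix S" "E.dim S = tri_dim d (Suc k)"
  obtains x \<phi> f where "optimal_pivot \<iota> smul BD BV e S k x \<phi> f"
proof -
  obtain x where x: "e x = x" "x \<noteq> 0" "\<And>y. e y = y \<Longrightarrow> V.dim ((\<lambda>u. u y) ` S) \<le> V.dim ((\<lambda>u. u x) ` S)"
    using max_eval_vector[OF e(1,2) S(2)] by blast
  obtain \<phi> f where "pivot \<iota> smul BD BV e S k x \<phi> f"
    using pivot_exists[OF e(1,2) S(1-3) x(1,2)] by blast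
  then interpret P: pivot \<iota> smul BD BV e S k x \<phi> f .
  have "E.dim P.Sx \<le> tri_dim d k"
    by (rule corner_bound[OF P.idem_e' P.dim_e' _ P.Sx_sub P.Sx_corner_gen[OF e(3) x(3)] P.Sx_nofix])
      (use e(3) card_ge_mono[of "Suc k * d" "k * d"] in auto)
  moreover have "V.dim ((\<lambda>u. u x) ` S) < Suc k * d"
    using eval_dim_less(1)[OF S(1-3) e(1) x(1,2)] e(2) by simp
  moreover have "E.dim S = V.dim ((\<lambda>u. u x) ` S) + E.dim P.Sx"
    by (rule EV.rank_nullity[OF linear_eval S(1) corner_fin_gen[OF S(2)]])
  ultimately have "V.dim ((\<lambda>u. u x) ` S) = Suc k * d - 1" using S(4) by simp
  then have "optimal_pivot \<iota> smul BD BV e S k x \<phi> f"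
    by (intro optimal_pivot.intro P.pivot_axioms optimal_pivot_axioms.intro e(3) S(4))
  then show ?thesis by (rule that)
qed

theorem eval_hyperplane:
  assumes "idem e" "V.dim (range e) = k * d" "card_ge TYPE('f) (k * d)"
    "E.subspace S" "S \<subseteq> corner e" "nofix S" "E.dim S = tri_dim d k" "irreducible_on e S"
    "e y = y" "y \<noteq> 0"
  shows "V.dim ((\<lambda>u. u y) ` S) = k * d - 1"
  using assms
proof (induction k arbitrary: e S y)
  case 0
  then have "V.dim (range e) = 0" by simp
  then have "range e \<subseteq> {0}" by (simp only: V.dim_eq_0)
  then show ?case using 0 by (metis rangeI singletonD subsetD)
next
  case (Suc k)
  obtain x \<phi> f where "optimal_pivot \<iota> smul BD BV e S k x \<phi> f"
    using optimal_pivot_exists[OF Suc.prems(1-7)] by blast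
  then interpret P: optimal_pivot \<iota> smul BD BV e S k x \<phi> f .
  show ?case
  proof (rule P.all_vectors_good[OF Suc.prems(8) _ Suc.prems(9,10)])
    fix z assume z: "P.e' z = z" "z \<noteq> 0"
    show "V.dim ((\<lambda>u. u z) ` P.Sx) = k * d - 1"
      by (rule Suc.IH[OF P.idem_e' P.dim_e' P.big' P.Sx_sub P.Sx_corner P.Sx_nofix P.Sx_dim
            P.irreducible_descent[OF Suc.prems(8)] z])
  qed
qed

end

section \<open>The annihilating bilinear form\<close>

text \<open>\<open>quadratic\<close> is the form in which the quadratic type of D enters; it serves
  \<open>pair_relation_line\<close>.\<close>

locale irreducible_optimal = division_space \<iota> smul BD BV
  for \<iota> :: "'f::field \<Rightarrow> 'd::division_ring" and smul :: "'v::ab_group_add \<Rightarrow> 'd \<Rightarrow> 'v" (infixl "\<cdot>" 70)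
    and BD BV +
  fixes S :: "('v \<Rightarrow> 'v) set" and k :: nat
  assumes S_sub_End: "S \<subseteq> End smul" and S_sub: "E.subspace S" and S_nofix: "nofix S"
    and S_dim: "E.dim S = tri_dim d (Suc k)"
    and V_dim: "V.dim (UNIV :: 'v set) = Suc k * d"
    and big: "card_ge TYPE('f) (Suc k * d)"
    and irr: "irreducible_on (\<lambda>v. v) S"
    and quadratic: "\<exists>s t. q * q = q * \<iota> s + \<iota> t"
begin

lemma S_End: "u \<in> S \<Longrightarrow> u \<in> End smul"
  using S_sub_End by blast

lemma idem_id: "idem (\<lambda>v. v)"
  by (simp add: idem_def End_id)

lemma S_corner: "S \<subseteq> corner (\<lambda>v. v)"
  using S_sub_End by (auto simp: corner_def)

lemma range_id: "V.dim (range (\<lambda>v::'v. v)) = Suc k * d"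
  using V_dim by (simp only: image_ident)

section \<open>Annihilators of the evaluation spaces\<close>

definition ann :: "'v \<Rightarrow> ('v \<Rightarrow> 'f) \<Rightarrow> bool" where
  "ann x \<psi> \<longleftrightarrow> form \<psi> \<and> (\<forall>u\<in>S. \<psi> (u x) = 0)"

lemma pivot_at:
  assumes "x \<noteq> 0"
  obtains \<phi> f where "optimal_pivot \<iota> smul BD BV (\<lambda>v. v) S k x \<phi> f"
proof -
  obtain \<phi> f where "pivot \<iota> smul BD BV (\<lambda>v. v) S k x \<phi> f"
    using pivot_exists[OF idem_id range_id S_sub S_corner S_nofix refl assms] by blast
  then have "optimal_pivot \<iota> smul BD BV (\<lambda>v. v) S k x \<phi> f"
    by (intro optimal_pivot.intro optimal_pivot_axioms.intro big S_dim
        eval_hyperplane[OF idem_id range_id big S_sub S_corner S_nofix S_dim irr refl assms])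
  then show ?thesis by (rule that)
qed

text \<open>For \<open>x \<noteq> 0\<close> the choice is immaterial by \<open>ann_unique\<close>:
  the form has kernel \<open>S x\<close> and value 1 at \<open>x\<close>.\<close>

definition \<Phi> :: "'v \<Rightarrow> 'v \<Rightarrow> 'f" where
  "\<Phi> x = (SOME \<phi>. \<exists>f. optimal_pivot \<iota> smul BD BV (\<lambda>v. v) S k x \<phi> f)"

lemma \<Phi>_pivot:
  assumes "x \<noteq> 0"
  obtains f where "optimal_pivot \<iota> smul BD BV (\<lambda>v. v) S k x (\<Phi> x) f"
proof -
  have "\<exists>\<phi>. \<exists>f. optimal_pivot \<iota> smul BD BV (\<lambda>v. v) S k x \<phi> f"
    using pivot_at[OF assms] by metis
  from someI_ex[OF this] that show ?thesis unfolding \<Phi>_def by blast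
qed

lemma \<Phi>_props:
  assumes "x \<noteq> 0"
  shows \<Phi>_form: "form (\<Phi> x)" and \<Phi>_self: "\<Phi> x x = 1" and \<Phi>_ann: "ann x (\<Phi> x)"
    and \<Phi>_image: "(\<lambda>u. u x) ` S = {v. \<Phi> x v = 0}"
    and \<Phi>_kernel: "u \<in> S \<Longrightarrow> u x = 0 \<Longrightarrow> \<Phi> x (u y) = 0"
proof -
  obtain f where "optimal_pivot \<iota> smul BD BV (\<lambda>v. v) S k x (\<Phi> x) f" using \<Phi>_pivot[OF assms] .
  then interpret P: optimal_pivot \<iota> smul BD BV "\<lambda>v. v" S k x "\<Phi> x" f .
  show f: "form (\<Phi> x)" "\<Phi> x x = 1" by (rule P.\<phi>_form P.\<phi>_x)+
  show "ann x (\<Phi> x)" using f P.\<phi>_S by (simp add: ann_def)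
  show "(\<lambda>u. u x) ` S = {v. \<Phi> x v = 0}" using P.eval_x_image by simp
  show "\<Phi> x (u y) = 0" if "u \<in> S" "u x = 0"
  proof -
    have "\<Phi> x (x \<cdot> f (u y)) = 0" by (simp add: P.Sx_f[OF that] form_0[OF f(1)])
    then show ?thesis by (simp only: P.\<phi>_f[of "u y", symmetric])
  qed
qed

lemma ann_unique:
  assumes "x \<noteq> 0" "ann x \<psi>"
  shows "\<psi> v = \<psi> x * \<Phi> x v"
proof -
  have \<psi>: "form \<psi>" using assms by (simp add: ann_def)
  have "v - x \<cdot> \<iota> (\<Phi> x v) \<in> (\<lambda>u. u x) ` S"
    unfolding \<Phi>_image[OF assms(1)]
    by (simp add: form_diff[OF \<Phi>_form] form_scale[OF \<Phi>_form] \<Phi>_self assms(1))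
  then have "\<psi> (v - x \<cdot> \<iota> (\<Phi> x v)) = 0" using assms(2) by (auto simp: ann_def)
  then show ?thesis by (simp add: form_diff[OF \<psi>] form_scale[OF \<psi>] mult.commute)
qed

lemma ann_self_nz:
  assumes "x \<noteq> 0" "ann x \<psi>" "\<psi> v \<noteq> 0"
  shows "\<psi> x \<noteq> 0"
  using ann_unique[OF assms(1,2), of v] assms(3) by auto

lemma form_lincomb: "form \<phi> \<Longrightarrow> form \<psi> \<Longrightarrow> form (\<lambda>v. a * \<phi> v + b * \<psi> v)"
  by (intro VF.linear_compose_add VF.linear_compose_scale_right)

lemma ann_lincomb: "ann x \<phi> \<Longrightarrow> ann x \<psi> \<Longrightarrow> ann x (\<lambda>v. a * \<phi> v + b * \<psi> v)"
  by (simp add: ann_def form_lincomb)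

lemma ann_lincomb_vec: "ann x \<psi> \<Longrightarrow> ann y \<psi> \<Longrightarrow> ann (x \<cdot> \<iota> a + y \<cdot> \<iota> b) \<psi>"
  by (simp add: ann_def End_add[OF S_End] End_smul[OF S_End] form_add form_scale)

lemma ann_smul: "ann x \<psi> \<Longrightarrow> q \<noteq> 0 \<Longrightarrow> ann (x \<cdot> q) (\<lambda>v. \<psi> (v \<cdot> inverse q))"
  by (simp add: ann_def form_smul End_smul[OF S_End] smul_smul smul_one)

lemma ann_smul': "ann x \<psi> \<Longrightarrow> q \<noteq> 0 \<Longrightarrow> ann (x \<cdot> inverse q) (\<lambda>v. \<psi> (v \<cdot> q))"
  using ann_smul[of x \<psi> "inverse q"] by simp

text \<open>\<open>\<psi>\<close> annihilates \<open>S z\<close> and vanishes at \<open>z = x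
  \<cdot> \<iota> (\<psi> y) - y \<cdot> \<iota> (\<psi> x)\<close>, so \<open>z = 0\<close> by
  \<open>ann_self_nz\<close>. This is injectivity of the map from the F-line of \<open>x\<close> to
  the line of \<open>\<Phi> x\<close>.\<close>

lemma ann_inj:
  assumes "x \<noteq> 0" "ann x \<psi>" "ann y \<psi>" "\<psi> v \<noteq> 0"
  obtains c where "y = x \<cdot> \<iota> c"
proof -
  have \<psi>: "form \<psi>" using assms by (simp add: ann_def)
  have x: "\<psi> x \<noteq> 0" by (rule ann_self_nz[OF assms(1,2,4)])
  let ?z = "x \<cdot> \<iota> (\<psi> y) + y \<cdot> \<iota> (- \<psi> x)"
  have "?z = 0"
  proof (rule ccontr)
    assume "?z \<noteq> 0"
    then have "\<psi> ?z \<noteq> 0" using ann_lincomb_vec[OF assms(2,3)] assms(4) by (rule ann_self_nz)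
    then show False by (simp add: form_add[OF \<psi>] form_scale[OF \<psi>] mult.commute)
  qed
  then have "y \<cdot> \<iota> (\<psi> x) = x \<cdot> \<iota> (\<psi> y)" by (simp add: embed_neg eq_neg_iff_add_eq_0)
  then have "y \<cdot> \<iota> (\<psi> x) \<cdot> \<iota> (inverse (\<psi> x)) = x \<cdot> \<iota> (\<psi> y) \<cdot> \<iota> (inverse (\<psi> x))" by simp
  then have "y = x \<cdot> \<iota> (\<psi> y * inverse (\<psi> x))"
    using x by (simp add: smul_smul embed_mult[symmetric] embed_one smul_one)
  then show ?thesis by (rule that)
qed

text \<open>On \<open>K\<close> all forms that kill the values \<open>u y\<close> with
  \<open>u x = 0\<close> are proportional, because these values fill a hyperplane of
  \<open>K\<close>, by \<open>eval_hyperplane\<close> for the evaluation kernel. What remains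
  vanishes on \<open>K\<close> and is \<open>\<Phi> x (v \<cdot> r)\<close> by
  \<open>form_on_D\<close>. \<open>\<Phi> y\<close> does not vanish on \<open>K\<close>, since
  \<open>ann_inj\<close> would then put \<open>y\<close> in \<open>x D\<close>.\<close>

lemma kernel_form_decomp:
  assumes x: "x \<noteq> 0" and indep: "\<And>q. y \<noteq> x \<cdot> q"
    and \<psi>: "form \<psi>" and ker: "\<And>u. u \<in> S \<Longrightarrow> u x = 0 \<Longrightarrow> \<psi> (u y) = 0"
  obtains b r where "\<And>v. \<psi> v = b * \<Phi> y v + \<Phi> x (v \<cdot> r)"
proof -
  have y0: "y \<noteq> 0" using indep[of 0] by simp
  obtain f where "optimal_pivot \<iota> smul BD BV (\<lambda>v. v) S k x (\<Phi> x) f" using \<Phi>_pivot[OF x] .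
  then interpret P: optimal_pivot \<iota> smul BD BV "\<lambda>v. v" S k x "\<Phi> x" f .
  have dec: "v = x \<cdot> f v + P.e' v" for v by (rule P.decomp)
  have y': "P.e' y \<noteq> 0" using indep[of "f y"] dec[of y] by auto
  have "k \<noteq> 0"
  proof
    assume "k = 0"
    then have "V.dim (range P.e') = 0" using P.dim_e' by simp
    then have "range P.e' \<subseteq> {0}" by (simp only: V.dim_eq_0)
    then show False using y' by blast
  qed
  then obtain j where j: "k = Suc j" by (cases k) auto
  note A = P.idem_e' P.dim_e'[unfolded j]
  note B = P.Sx_sub P.Sx_corner P.Sx_nofix
  obtain \<phi>' f' where "pivot \<iota> smul BD BV P.e' P.Sx j (P.e' y) \<phi>' f'"
    using pivot_exists[OF A B P.e'_e' y'] by blast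
  then have "optimal_pivot \<iota> smul BD BV P.e' P.Sx j (P.e' y) \<phi>' f'"
    by (intro optimal_pivot.intro optimal_pivot_axioms.intro P.big'[unfolded j] P.Sx_dim[unfolded j]
        eval_hyperplane[OF A P.big'[unfolded j] B P.Sx_dim[unfolded j] P.irreducible_descent[OF irr] P.e'_e' y'])
  then interpret Q: optimal_pivot \<iota> smul BD BV P.e' P.Sx j "P.e' y" \<phi>' f' .
  have uy: "u y = u (P.e' y)" if "u \<in> S" "u x = 0" for u
    using arg_cong[OF dec[of y], of u] that by (simp add: End_add[OF S_End] End_smul[OF S_End])
  have onK: "\<chi> v = \<phi>' v * \<chi> (P.e' y)"
    if \<chi>: "form \<chi>" "\<forall>u\<in>S. u x = 0 \<longrightarrow> \<chi> (u y) = 0" and v: "P.e' v = v" for \<chi> v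
  proof -
    have "v - P.e' y \<cdot> \<iota> (\<phi>' v) \<in> (\<lambda>u. u (P.e' y)) ` P.Sx"
      unfolding Q.eval_x_image by (simp add: Q.e_simps v Q.\<phi>_x form_diff[OF Q.\<phi>_form] form_scale[OF Q.\<phi>_form])
    then obtain u where u: "u \<in> S" "u x = 0" "v - P.e' y \<cdot> \<iota> (\<phi>' v) = u (P.e' y)" by auto
    have "\<chi> (u y) = 0" using \<chi>(2) u(1,2) by blast
    then have "\<chi> (v - P.e' y \<cdot> \<iota> (\<phi>' v)) = 0" unfolding u(3) uy[OF u(1,2)] .
    then show ?thesis by (simp add: form_diff[OF \<chi>(1)] form_scale[OF \<chi>(1)])
  qed
  have vanish: "\<exists>r. \<forall>v. \<chi> v = \<Phi> x (v \<cdot> r)"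
    if \<chi>: "form \<chi>" "\<And>v. P.e' v = v \<Longrightarrow> \<chi> v = 0" for \<chi>
  proof -
    obtain r where r: "\<And>q. \<chi> (x \<cdot> q) = \<Phi> x (x \<cdot> (q * r))"
      using P.form_on_D[OF form_smul_right[OF \<chi>(1)]] by blast
    have "\<chi> v = \<Phi> x (v \<cdot> r)" for v
    proof -
      have "\<chi> v = \<chi> (x \<cdot> f v)"
        using arg_cong[OF dec[of v], of \<chi>] \<chi>(2)[OF P.e'_e'] by (simp add: form_add[OF \<chi>(1)])
      also have "\<dots> = \<Phi> x (v \<cdot> r)" 
        using r P.\<phi>_f[of "v \<cdot> r"] by (simp only: dlin_smul[OF P.f_dlin])
      finally show ?thesis .
    qed
    then show ?thesis by blast
  qed
  have ker': "\<forall>u\<in>S. u x = 0 \<longrightarrow> \<psi> (u y) = 0" using ker by blast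
  have \<Phi>y: "form (\<Phi> y)" "\<forall>u\<in>S. u x = 0 \<longrightarrow> \<Phi> y (u y) = 0"
    using \<Phi>_form[OF y0] \<Phi>_ann[OF y0] by (auto simp: ann_def)
  have nz: "\<Phi> y (P.e' y) \<noteq> 0"
  proof
    assume "\<Phi> y (P.e' y) = 0"
    then have "\<Phi> y v = 0" if "P.e' v = v" for v using onK[OF \<Phi>y that] by simp
    then obtain r where r: "\<And>v. \<Phi> y v = \<Phi> x (v \<cdot> r)" using vanish[OF \<Phi>y(1)] by blast
    have r0: "r \<noteq> 0" using r[of y] \<Phi>_self[OF y0] form_0[OF \<Phi>_form[OF x]] by auto
    have "ann (x \<cdot> inverse r) (\<Phi> y)"
      using ann_smul'[OF \<Phi>_ann[OF x] r0] by (simp add: r[symmetric])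
    moreover have "\<Phi> y y \<noteq> 0" using \<Phi>_self[OF y0] by simp
    ultimately obtain c where "y = x \<cdot> inverse r \<cdot> \<iota> c"
      using ann_inj[of "x \<cdot> inverse r" "\<Phi> y" y y] \<Phi>_ann[OF y0] x r0 by auto
    then show False using indep by (simp add: smul_smul)
  qed
  define b where "b = \<psi> (P.e' y) / \<Phi> y (P.e' y)"
  have "\<exists>r. \<forall>v. 1 * \<psi> v + (- b) * \<Phi> y v = \<Phi> x (v \<cdot> r)"
  proof (rule vanish[OF form_lincomb[OF \<psi> \<Phi>y(1)]])
    fix v assume v: "P.e' v = v"
    show "1 * \<psi> v + (- b) * \<Phi> y v = 0"
      using onK[OF \<psi> ker' v] onK[OF \<Phi>y v] nz by (simp add: b_def)
  qed
  then obtain r where "\<And>v. \<psi> v - b * \<Phi> y v = \<Phi> x (v \<cdot> r)" by auto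
  then have "\<psi> v = b * \<Phi> y v + \<Phi> x (v \<cdot> r)" for v by (metis add.commute diff_eq_eq)
  then show ?thesis by (rule that)
qed

text \<open>\<open>kernel_form_decomp\<close>, used in both orders, writes
  \<open>\<Phi> (x + y)\<close> in two ways, and \<open>ann_inj\<close> forces
  \<open>r = \<iota> a\<close>. So \<open>\<Phi> (x + y)\<close> is
  \<open>a \<Phi> x + b \<Phi> y\<close> with \<open>a\<close> and \<open>b\<close> nonzero; the
  relation is its vanishing at \<open>u (x + y)\<close>.\<close>

lemma pair_relation_indep:
  assumes x: "x \<noteq> 0" and indep: "\<And>q. y \<noteq> x \<cdot> q"
  obtains c where "c \<noteq> 0" "\<And>u. u \<in> S \<Longrightarrow> \<Phi> x (u y) + c * \<Phi> y (u x) = 0"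
proof -
  have y: "y \<noteq> 0" using indep[of 0] by simp
  have indep': "x \<noteq> y \<cdot> q" for q
  proof
    assume "x = y \<cdot> q"
    then have "q \<noteq> 0" "y = x \<cdot> inverse q" using x by (auto simp: smul_smul smul_one)
    then show False using indep by blast
  qed
  let ?z = "x + y"
  have z: "?z \<noteq> 0" using indep[of "- 1"] by (simp add: smul_one add_eq_0_iff)
  have \<Phi>z: "form (\<Phi> ?z)" by (rule \<Phi>_form[OF z])
  have uz: "\<Phi> ?z (u x) + \<Phi> ?z (u y) = 0" if "u \<in> S" for u
    using \<Phi>_ann[OF z] that by (simp add: ann_def End_add[OF S_End] form_add[OF \<Phi>z])
  obtain b r where br: "\<And>v. \<Phi> ?z v = b * \<Phi> y v + \<Phi> x (v \<cdot> r)"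
  proof (rule kernel_form_decomp[OF x indep \<Phi>z])
    show "\<Phi> ?z (u y) = 0" if "u \<in> S" "u x = 0" for u
      using uz[OF that(1)] that(2) form_0[OF \<Phi>z] by simp
  qed blast
  obtain a r' where ar: "\<And>v. \<Phi> ?z v = a * \<Phi> x v + \<Phi> y (v \<cdot> r')"
  proof (rule kernel_form_decomp[OF y indep' \<Phi>z])
    show "\<Phi> ?z (u x) = 0" if "u \<in> S" "u y = 0" for u
      using uz[OF that(1)] that(2) form_0[OF \<Phi>z] by simp
  qed blast
  let ?p = "r - \<iota> a" and ?p' = "r' - \<iota> b"
  have eq: "\<Phi> x (v \<cdot> ?p) = \<Phi> y (v \<cdot> ?p')" for v
    using br[of v] ar[of v]
    by (simp add: smul_diff_right form_diff[OF \<Phi>_form[OF x]] form_diff[OF \<Phi>_form[OF y]]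
        form_scale[OF \<Phi>_form[OF x]] form_scale[OF \<Phi>_form[OF y]] algebra_simps)
  have "?p = 0"
  proof (rule ccontr)
    assume p: "?p \<noteq> 0"
    have nz: "\<Phi> x (x \<cdot> inverse ?p \<cdot> ?p) \<noteq> 0"
      using p \<Phi>_self[OF x] by (simp only: smul_smul) (simp add: smul_one)
    have p': "?p' \<noteq> 0" using nz eq[of "x \<cdot> inverse ?p"] form_0[OF \<Phi>_form[OF y]] by auto
    have 1: "ann (x \<cdot> inverse ?p) (\<lambda>v. \<Phi> x (v \<cdot> ?p))" by (rule ann_smul'[OF \<Phi>_ann[OF x] p])
    have 2: "ann (y \<cdot> inverse ?p') (\<lambda>v. \<Phi> x (v \<cdot> ?p))"
      using ann_smul'[OF \<Phi>_ann[OF y] p'] by (simp only: eq)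
    obtain c where "y \<cdot> inverse ?p' = x \<cdot> inverse ?p \<cdot> \<iota> c"
      using ann_inj[OF _ 1 2 nz] x p by auto
    then have "y \<cdot> inverse ?p' \<cdot> ?p' = x \<cdot> inverse ?p \<cdot> \<iota> c \<cdot> ?p'" by simp
    moreover have "y \<cdot> inverse ?p' \<cdot> ?p' = y" using p' by (simp only: smul_smul) (simp add: smul_one)
    ultimately show False using indep by (simp only: smul_smul) blast
  qed
  then have r: "r = \<iota> a" by simp
  have \<Phi>z_eq: "\<Phi> ?z v = b * \<Phi> y v + a * \<Phi> x v" for v
    using br[of v] by (simp add: r form_scale[OF \<Phi>_form[OF x]])
  have \<Phi>zz: "\<Phi> ?z ?z \<noteq> 0" using \<Phi>_self[OF z] by simp
  have a: "a \<noteq> 0"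
  proof
    assume a0: "a = 0"
    have "ann y (\<Phi> ?z)"
      using ann_lincomb[OF \<Phi>_ann[OF y] \<Phi>_ann[OF y], of b 0] by (simp add: \<Phi>z_eq[abs_def] a0)
    then obtain c where "?z = y \<cdot> \<iota> c" using ann_inj[OF y _ \<Phi>_ann[OF z] \<Phi>zz] by blast
    then have "x = y \<cdot> (\<iota> c - 1)" by (simp add: smul_diff_right smul_one eq_diff_eq)
    then show False using indep' by blast
  qed
  have b: "b \<noteq> 0"
  proof
    assume b0: "b = 0"
    have "ann x (\<Phi> ?z)"
      using ann_lincomb[OF \<Phi>_ann[OF x] \<Phi>_ann[OF x], of a 0] by (simp add: \<Phi>z_eq[abs_def] b0)
    then obtain c where "?z = x \<cdot> \<iota> c" using ann_inj[OF x _ \<Phi>_ann[OF z] \<Phi>zz] by blast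
    then have "y = x \<cdot> (\<iota> c - 1)" by (simp add: smul_diff_right smul_one eq_diff_eq add.commute)
    then show False using indep by blast
  qed
  show ?thesis
  proof (rule that[of "b / a"])
    show "b / a \<noteq> 0" using a b by simp
    fix u assume u: "u \<in> S"
    have "\<Phi> x (u x) = 0" "\<Phi> y (u y) = 0" using \<Phi>_ann[OF x] \<Phi>_ann[OF y] u by (auto simp: ann_def)
    then have "a * \<Phi> x (u y) + b * \<Phi> y (u x) = 0" using uz[OF u] by (simp add: \<Phi>z_eq add.commute)
    then show "\<Phi> x (u y) + b / a * \<Phi> y (u x) = 0" using a by (simp add: field_simps)
  qed
qed

text \<open>The quadratic equation gives \<open>q = \<iota> s + inverse q * \<iota> t\<close>, while
  \<open>\<Phi> (x \<cdot> q) v = \<Phi> x (v \<cdot> inverse q)\<close>; hence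
  \<open>c = - t\<close>.\<close>

lemma pair_relation_line:
  assumes x: "x \<noteq> 0" and q: "q \<notin> range \<iota>"
  obtains c where "c \<noteq> 0" "\<And>u. u \<in> S \<Longrightarrow> \<Phi> x (u (x \<cdot> q)) + c * \<Phi> (x \<cdot> q) (u x) = 0"
proof -
  have q0: "q \<noteq> 0" using q embed_0 by (metis rangeI)
  have y: "x \<cdot> q \<noteq> 0" using x q0 by simp
  obtain s t where st: "q * q = q * \<iota> s + \<iota> t" using quadratic by blast
  have "q = q * q * inverse q" using q0 by (simp add: mult.assoc)
  also have "\<dots> = \<iota> s + \<iota> t * inverse q"
    using q0 by (simp add: st distrib_right embed_central[symmetric] mult.assoc)
  finally have q_eq: "q = \<iota> s + inverse q * \<iota> t" by (simp add: embed_central)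
  have t: "t \<noteq> 0" using q q_eq by auto
  have \<Phi>y: "\<Phi> (x \<cdot> q) v = \<Phi> x (v \<cdot> inverse q)" for v
    using ann_unique[OF y ann_smul[OF \<Phi>_ann[OF x] q0], of v] q0 \<Phi>_self[OF x]
    by (simp add: smul_smul smul_one)
  show ?thesis
  proof (rule that[of "- t"])
    show "- t \<noteq> 0" using t by simp
    fix u assume u: "u \<in> S"
    have "\<Phi> x (u x) = 0" using \<Phi>_ann[OF x] u by (simp add: ann_def)
    moreover have "u x \<cdot> q = u x \<cdot> \<iota> s + u x \<cdot> inverse q \<cdot> \<iota> t"
      by (subst q_eq) (simp add: smul_add_right smul_smul)
    ultimately have "\<Phi> x (u (x \<cdot> q)) = t * \<Phi> x (u x \<cdot> inverse q)"
      by (simp add: End_smul[OF S_End[OF u]] form_add[OF \<Phi>_form[OF x]] form_scale[OF \<Phi>_form[OF x]])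
    then show "\<Phi> x (u (x \<cdot> q)) + - t * \<Phi> (x \<cdot> q) (u x) = 0" by (simp add: \<Phi>y)
  qed
qed

lemma pair_relation:
  assumes x: "x \<noteq> 0" and indep: "\<And>c. y \<noteq> x \<cdot> \<iota> c"
  obtains c where "c \<noteq> 0" "\<And>u. u \<in> S \<Longrightarrow> \<Phi> x (u y) + c * \<Phi> y (u x) = 0"
proof (cases "\<exists>q. y = x \<cdot> q")
  case True
  then obtain q where q: "y = x \<cdot> q" by blast
  then have "q \<notin> range \<iota>" using indep by blast
  then show ?thesis using pair_relation_line[OF x] that q by metis
next
  case False
  then show ?thesis using pair_relation_indep[OF x, of y] that by metis
qed

text \<open>The form \<open>\<psi>\<close> attached to \<open>h\<close> is the scalar multiple of \<open>\<Phi> h\<close> for which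
  \<open>\<Phi> x + \<psi>\<close> annihilates the image of \<open>x + h\<close>.\<close>

definition matched :: "'v \<Rightarrow> 'v \<Rightarrow> ('v \<Rightarrow> 'f) \<Rightarrow> bool" where
  "matched x h \<psi> \<longleftrightarrow> ann h \<psi> \<and> (\<forall>u\<in>S. \<Phi> x (u h) + \<psi> (u x) = 0)"

lemma matched_scale:
  assumes m: "matched x h \<psi>" and x: "x \<noteq> 0"
  shows "matched x (h \<cdot> \<iota> a) (\<lambda>v. a * \<psi> v)"
  unfolding matched_def ann_def
proof (intro conjI ballI)
  have \<psi>: "form \<psi>" using m by (simp add: matched_def ann_def)
  then show "form (\<lambda>v. a * \<psi> v)" by (rule VF.linear_compose_scale_right)
  fix u assume u: "u \<in> S"
  show "a * \<psi> (u (h \<cdot> \<iota> a)) = 0"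
    using m u by (simp add: matched_def ann_def End_smul[OF S_End[OF u]] form_scale[OF \<psi>])
  have "\<Phi> x (u (h \<cdot> \<iota> a)) + a * \<psi> (u x) = a * (\<Phi> x (u h) + \<psi> (u x))"
    by (simp add: End_smul[OF S_End[OF u]] form_scale[OF \<Phi>_form[OF x]] distrib_left)
  also have "\<dots> = 0" using m u by (simp add: matched_def)
  finally show "\<Phi> x (u (h \<cdot> \<iota> a)) + a * \<psi> (u x) = 0" .
qed

lemma matched_exists:
  assumes x: "x \<noteq> 0" and h: "\<And>c. h \<noteq> x \<cdot> \<iota> c"
  obtains \<psi> where "matched x h \<psi>"
proof -
  have h0: "h \<noteq> 0" using h[of 0] by simp
  obtain c where c: "c \<noteq> 0" "\<And>u. u \<in> S \<Longrightarrow> \<Phi> x (u h) + c * \<Phi> h (u x) = 0" using pair_relation[OF x h] by blast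
  have "ann h (\<lambda>v. c * \<Phi> h v)" using ann_lincomb[OF \<Phi>_ann[OF h0] \<Phi>_ann[OF h0], of c 0] by simp
  then show ?thesis using that[of "\<lambda>v. c * \<Phi> h v"] c by (simp add: matched_def)
qed

text \<open>The difference of two candidates annihilates both \<open>S h\<close> and
  \<open>S x\<close>, so it is zero by \<open>ann_inj\<close>.\<close>

lemma matched_unique:
  assumes x: "x \<noteq> 0" and h: "\<And>c. h \<noteq> x \<cdot> \<iota> c" and m: "matched x h \<psi>" "matched x h \<psi>'"
  shows "\<psi> = \<psi>'"
proof (rule ccontr)
  assume "\<psi> \<noteq> \<psi>'"
  then obtain v where v: "\<psi> v \<noteq> \<psi>' v" by blast
  let ?\<chi> = "\<lambda>v. 1 * \<psi> v + (- 1) * \<psi>' v"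
  have "ann h ?\<chi>" using m by (intro ann_lincomb) (simp_all add: matched_def)
  moreover have "ann x ?\<chi>" unfolding ann_def
  proof
    show "form ?\<chi>" using m by (intro form_lincomb) (simp_all add: matched_def ann_def)
    show "\<forall>u\<in>S. ?\<chi> (u x) = 0"
    proof
      fix u assume "u \<in> S"
      then have "\<Phi> x (u h) + \<psi> (u x) = \<Phi> x (u h) + \<psi>' (u x)" using m by (simp add: matched_def)
      then show "?\<chi> (u x) = 0" by simp
    qed
  qed
  moreover have "?\<chi> v \<noteq> 0" using v by simp
  ultimately obtain c where "h = x \<cdot> \<iota> c" using ann_inj[OF x] by blast
  then show False using h by blast
qed

text \<open>\<open>\<psi> = 0\<close> would make \<open>\<Phi> x\<close> annihilate
  \<open>S h\<close>, against \<open>ann_inj\<close>.\<close>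

lemma matched_nz:
  assumes x: "x \<noteq> 0" and h: "\<And>c. h \<noteq> x \<cdot> \<iota> c" and m: "matched x h \<psi>"
  obtains a where "a \<noteq> 0" "\<And>v. \<psi> v = a * \<Phi> h v"
proof -
  have h0: "h \<noteq> 0" using h[of 0] by simp
  have eq: "\<And>v. \<psi> v = \<psi> h * \<Phi> h v" using ann_unique[OF h0] m by (simp add: matched_def)
  have "\<psi> h \<noteq> 0"
  proof
    assume "\<psi> h = 0"
    then have \<psi>0: "\<psi> v = 0" for v using eq[of v] by simp
    have "ann h (\<Phi> x)" using m \<Phi>_form[OF x] by (simp add: matched_def ann_def \<psi>0)
    moreover have "\<Phi> x x \<noteq> 0" using \<Phi>_self[OF x] by simp
    ultimately obtain c where "h = x \<cdot> \<iota> c" using ann_inj[OF x \<Phi>_ann[OF x]] by blast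
    then show False using h by blast
  qed
  then show ?thesis using that eq by blast
qed

section \<open>Linearity of the matching\<close>

lemma hyperplane_not_line:
  assumes "x \<noteq> 0" "h \<noteq> 0" "\<Phi> x h = 0"
  shows "h \<noteq> x \<cdot> \<iota> c"
  using assms by (auto simp: form_scale[OF \<Phi>_form] \<Phi>_self)

text \<open>A combination that vanishes on \<open>S x\<close> also vanishes on \<open>S ?w\<close>,
  so \<open>?w\<close> is a scalar multiple of \<open>x\<close> by \<open>ann_inj\<close>; but
  \<open>\<Phi> x ?w = 0\<close> and \<open>?w \<noteq> 0\<close>.\<close>

lemma matched_independent:
  assumes x: "x \<noteq> 0" and h: "h \<noteq> 0" "\<Phi> x h = 0" and h': "\<Phi> x h' = 0" "\<And>c. h' \<noteq> h \<cdot> \<iota> c"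
    and m: "matched x h \<psi>" "matched x h' \<psi>'"
    and z: "\<And>u. u \<in> S \<Longrightarrow> \<alpha> * \<psi> (u x) + \<beta> * \<psi>' (u x) = 0"
  shows "\<alpha> = 0 \<and> \<beta> = 0"
proof (rule ccontr)
  assume nz: "\<not> (\<alpha> = 0 \<and> \<beta> = 0)"
  have h'0: "h' \<noteq> 0" using h'(2)[of 0] by simp
  obtain a where a: "a \<noteq> 0" "\<And>v. \<psi> v = a * \<Phi> h v"
    using matched_nz[OF x hyperplane_not_line[OF x h] m(1)] by blast
  obtain a' where a': "a' \<noteq> 0" "\<And>v. \<psi>' v = a' * \<Phi> h' v"
    using matched_nz[OF x hyperplane_not_line[OF x h'0 h'(1)] m(2)] by blast
  obtain c where c: "c \<noteq> 0" "\<And>u. u \<in> S \<Longrightarrow> \<Phi> h (u h') + c * \<Phi> h' (u h) = 0"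
    using pair_relation[OF h(1) h'(2)] by blast
  define A B where "A = \<alpha> * a" and "B = \<beta> * a'"
  have AB: "A \<noteq> 0 \<or> B \<noteq> 0" using nz a a' by (auto simp: A_def B_def)
  let ?\<chi> = "\<lambda>v. A * \<Phi> h v + B * \<Phi> h' v"
  \<comment> \<open>The weights for which the relation between \<open>h\<close> and
    \<open>h'\<close> makes \<open>?\<chi>\<close> vanish on \<open>S ?w\<close>.\<close>
  let ?w = "h \<cdot> \<iota> (A * c) + h' \<cdot> \<iota> B"
  have \<Phi>h: "form (\<Phi> h)" "form (\<Phi> h')" using \<Phi>_form h(1) h'0 by auto
  have \<chi>: "form ?\<chi>" by (rule form_lincomb[OF \<Phi>h])
  have annx: "ann x ?\<chi>" unfolding ann_def
  proof (intro conjI ballI \<chi>)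
    fix u assume u: "u \<in> S"
    show "?\<chi> (u x) = 0"
      using z[OF u] unfolding a(2) a'(2) A_def B_def by (simp only: mult.assoc)
  qed
  have annw: "ann ?w ?\<chi>" unfolding ann_def
  proof (intro conjI ballI \<chi>)
    fix u assume u: "u \<in> S"
    have 0: "\<Phi> h (u h) = 0" "\<Phi> h' (u h') = 0"
      using \<Phi>_ann[OF h(1)] \<Phi>_ann[OF h'0] u by (auto simp: ann_def)
    have "u ?w = u h \<cdot> \<iota> (A * c) + u h' \<cdot> \<iota> B"
      by (simp add: End_add[OF S_End[OF u]] End_smul[OF S_End[OF u]])
    then have "?\<chi> (u ?w) = A * B * (\<Phi> h (u h') + c * \<Phi> h' (u h))"
      by (simp add: form_add[OF \<Phi>h(1)] form_add[OF \<Phi>h(2)] form_scale[OF \<Phi>h(1)] form_scale[OF \<Phi>h(2)] 0 distrib_left)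
    then show "?\<chi> (u ?w) = 0" using c(2)[OF u] by simp
  qed
  have "?w \<noteq> 0"
  proof
    assume w0: "?w = 0"
    show False
    proof (cases "B = 0")
      case True
      then show False using w0 AB c(1) h(1) by simp
    next
      case False
      have "h' \<cdot> \<iota> B = h \<cdot> \<iota> (- (A * c))" using w0 by (simp add: embed_neg eq_neg_iff_add_eq_0 add.commute)
      then have "h' \<cdot> \<iota> B \<cdot> \<iota> (inverse B) = h \<cdot> \<iota> (- (A * c)) \<cdot> \<iota> (inverse B)" by simp
      then have "h' = h \<cdot> \<iota> (- (A * c) * inverse B)"
        using False by (simp only: smul_smul embed_mult[symmetric]) (simp add: embed_one smul_one)
      then show False using h'(2) by blast
    qed
  qed
  moreover have "\<exists>v. ?\<chi> v \<noteq> 0"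
  proof (rule ccontr)
    assume "\<not> (\<exists>v. ?\<chi> v \<noteq> 0)"
    then have 0: "A * \<Phi> h v + B * \<Phi> h' v = 0" for v by blast
    show False
    proof (cases "A = 0")
      case True
      then show False using 0[of h'] AB \<Phi>_self[OF h'0] by simp
    next
      case False
      have "\<Phi> h v = - B / A * \<Phi> h' v" for v using 0[of v] False by (simp add: field_simps eq_neg_iff_add_eq_0)
      then have "ann h' (\<Phi> h)"
        using \<Phi>_ann[OF h'0] \<Phi>h(1) by (simp add: ann_def)
      then obtain c where "h' = h \<cdot> \<iota> c" using ann_inj[OF h(1) \<Phi>_ann[OF h(1)]] \<Phi>_self[OF h(1)]
        by (metis zero_neq_one)
      then show False using h'(2) by blast
    qed
  qed
  ultimately obtain c' where c': "?w = x \<cdot> \<iota> c'" using ann_inj[OF x annx annw] by blast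
  have "\<Phi> x ?w = 0" using h h' by (simp add: form_add[OF \<Phi>_form[OF x]] form_scale[OF \<Phi>_form[OF x]])
  then have "c' = 0" unfolding c' by (simp add: form_scale[OF \<Phi>_form[OF x]] \<Phi>_self[OF x])
  then show False using c' \<open>?w \<noteq> 0\<close> by simp
qed

text \<open>Let \<open>\<theta>\<close> be matched with \<open>h + h'\<close>. On \<open>S x\<close>
  it agrees with \<open>\<psi> + \<psi>'\<close>, and everywhere some
  \<open>\<psi> + c' \<psi>'\<close> equals \<open>r \<theta>\<close>. Comparison on
  \<open>S x\<close>, where \<open>\<psi>\<close> and \<open>\<psi>'\<close> are independent, gives
  \<open>r = c' = 1\<close>.\<close>

lemma matched_sum:
  assumes x: "x \<noteq> 0" and h: "h \<noteq> 0" "\<Phi> x h = 0" and h': "\<Phi> x h' = 0" "\<And>c. h' \<noteq> h \<cdot> \<iota> c"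
    and m: "matched x h \<psi>" "matched x h' \<psi>'"
  shows "matched x (h + h') (\<lambda>v. \<psi> v + \<psi>' v)"
proof -
  have h'0: "h' \<noteq> 0" using h'(2)[of 0] by simp
  have s0: "h + h' \<noteq> 0" using h'(2)[of "- 1"] by (auto simp: embed_neg embed_one smul_one add_eq_0_iff)
  have sH: "\<Phi> x (h + h') = 0" using h h' by (simp add: form_add[OF \<Phi>_form[OF x]])
  note sL = hyperplane_not_line[OF x s0 sH]
  obtain a where a: "a \<noteq> 0" "\<And>v. \<psi> v = a * \<Phi> h v"
    using matched_nz[OF x hyperplane_not_line[OF x h] m(1)] by blast
  obtain a' where a': "a' \<noteq> 0" "\<And>v. \<psi>' v = a' * \<Phi> h' v"
    using matched_nz[OF x hyperplane_not_line[OF x h'0 h'(1)] m(2)] by blast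
  obtain c where c: "c \<noteq> 0" "\<And>u. u \<in> S \<Longrightarrow> \<Phi> h (u h') + c * \<Phi> h' (u h) = 0"
    using pair_relation[OF h(1) h'(2)] by blast
  \<comment> \<open>The ratio for which \<open>\<psi> + c' \<psi>'\<close> annihilates
    \<open>S (h + h')\<close>, by the relation between \<open>h\<close> and
    \<open>h'\<close>.\<close>
  define c' where "c' = c * a / a'"
  obtain \<theta> where \<theta>: "matched x (h + h') \<theta>" using matched_exists[OF x sL] by blast
  obtain b where b: "b \<noteq> 0" "\<And>v. \<theta> v = b * \<Phi> (h + h') v" using matched_nz[OF x sL \<theta>] by blast
  have f: "form \<psi>" "form \<psi>'" using m by (auto simp: matched_def ann_def)
  have "ann (h + h') (\<lambda>v. 1 * \<psi> v + c' * \<psi>' v)" unfolding ann_def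
  proof (intro conjI ballI form_lincomb f)
    fix u assume u: "u \<in> S"
    have 0: "\<psi> (u h) = 0" "\<psi>' (u h') = 0" using m u by (auto simp: matched_def ann_def)
    have "1 * \<psi> (u (h + h')) + c' * \<psi>' (u (h + h')) = a * (\<Phi> h (u h') + c * \<Phi> h' (u h))"
      using a'(1) by (simp add: End_add[OF S_End[OF u]] form_add[OF f(1)] form_add[OF f(2)] 0 distrib_left)
        (simp add: a(2) a'(2) c'_def)
    then show "1 * \<psi> (u (h + h')) + c' * \<psi>' (u (h + h')) = 0" using c(2)[OF u] by simp
  qed
  note uniq = ann_unique[OF s0 this]
  define r where "r = (\<psi> (h + h') + c' * \<psi>' (h + h')) / b"
  have r: "\<psi> v + c' * \<psi>' v = r * \<theta> v" for v
    unfolding r_def b(2) using uniq[of v] b(1) by simp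
  have \<theta>x: "\<theta> (u x) = \<psi> (u x) + \<psi>' (u x)" if u: "u \<in> S" for u
  proof -
    have "\<Phi> x (u h) = - \<psi> (u x)" "\<Phi> x (u h') = - \<psi>' (u x)" "\<Phi> x (u (h + h')) = - \<theta> (u x)"
      using m \<theta> u by (auto simp: matched_def eq_neg_iff_add_eq_0)
    moreover have "\<Phi> x (u (h + h')) = \<Phi> x (u h) + \<Phi> x (u h')"
      by (simp add: End_add[OF S_End[OF u]] form_add[OF \<Phi>_form[OF x]])
    ultimately show ?thesis by (metis add.commute minus_add_distrib minus_minus)
  qed
  have "1 - r = 0 \<and> c' - r = 0"
  proof (rule matched_independent[OF x h h' m])
    fix u assume u: "u \<in> S"
    show "(1 - r) * \<psi> (u x) + (c' - r) * \<psi>' (u x) = 0"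
      using r[of "u x"] \<theta>x[OF u] by (simp add: algebra_simps)
  qed
  then have "r = 1" "c' = 1" by auto
  then have "(\<lambda>v. \<psi> v + \<psi>' v) = \<theta>" using r by simp
  then show ?thesis using \<theta> by simp
qed

text \<open>The case distinction is needed for linearity, since every multiple of \<open>\<Phi> x\<close> is matched with \<open>0\<close>.\<close>

definition matching :: "'v \<Rightarrow> 'v \<Rightarrow> 'v \<Rightarrow> 'f" where
  "matching x h = (if h = 0 then (\<lambda>v. 0) else SOME \<psi>. matched x h \<psi>)"

lemma matching_0 [simp]: "matching x 0 v = 0"
  by (simp add: matching_def)

lemma matching_matched:
  assumes x: "x \<noteq> 0" and h: "\<Phi> x h = 0"
  shows "matched x h (matching x h)"
proof (cases "h = 0")
  case True
  have "form (\<lambda>v. 0)" by (rule VF.linear_zero)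
  then show ?thesis using True by (simp add: matching_def matched_def ann_def End_0[OF S_End] form_0[OF \<Phi>_form[OF x]])
next
  case False
  then obtain \<psi> where "matched x h \<psi>" using matched_exists[OF x hyperplane_not_line[OF x False h]] by blast
  then show ?thesis using False someI[of "matched x h"] by (simp add: matching_def)
qed

lemma matching_eqI:
  assumes "x \<noteq> 0" "\<Phi> x h = 0" "h \<noteq> 0" "matched x h \<psi>"
  shows "matching x h = \<psi>"
  using matched_unique[OF assms(1) hyperplane_not_line[OF assms(1,3,2)] matching_matched[OF assms(1,2)] assms(4)] .

lemma matching_scale:
  assumes x: "x \<noteq> 0" and h: "\<Phi> x h = 0"
  shows "matching x (h \<cdot> \<iota> a) v = a * matching x h v"
proof (cases "h \<cdot> \<iota> a = 0")
  case True
  then have "a = 0 \<or> h = 0" by auto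
  then show ?thesis by auto
next
  case False
  have "matching x (h \<cdot> \<iota> a) = (\<lambda>v. a * matching x h v)"
    by (rule matching_eqI[OF x _ False matched_scale[OF matching_matched[OF x h] x]])
      (simp add: form_scale[OF \<Phi>_form[OF x]] h)
  then show ?thesis by simp
qed

lemma matching_add:
  assumes x: "x \<noteq> 0" and h: "\<Phi> x h = 0" "\<Phi> x h' = 0"
  shows "matching x (h + h') v = matching x h v + matching x h' v"
proof (cases "h = 0")
  case False
  show ?thesis
  proof (cases "\<exists>c. h' = h \<cdot> \<iota> c")
    case True
    then obtain c where c: "h' = h \<cdot> \<iota> c" by blast
    then have "h + h' = h \<cdot> \<iota> (1 + c)" by (simp add: embed_add embed_one smul_add_right smul_one)
    then show ?thesis using c by (simp add: matching_scale[OF x h(1)] distrib_right)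
  next
    case indep: False
    have s0: "h + h' \<noteq> 0"
    proof
      assume "h + h' = 0"
      then have "h' = h \<cdot> \<iota> (- 1)" by (simp add: embed_neg embed_one smul_one add_eq_0_iff)
      then show False using indep by blast
    qed
    have "matching x (h + h') = (\<lambda>v. matching x h v + matching x h' v)"
    proof (rule matching_eqI[OF x _ s0])
      show "\<Phi> x (h + h') = 0" by (simp add: form_add[OF \<Phi>_form[OF x]] h)
      show "matched x (h + h') (\<lambda>v. matching x h v + matching x h' v)"
        using indep by (intro matched_sum x False h matching_matched) blast
    qed
    then show ?thesis by simp
  qed
qed simp

section \<open>Construction and uniqueness of the bilinear form\<close>

lemma V_nontrivial: obtains x :: 'v where "x \<noteq> 0"
proof -
  have "\<not> (UNIV :: 'v set) \<subseteq> {0}"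
  proof
    assume "(UNIV :: 'v set) \<subseteq> {0}"
    then have "V.dim (UNIV :: 'v set) = 0" by (simp only: V.dim_eq_0)
    then show False using V_dim d_pos by simp
  qed
  then show ?thesis using that by blast
qed

text \<open>\<open>x\<close> is split along the line of \<open>x0\<close> and the kernel of
  \<open>\<Phi> x0\<close>; \<open>b\<close> uses \<open>\<Phi> x0\<close> on the first summand and
  the matching on the second. In \<open>b x (u x)\<close> the two pure terms vanish, and the mixed
  ones cancel by the definition of \<open>matched\<close>.\<close>

theorem bilinear_annihilator_exists:
  "\<exists>b. bilinear_form \<iota> smul b \<and> nonisotropic b \<and> (\<forall>x. ann x (b x))"
proof -
  obtain x0 :: 'v where x0: "x0 \<noteq> 0" by (rule V_nontrivial)
  let ?\<phi> = "\<Phi> x0"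
  have \<phi>: "form ?\<phi>" "?\<phi> x0 = 1" by (rule \<Phi>_form[OF x0] \<Phi>_self[OF x0])+
  define p where "p x = x - x0 \<cdot> \<iota> (?\<phi> x)" for x
  have p: "?\<phi> (p x) = 0" for x by (simp add: p_def form_diff[OF \<phi>(1)] form_scale[OF \<phi>(1)] \<phi>(2))
  have p_add: "p (x + y) = p x + p y" for x y
    by (simp add: p_def form_add[OF \<phi>(1)] embed_add smul_add_right)
  have p_scale: "p (x \<cdot> \<iota> a) = p x \<cdot> \<iota> a" for x a
    by (simp add: p_def form_scale[OF \<phi>(1)] smul_diff_left smul_smul embed_mult[symmetric] mult.commute)
  define b where "b x v = ?\<phi> x * ?\<phi> v + 1 * matching x0 (p x) v" for x v
  note m = matching_matched[OF x0 p]
  have mf: "form (matching x0 (p x))" for x using m by (simp add: matched_def ann_def)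
  have bf: "form (b x)" for x
    unfolding b_def[abs_def] by (rule form_lincomb[OF \<phi>(1) mf])
  have bann: "ann x (b x)" for x
    unfolding ann_def
  proof (intro conjI ballI bf)
    fix u assume u: "u \<in> S"
    have x: "x = x0 \<cdot> \<iota> (?\<phi> x) + p x" by (simp add: p_def)
    have ux: "u x = u x0 \<cdot> \<iota> (?\<phi> x) + u (p x)"
      using arg_cong[OF x, of u] by (simp add: End_add[OF S_End[OF u]] End_smul[OF S_End[OF u]])
    have 0: "?\<phi> (u x0) = 0" "matching x0 (p x) (u (p x)) = 0"
      "?\<phi> (u (p x)) + matching x0 (p x) (u x0) = 0"
      using \<Phi>_ann[OF x0] m[of x] u by (auto simp: matched_def ann_def)
    have "b x (u x) = ?\<phi> x * (?\<phi> (u (p x)) + matching x0 (p x) (u x0))"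
      by (simp add: b_def ux form_add[OF \<phi>(1)] form_add[OF mf] form_scale[OF \<phi>(1)] form_scale[OF mf] 0(1,2) distrib_left)
    then show "b x (u x) = 0" by (simp add: 0(3))
  qed
  have b_add: "b (x + y) v = b x v + b y v" for x y v
    by (simp add: b_def p_add matching_add[OF x0 p p] form_add[OF \<phi>(1)] algebra_simps)
  have b_scale: "b (x \<cdot> \<iota> a) v = a * b x v" for x a v
    by (simp only: b_def p_scale matching_scale[OF x0 p] form_scale[OF \<phi>(1)] distrib_left mult.assoc mult_1)
  have "form (\<lambda>x. b x v)" for v
    by (rule linearI_space) (simp_all add: spaces b_add b_scale vec_scale_def)
  then have "bilinear_form \<iota> smul b" using bf by (simp add: bilinear_form_def)
  moreover have "nonisotropic b" unfolding nonisotropic_def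
  proof (intro allI impI)
    fix x :: 'v assume x: "x \<noteq> 0"
    \<comment> \<open>By \<open>ann_self_nz\<close> it is enough that \<open>b x\<close> is not the
      zero form.\<close>
    have "\<exists>v. b x v \<noteq> 0"
    proof (cases "p x = 0")
      case True
      then have "x = x0 \<cdot> \<iota> (?\<phi> x)" by (simp add: p_def)
      then have "?\<phi> x \<noteq> 0" using x by auto
      then have "b x x0 \<noteq> 0" using True \<phi>(2) by (simp add: b_def)
      then show ?thesis by blast
    next
      case False
      note L = hyperplane_not_line[OF x0 False p]
      show ?thesis
      proof (rule ccontr)
        assume "\<not> ?thesis"
        then have z: "matching x0 (p x) v = - ?\<phi> x * ?\<phi> v" for v
          by (simp add: b_def eq_neg_iff_add_eq_0 add.commute)
        obtain a where a: "a \<noteq> 0" "\<And>v. matching x0 (p x) v = a * \<Phi> (p x) v"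
          using matched_nz[OF x0 L m] by blast
        have "matching x0 (p x) (p x) = a" using a(2) \<Phi>_self[OF False] by simp
        moreover have "matching x0 (p x) (p x) = 0" using z p by simp
        ultimately show False using a(1) by simp
      qed
    qed
    then show "b x x \<noteq> 0" using ann_self_nz[OF x bann] by blast
  qed
  ultimately show ?thesis using bann by blast
qed

text \<open>\<open>b' x\<close> is \<open>c x\<close> times \<open>b x\<close> by
  \<open>ann_unique\<close>. Additivity in \<open>x\<close> gives
  \<open>A * b x0 v + B * b x v = 0\<close> for all \<open>v\<close>; taking \<open>v = ?w\<close>
  and using nonisotropy, \<open>?w = 0\<close>, so \<open>A\<close> and \<open>B\<close> vanish when
  \<open>x\<close> is off the line of \<open>x0\<close>.\<close>

lemma bilinear_annihilator_unique:
  assumes b: "bilinear_form \<iota> smul b" "nonisotropic b" "\<And>x. ann x (b x)"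
    and b': "bilinear_form \<iota> smul b'" "\<And>x. ann x (b' x)"
  shows "\<exists>c. \<forall>x y. b' x y = c * b x y"
proof -
  have lb: "form (b x)" "form (\<lambda>x. b x y)" and lb': "form (b' x)" "form (\<lambda>x. b' x y)" for x y
    using b(1) b'(1) by (auto simp: bilinear_form_def)
  have bz: "b x x \<noteq> 0" if "x \<noteq> 0" for x using b(2) that by (simp add: nonisotropic_def)
  define c where "c x = b' x x / b x x" for x
  have c: "b' x v = c x * b x v" if x: "x \<noteq> 0" for x v
    using ann_unique[OF x b(3), of v] ann_unique[OF x b'(2), of v] bz[OF x] by (simp add: c_def)
  obtain x0 :: 'v where x0: "x0 \<noteq> 0" by (rule V_nontrivial)
  have "c x = c x0" if x: "x \<noteq> 0" for x
  proof (cases "\<exists>a. x = x0 \<cdot> \<iota> a")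
    case True
    then obtain a where a: "x = x0 \<cdot> \<iota> a" by blast
    then have a0: "a \<noteq> 0" using x by auto
    have "b' x x = a * (a * b' x0 x0)" "b x x = a * (a * b x0 x0)"
      unfolding a by (simp_all add: form_scale[OF lb(1)] form_scale[OF lb(2)] form_scale[OF lb'(1)] form_scale[OF lb'(2)])
    then show ?thesis using a0 by (simp add: c_def)
  next
    case False
    have s: "x0 + x \<noteq> 0"
    proof
      assume "x0 + x = 0"
      then have "x = x0 \<cdot> \<iota> (- 1)" by (simp add: embed_neg embed_one smul_one add_eq_0_iff)
      then show False using False by blast
    qed
    define A B where "A = c (x0 + x) - c x0" and "B = c (x0 + x) - c x"
    have AB: "A * b x0 v + B * b x v = 0" for v
    proof -
      have "c (x0 + x) * (b x0 v + b x v) = c x0 * b x0 v + c x * b x v"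
        using c[OF s, of v] c[OF x0, of v] c[OF x, of v] by (simp add: form_add[OF lb(2)] form_add[OF lb'(2)])
      then show ?thesis by (simp add: A_def B_def algebra_simps)
    qed
    let ?w = "x0 \<cdot> \<iota> A + x \<cdot> \<iota> B"
    have "b ?w ?w = 0" using AB[of ?w]
      by (simp add: form_add[OF lb(2)] form_scale[OF lb(2)])
    then have w: "?w = 0" using bz by blast
    have "B = 0"
    proof (rule ccontr)
      assume B: "B \<noteq> 0"
      have "x \<cdot> \<iota> B = x0 \<cdot> \<iota> (- A)" using w by (simp add: embed_neg eq_neg_iff_add_eq_0 add.commute)
      then have "x \<cdot> \<iota> B \<cdot> \<iota> (inverse B) = x0 \<cdot> \<iota> (- A) \<cdot> \<iota> (inverse B)" by simp
      then have "x = x0 \<cdot> \<iota> (- A * inverse B)"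
        using B by (simp only: smul_smul embed_mult[symmetric]) (simp add: embed_one smul_one)
      then show False using False by blast
    qed
    moreover from this have "A = 0" using w x0 by simp
    ultimately show ?thesis by (simp add: A_def B_def)
  qed
  moreover have "b' 0 y = 0" "b 0 y = 0" for y using form_0[OF lb(2)] form_0[OF lb'(2)] by auto
  ultimately have "b' x y = c x0 * b x y" for x y using c by (cases "x = 0") auto
  then show ?thesis by blast
qed

end

section \<open>A triangular space attaining the bound\<close>

context division_space
begin

text \<open>Block triangular operators: \<open>T\<close> acts on \<open>K\<close>, and
  \<open>y \<cdot> f\<close> with \<open>\<phi> y = 0\<close> is added. A fixed vector has
  \<open>f v = f y * f v\<close>, and \<open>f y = 1\<close> is excluded by
  \<open>\<phi> y = 0\<close>; so \<open>f v = 0\<close>, and \<open>T\<close> has no fixed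
  vector.\<close>

lemma triangular_exists:
  assumes "idem e" "V.dim (range e) = k * d"
  shows "\<exists>T. E.subspace T \<and> T \<subseteq> corner e \<and> nofix T \<and> tri_dim d k \<le> E.dim T"
  using assms
proof (induction k arbitrary: e)
  case 0
  have "E.subspace {0} \<and> {0} \<subseteq> corner e \<and> nofix {0}"
    using E.subspace_0[OF corner_subspace[OF 0(1)]] by (auto simp: nofix_def)
  then show ?case by (metis le0 tri_dim.simps(1))
next
  case (Suc k)
  have eE: "e \<in> End smul" and ee: "\<And>v. e (e v) = e v" using Suc.prems by (auto simp: idem_def)
  have sub0: "E.subspace {0}" "{0} \<subseteq> corner e" "nofix {0}"
    using E.subspace_0[OF corner_subspace[OF Suc.prems(1)]] by (auto simp: nofix_def)
  obtain x where x: "e x = x" "x \<noteq> 0"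
    using max_eval_vector[OF Suc.prems sub0(2)] by blast
  \<comment> \<open>For the zero space a pivot amounts to a splitting of
    \<open>range e\<close>.\<close>
  obtain \<phi> f where "pivot \<iota> smul BD BV e {0} k x \<phi> f"
    using pivot_exists[OF Suc.prems sub0 x] by blast
  then interpret P: pivot \<iota> smul BD BV e "{0}" k x \<phi> f .
  obtain T where T: "E.subspace T" "T \<subseteq> corner P.e'" "nofix T" "tri_dim d k \<le> E.dim T"
    using Suc.IH[OF P.idem_e' P.dim_e'] by blast
  have TE: "t \<in> End smul" if "t \<in> T" for t using T(2) that by (auto simp: corner_def)
  have Te: "P.e' (t v) = t v" "t (P.e' v) = t v" if "t \<in> T" for t v
    using T(2) that by (auto simp: corner_def)
  have Tee: "e (t v) = t v" "t (e v) = t v" if "t \<in> T" for t v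
    using Te[OF that] P.e_e' by metis+
  have Tf: "f (t v) = 0" if "t \<in> T" for t v using Te(1)[OF that, of v] P.f_e' by metis
  have Tx: "t x = 0" if "t \<in> T" for t
    using Te(2)[OF that, of x] P.e'_x End_0[OF TE[OF that]] by simp
  define Y where "Y = {y. e y = y \<and> \<phi> y = 0}"
  have Y: "V.subspace Y"
    unfolding V.subspace_def Y_def by (simp add: P.e_simps P.\<phi>_simps vec_scale_def)
  let ?r = "\<lambda>y v. y \<cdot> f v"
  let ?R = "{a + b | a b. a \<in> ?r ` Y \<and> b \<in> T}"
  have rY: "E.subspace (?r ` Y)" by (rule VE.linear_subspace_image[OF linear_rank1 Y])
  have sub: "E.subspace ?R" by (rule E.subspace_sums[OF rY T(1)])
  have rc: "?r y \<in> corner e" if "y \<in> Y" for y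
    using End_rank1[OF P.f_dlin, of y] that by (simp add: corner_def Y_def P.f_e P.e_simps)
  have Tc: "t \<in> corner e" if "t \<in> T" for t using TE[OF that] Tee[OF that] by (simp add: corner_def)
  have Rc: "?R \<subseteq> corner e"
    using rc Tc E.subspace_add[OF corner_subspace[OF Suc.prems(1)]] by blast
  have nf: "nofix ?R" unfolding nofix_def
  proof (intro ballI allI impI)
    fix u v assume "u \<in> ?R" and uv: "u v = v"
    then obtain y t where y: "y \<in> Y" and t: "t \<in> T" and u: "u = ?r y + t" by blast
    have v: "v = y \<cdot> f v + t v" using uv by (simp add: u)
    have fv: "f v = f y * f v" using arg_cong[OF v, of f] by (simp add: P.f_simps Tf[OF t])
    have "f v = 0"
    proof (rule ccontr)
      assume "f v \<noteq> 0"
      then have "f y = 1" using fv by (metis mult_cancel_right1)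
      then have "\<phi> y = 1" using P.\<phi>_f[of y] P.\<phi>_x by (simp add: smul_one)
      then show False using y by (simp add: Y_def)
    qed
    then have "t v = v" using v by simp
    then show "v = 0" using T(3) t by (simp add: nofix_def)
  qed
  have fg: "E.fin_gen ?R" by (rule corner_fin_gen[OF Rc])
  have evx: "(\<lambda>u. u x) ` ?R = Y"
  proof
    show "(\<lambda>u. u x) ` ?R \<subseteq> Y"
    proof
      fix y assume "y \<in> (\<lambda>u. u x) ` ?R"
      then obtain w t where "w \<in> Y" "t \<in> T" "y = w \<cdot> f x + t x" by auto
      then show "y \<in> Y" by (simp add: P.f_x smul_one Tx)
    qed
    show "Y \<subseteq> (\<lambda>u. u x) ` ?R"
    proof
      fix y assume "y \<in> Y"
      then have m: "?r y + 0 \<in> ?R" using E.subspace_0[OF T(1)] by blast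
      show "y \<in> (\<lambda>u. u x) ` ?R"
        by (rule image_eqI[OF _ m]) (simp add: P.f_x smul_one)
    qed
  qed
  have "E.dim ?R = V.dim Y + E.dim {u \<in> ?R. u x = 0}"
    using EV.rank_nullity[OF linear_eval sub fg, of x] by (simp only: evx)
  moreover have "E.dim T \<le> E.dim {u \<in> ?R. u x = 0}"
  proof (rule E.fin_gen_dim_mono)
    show "T \<subseteq> {u \<in> ?R. u x = 0}"
    proof
      fix t assume t: "t \<in> T"
      then have "0 + t \<in> ?R" using E.subspace_0[OF rY] by blast
      then show "t \<in> {u \<in> ?R. u x = 0}" using Tx[OF t] by simp
    qed
    show "E.fin_gen {u \<in> ?R. u x = 0}" by (rule E.fin_gen_mono[OF _ fg]) blast
  qed
  moreover have "Suc k * d - 1 \<le> V.dim Y"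
  proof -
    have "V.dim (range e) \<le> V.dim {v \<in> range e. \<forall>i\<in>{()}. \<phi> v = 0} + card {()}"
      by (rule V.dim_kernels[OF _ End_range_subspace[OF eE] V_fin_gen P.\<phi>_form]) simp
    moreover have "{v \<in> range e. \<forall>i\<in>{()}. \<phi> v = 0} = Y"
      using ee by (auto simp: Y_def intro: range_eqI[OF sym])
    ultimately show ?thesis using Suc.prems(2) by simp
  qed
  ultimately have "tri_dim d (Suc k) \<le> E.dim ?R" using T(4) by simp
  then show ?case using sub Rc nf by blast
qed

section \<open>Elements of division rings of quadratic type\<close>

text \<open>The cardinality is stated beside independence because equal elements collapse in the set
  display.\<close>

lemma quadratic_of_dependent:
  assumes "\<not> (q \<notin> range \<iota> \<and> D.independent {q * q, q, 1} \<and> card {q * q, q, 1} = 3)"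
  shows "\<exists>s t. q * q = q * \<iota> s + \<iota> t"
proof (cases "q \<in> range \<iota>")
  case True
  then obtain a where "q = \<iota> a" by blast
  then have "q * q = q * \<iota> a + \<iota> 0" by simp
  then show ?thesis by blast
next
  case False
  have sp1: "D.span {1} = range \<iota>" by (simp add: D.span_singleton ring_scale_def)
  have i1: "D.independent {1}" by simp
  have i2: "D.independent {q, 1}" using False by (intro D.independent_insertI[OF _ i1]) (simp add: sp1)
  have q1: "q \<noteq> 1" using False embed_one by (metis rangeI)
  show ?thesis
  proof (cases "q * q \<in> D.span {q, 1}")
    case True
    then obtain s where "q * q - ds s q \<in> D.span {1}" unfolding D.span_insert by blast
    then obtain t where t: "q * q - ds s q = \<iota> t" unfolding sp1 by blast
    have "q * q = q * \<iota> s + \<iota> t"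
      using t by (simp add: ring_scale_def embed_central diff_eq_eq add.commute)
    then show ?thesis by blast
  next
    case nin: False
    then have "D.independent {q * q, q, 1}" using i2 by (rule D.independent_insertI)
    moreover have "q * q \<noteq> q" "q * q \<noteq> 1" using nin D.span_base[of _ "{q, 1}"] by auto
    then have "card {q * q, q, 1} = 3" using q1 by simp
    ultimately show ?thesis using assms False by blast
  qed
qed

text \<open>If \<open>q\<close> had degree at least 3, its centralizer \<open>C\<close> would be a hyperplane of \<open>D\<close>, whence
  \<open>C \<inter> C r \<noteq> 0\<close> for every \<open>r\<close>; but \<open>C\<close> is a division subring.\<close>

lemma quaternion_quadratic:
  assumes d4: "d = 4" and center: "ring_center = range \<iota>"
  shows "\<exists>s t. q * q = q * \<iota> s + \<iota> t"
proof (rule quadratic_of_dependent, rule notI, elim conjE)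
  assume q: "q \<notin> range \<iota>" and ind: "D.independent {q * q, q, 1}" and c3: "card {q * q, q, 1} = 3"
  define C where "C = {y. q * y = y * q}"
  have C: "D.subspace C"
    unfolding D.subspace_def C_def ring_scale_def
    by (simp add: distrib_left distrib_right) (metis embed_central mult.assoc)
  have "{q * q, q, 1} \<subseteq> C" by (auto simp: C_def mult.assoc)
  then have dC: "3 \<le> D.dim C" using D.fin_gen_independent[OF D_fin_gen _ ind] c3 by simp
  obtain r where r: "r \<notin> C"
  proof -
    have "q \<notin> ring_center" using q center by simp
    then show ?thesis using that by (auto simp: ring_center_def C_def)
  qed
  have r0: "r \<noteq> 0" using r D.subspace_0[OF C] by blast
  obtain \<omega> where \<omega>: "Vector_Spaces.linear ds (*) \<omega>" "\<And>v. v \<in> C \<Longrightarrow> \<omega> v = (0::'f)" "\<omega> r = 1"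
    using D.form_exists[OF C r] by metis
  let ?K = "{v. \<omega> v = 0}"
  have K: "D.subspace ?K" by (rule DF.linear_subspace_kernel[OF \<omega>(1)])
  have "?K \<noteq> UNIV" using \<omega>(3) by (metis UNIV_I mem_Collect_eq zero_neq_one)
  then have "D.dim ?K < D.dim (UNIV :: 'd set)"
    using D.fin_gen_dim_eq[OF K subset_UNIV D_fin_gen] by (meson not_le_imp_less)
  then have "D.dim ?K < 4" unfolding D.dim_UNIV d4 .
  then have CK: "C = ?K" using D.fin_gen_dim_eq[OF C _ D_fin_gen, of ?K] \<omega>(2) dC by auto
  interpret DD: linear_space_pair ds ds ..
  have lin: "Vector_Spaces.linear ds ds (\<lambda>c. c * r)"
    by (rule linearI_space) (simp_all add: spaces distrib_right ring_scale_def mult.assoc)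
  let ?Cr = "(\<lambda>c. c * r) ` C"
  have Cr: "D.subspace ?Cr" by (rule DD.linear_subspace_image[OF lin C])
  have "D.dim ?Cr = D.dim C"
    by (rule DD.dim_image_eq_gen[OF lin C D_fin_gen]) (use r0 in simp)
  moreover have "D.dim ?Cr \<le> D.dim {v \<in> ?Cr. \<forall>i\<in>{()}. \<omega> v = 0} + card {()}"
    by (rule D.dim_kernels[OF _ Cr D_fin_gen \<omega>(1)]) simp
  moreover have "{v \<in> ?Cr. \<forall>i\<in>{()}. \<omega> v = 0} \<subseteq> {0}"
  proof
    fix v assume "v \<in> {v \<in> ?Cr. \<forall>i\<in>{()}. \<omega> v = 0}"
    then obtain c where c: "c \<in> C" "v = c * r" "v \<in> C" using CK by auto
    have "c = 0"
    proof (rule ccontr)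
      assume "c \<noteq> 0"
      have "q * c = c * q" "q * v = v * q" using c(1,3) unfolding C_def by blast+
      then have "c * (q * r) = c * (r * q)" unfolding c(2) by (metis mult.assoc)
      then have "q * r = r * q" using \<open>c \<noteq> 0\<close> by simp
      then show False using r by (simp add: C_def)
    qed
    then show "v \<in> {0}" using c by simp
  qed
  then have "D.dim {v \<in> ?Cr. \<forall>i\<in>{()}. \<omega> v = 0} = 0" by (simp only: D.dim_eq_0)
  moreover have "card {()} = 1" by simp
  ultimately show False using dC by linarith
qed

lemma quadratic_type_quadratic:
  assumes "quadratic_type \<iota> d"
  shows "\<exists>s t. q * q = q * \<iota> s + \<iota> t"
proof -
  \<comment> \<open>The types with \<open>d = 1\<close> and \<open>d = 2\<close> are merged: there
    \<open>q * q\<close>, \<open>q\<close> and 1 are dependent for lack of room.\<close>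
  consider "d \<le> 2" | "d = 4" "ring_center = range \<iota>" | "q\<^sup>2 \<in> range \<iota>"
    using assms unfolding quadratic_type_def quaternion_algebra_def by force
  then show ?thesis
  proof cases
    case 1
    show ?thesis
    proof (rule quadratic_of_dependent, rule notI, elim conjE)
      assume "D.independent {q * q, q, 1}" "card {q * q, q, 1} = 3"
      then have "3 \<le> D.dim (UNIV :: 'd set)" using D.fin_gen_independent[OF D_fin_gen subset_UNIV] by metis
      then show False using 1 unfolding D.dim_UNIV by simp
    qed
  next
    case 2
    then show ?thesis by (rule quaternion_quadratic)
  next
    case 3
    then obtain t where "q * q = \<iota> t" by (auto simp: power2_eq_square)
    then have "q * q = q * \<iota> 0 + \<iota> t" by simp
    then show ?thesis by blast
  qed
qed

end

section \<open>The theorem\<close>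

text \<open>Tower law: the vectors \<open>smul b p\<close>, with \<open>b\<close> in the D-basis of
  V and \<open>p\<close> in the F-basis of D, form an F-basis.\<close>

lemma scalar_basis_exists:
  assumes c: "central_subfield \<iota>" and r: "right_vector_space smul"
    and D: "finite_dimensional_vector_space (ring_scale \<iota>) BD" and B: "right_basis smul B"
  shows "\<exists>BV. finite_dimensional_vector_space (vec_scale \<iota> smul) BV \<and> card BV = card B * card BD"
proof -
  interpret central_subfield \<iota> by fact
  interpret right_vector_space smul by fact
  interpret D: finite_dimensional_vector_space "ring_scale \<iota>" BD by fact
  interpret V: vector_space "vec_scale \<iota> smul" by (rule vector_space_vec_scale[OF c r])
  have finB: "finite B" and indB: "\<And>c b. (\<Sum>b\<in>B. smul b (c b)) = 0 \<Longrightarrow> b \<in> B \<Longrightarrow> c b = 0"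
    and spanB: "\<And>v. \<exists>c. v = (\<Sum>b\<in>B. smul b (c b))"
    using B unfolding right_basis_def by blast+
  have z: "smul v 0 = 0" for v using smul_add_right[of v 0 0] by simp
  have sum_smul: "smul v (\<Sum>i\<in>I. g i) = (\<Sum>i\<in>I. smul v (g i))" for v and g :: "_ \<Rightarrow> 'b" and I
    by (induction I rule: infinite_finite_induct) (auto simp: smul_add_right z)
  let ?g = "\<lambda>(b, p). smul b p"
  have sc: "vec_scale \<iota> smul a (smul b p) = smul b (ring_scale \<iota> a p)" for a b p
    by (simp add: vec_scale_def ring_scale_def embed_central smul_mult)
  have combine: "(\<Sum>(b, p)\<in>B \<times> BD. vec_scale \<iota> smul (h b p) (smul b p)) =
      (\<Sum>b\<in>B. smul b (\<Sum>p\<in>BD. ring_scale \<iota> (h b p) p))" for h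
    by (simp add: sum.cartesian_product[symmetric] sum_smul sc)
  have zero: "h b p = 0"
    if "(\<Sum>(b, p)\<in>B \<times> BD. vec_scale \<iota> smul (h b p) (smul b p)) = 0" "b \<in> B" "p \<in> BD" for h b p
  proof -
    have "(\<Sum>p\<in>BD. ring_scale \<iota> (h b p) p) = 0"
      by (rule indB[OF _ that(2)]) (use that(1) combine in simp)
    then show ?thesis using D.independentD[OF D.independent_Basis D.finite_Basis subset_refl _ that(3)] by blast
  qed
  have inj: "inj_on ?g (B \<times> BD)"
  proof (rule inj_onI, rule ccontr)
    fix x y assume xy: "x \<in> B \<times> BD" "y \<in> B \<times> BD" "?g x = ?g y" "x \<noteq> y"
    define h where "h b p = (if (b, p) = x then 1 else if (b, p) = y then - 1 else 0 :: 'a)" for b p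
    have "(\<Sum>(b, p)\<in>B \<times> BD. vec_scale \<iota> smul (h b p) (smul b p)) =
        (\<Sum>(b, p)\<in>{x, y}. vec_scale \<iota> smul (h b p) (smul b p))"
      using xy(1,2) finB D.finite_Basis
      by (intro sum.mono_neutral_right) (auto simp: h_def split: if_splits)
    also have "\<dots> = 0" using xy(3,4) by (auto simp: h_def split: prod.splits)
    finally have s: "(\<Sum>(b, p)\<in>B \<times> BD. vec_scale \<iota> smul (h b p) (smul b p)) = 0" .
    have "h (fst x) (snd x) = 0"
      using xy(1) by (intro zero[OF s]) (auto simp: mem_Times_iff)
    then show False by (simp add: h_def)
  qed
  have img: "(\<Sum>v\<in>?g ` (B \<times> BD). vec_scale \<iota> smul (k v) v) =
      (\<Sum>(b, p)\<in>B \<times> BD. vec_scale \<iota> smul (k (smul b p)) (smul b p))" for k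
    unfolding sum.reindex[OF inj] by (simp add: case_prod_unfold)
  have ind: "V.independent (?g ` (B \<times> BD))"
  proof (rule V.independent_if_scalars_zero)
    fix k v assume "(\<Sum>v\<in>?g ` (B \<times> BD). vec_scale \<iota> smul (k v) v) = 0" and v: "v \<in> ?g ` (B \<times> BD)"
    then have "(\<Sum>(b, p)\<in>B \<times> BD. vec_scale \<iota> smul (k (smul b p)) (smul b p)) = 0" by (simp only: img)
    then have "k (smul b p) = 0" if "b \<in> B" "p \<in> BD" for b p using zero[of "\<lambda>b p. k (smul b p)"] that by blast
    then show "k v = 0" using v by auto
  qed (use finB D.finite_Basis in simp)
  have "v \<in> V.span (?g ` (B \<times> BD))" for v
  proof -
    obtain c where v: "v = (\<Sum>b\<in>B. smul b (c b))" using spanB by blast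
    have "smul b (c b) \<in> V.span (?g ` (B \<times> BD))" if b: "b \<in> B" for b
    proof -
      have "c b \<in> D.span BD" by (simp only: D.span_Basis UNIV_I)
      then obtain h where h: "c b = (\<Sum>p\<in>BD. ring_scale \<iota> (h p) p)"
        unfolding D.span_finite[OF D.finite_Basis] by blast
      have "smul b (c b) = (\<Sum>p\<in>BD. vec_scale \<iota> smul (h p) (smul b p))" by (simp add: h sum_smul sc)
      moreover have "\<dots> \<in> V.span (?g ` (B \<times> BD))"
        by (rule V.span_sum, rule V.span_scale, rule V.span_base) (use b in force)
      ultimately show ?thesis by simp
    qed
    then show ?thesis unfolding v by (rule V.span_sum)
  qed
  then have "V.span (?g ` (B \<times> BD)) = UNIV" by blast
  then have "finite_dimensional_vector_space (vec_scale \<iota> smul) (?g ` (B \<times> BD))"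
    using ind finB D.finite_Basis by unfold_locales auto
  moreover have "card (?g ` (B \<times> BD)) = card B * card BD" by (simp add: card_image[OF inj] card_cartesian_product)
  ultimately show ?thesis by blast
qed

theorem theorem1p12:
  fixes \<iota> :: "'f::field \<Rightarrow> 'd::division_ring"
    and smul :: "'v::ab_group_add \<Rightarrow> 'd \<Rightarrow> 'v"
    and d n :: nat
  assumes "central_subfield \<iota>"
    and "has_dimension (ring_scale \<iota>) d"
    and "quadratic_type \<iota> d"
    and "right_vector_space smul"
    and "right_has_dimension smul n"
    and "n > 0"
    and "infinite (UNIV :: 'f set) \<or> card (UNIV :: 'f set) \<ge> n * d"
  shows "(\<forall>S. optimal_trivial_spectrum_subspace \<iota> smul S \<and> irreducible_endos smul S \<longrightarrow>
            (\<exists>b. bilinear_form \<iota> smul b \<and> nonisotropic b \<and> S = alternating_endos smul b))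
       \<and> (\<forall>b b'. bilinear_form \<iota> smul b \<and> nonisotropic b \<and>
            bilinear_form \<iota> smul b' \<and> nonisotropic b' \<and>
            optimal_trivial_spectrum_subspace \<iota> smul (alternating_endos smul b) \<and>
            irreducible_endos smul (alternating_endos smul b) \<and>
            optimal_trivial_spectrum_subspace \<iota> smul (alternating_endos smul b') \<and>
            irreducible_endos smul (alternating_endos smul b') \<longrightarrow>
            (alternating_endos smul b = alternating_endos smul b' \<longleftrightarrow>
             (\<exists>c. \<forall>x y. b' x y = c * b x y)))"
proof -
  obtain BD where BD: "finite_dimensional_vector_space (ring_scale \<iota>) BD" "card BD = d"
    using assms(2) by (auto simp: has_dimension_def)
  obtain B where B: "right_basis smul B" "card B = n"
    using assms(5) by (auto simp: right_has_dimension_def)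
  obtain BV where BV: "finite_dimensional_vector_space (vec_scale \<iota> smul) BV" "card BV = n * d"
    using scalar_basis_exists[OF assms(1,4) BD(1) B(1)] BD(2) B(2) by metis
  interpret X: division_space \<iota> smul BD BV
    by (intro division_space.intro division_space_axioms.intro assms(1,4) BD(1) BV(1))
  obtain k where k: "n = Suc k" using assms(6) by (cases n) auto
  have Vdim: "X.V.dim (UNIV :: 'v set) = Suc k * card BD"
    using BV(2) BD(2) k by (simp only: X.V.dim_UNIV)
  have big: "card_ge TYPE('f) (Suc k * card BD)" using assms(7) BD(2) k by (simp add: card_ge_def)
  have idem: "X.idem (\<lambda>v. v)" by (simp add: X.idem_def X.End_id)
  have corner: "X.corner (\<lambda>v. v) = End smul" by (simp add: X.corner_def)
  have rdim: "X.V.dim (range (\<lambda>v::'v. v)) = Suc k * card BD" using Vdim by (simp only: image_ident)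
  have locale_S: "irreducible_optimal \<iota> smul BD BV S k"
    if opt: "optimal_trivial_spectrum_subspace \<iota> smul S" and irr: "irreducible_endos smul S" for S
  proof -
    have S: "S \<subseteq> End smul" "X.E.subspace S" "nofix S"
      using opt by (auto simp: optimal_trivial_spectrum_subspace_def X.trivial_spectrum_iff)
    \<comment> \<open>The triangular space and optimality give the lower bound for
      \<open>dim S\<close>, \<open>corner_bound\<close> the upper one.\<close>
    obtain T where T: "X.E.subspace T" "T \<subseteq> End smul" "nofix T" "tri_dim (card BD) (Suc k) \<le> X.E.dim T"
      using X.triangular_exists[OF idem rdim] unfolding corner by blast
    have "X.E.dim T \<le> X.E.dim S"
      using opt T unfolding optimal_trivial_spectrum_subspace_def X.trivial_spectrum_iff by blast
    moreover have "X.E.dim S \<le> tri_dim (card BD) (Suc k)"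
      by (rule X.corner_bound[OF idem rdim big S(2) _ S(3)]) (simp add: corner S(1))
    ultimately have "X.E.dim S = tri_dim (card BD) (Suc k)" using T(4) by linarith
    moreover have "X.irreducible_on (\<lambda>v. v) S"
      using irr by (auto simp: irreducible_endos_def X.irreducible_on_def)
    moreover have "\<exists>s t. q * q = q * \<iota> s + \<iota> t" for q
      by (rule X.quadratic_type_quadratic) (use assms(3) BD(2) in simp)
    ultimately show ?thesis
      by (intro irreducible_optimal.intro irreducible_optimal_axioms.intro X.division_space_axioms S Vdim big)
  qed
  have form: "X.form (b x)" if "bilinear_form \<iota> smul b" for b x
    using that by (simp add: bilinear_form_def)
  show ?thesis
  proof (intro conjI allI impI; (elim conjE)?)
    fix S assume opt: "optimal_trivial_spectrum_subspace \<iota> smul S" and irr: "irreducible_endos smul S"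
    interpret I: irreducible_optimal \<iota> smul BD BV S k by (rule locale_S[OF opt irr])
    obtain b where b: "bilinear_form \<iota> smul b" "nonisotropic b" "\<And>x. I.ann x (b x)"
      using I.bilinear_annihilator_exists by blast
    let ?A = "alternating_endos smul b"
    have SA: "S \<subseteq> ?A" using I.S_sub_End b(3) by (auto simp: alternating_endos_def I.ann_def)
    have AE: "?A \<subseteq> End smul" by (auto simp: alternating_endos_def)
    have A: "X.E.subspace ?A"
    proof (rule X.E.subspaceI)
      show "0 \<in> ?A" using X.E.subspace_0[OF X.End_subspace]
        by (simp add: alternating_endos_def X.form_0[OF form[OF b(1)]])
      show "u + w \<in> ?A" if "u \<in> ?A" "w \<in> ?A" for u w
        using that X.E.subspace_add[OF X.End_subspace, of u w]
        by (simp add: alternating_endos_def X.form_add[OF form[OF b(1)]])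
      show "end_scale \<iota> smul c u \<in> ?A" if "u \<in> ?A" for c u
        using that X.E.subspace_scale[OF X.End_subspace, of u c]
        by (simp add: alternating_endos_def end_scale_def vec_scale_def X.form_scale[OF form[OF b(1)]])
    qed
    \<comment> \<open>A fixed vector \<open>v\<close> has \<open>b v v = 0\<close>. So
      \<open>?A\<close> is a trivial spectrum space containing \<open>S\<close>, and optimality of
      \<open>S\<close> forces equality.\<close>
    have "nofix ?A" unfolding nofix_def
    proof (intro ballI allI impI)
      fix u v assume "u \<in> ?A" "u v = v"
      then have "b v v = 0" by (auto simp: alternating_endos_def dest: spec[of _ v])
      then show "v = 0" using b(2) by (auto simp: nonisotropic_def)
    qed
    then have "X.E.dim ?A \<le> X.E.dim S"
      using opt A AE unfolding optimal_trivial_spectrum_subspace_def X.trivial_spectrum_iff by blast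
    then have "S = ?A" using X.E.fin_gen_dim_eq[OF I.S_sub SA X.End_sub_fin_gen[OF AE]] by blast
    then show "\<exists>b. bilinear_form \<iota> smul b \<and> nonisotropic b \<and> S = alternating_endos smul b"
      using b by blast
  next
    fix b b'
    assume b: "bilinear_form \<iota> smul b" "nonisotropic b" and b': "bilinear_form \<iota> smul b'" "nonisotropic b'"
      and opt: "optimal_trivial_spectrum_subspace \<iota> smul (alternating_endos smul b)"
      and irr: "irreducible_endos smul (alternating_endos smul b)"
    interpret I: irreducible_optimal \<iota> smul BD BV "alternating_endos smul b" k by (rule locale_S[OF opt irr])
    have bann: "I.ann x (b x)" for x
      unfolding I.ann_def using form[OF b(1)] by (simp add: alternating_endos_def)
    show "alternating_endos smul b = alternating_endos smul b' \<longleftrightarrow> (\<exists>c. \<forall>x y. b' x y = c * b x y)"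
    proof
      assume eq: "alternating_endos smul b = alternating_endos smul b'"
      have "b' x (u x) = 0" if "u \<in> alternating_endos smul b" for u x
        using that unfolding eq by (simp add: alternating_endos_def)
      then have "I.ann x (b' x)" for x
        unfolding I.ann_def using form[OF b'(1)] by blast
      then show "\<exists>c. \<forall>x y. b' x y = c * b x y"
        by (intro I.bilinear_annihilator_unique b b' bann)
    next
      assume "\<exists>c. \<forall>x y. b' x y = c * b x y"
      then obtain c where c: "\<And>x y. b' x y = c * b x y" by blast
      obtain x :: 'v where x: "x \<noteq> 0" by (rule I.V_nontrivial)
      \<comment> \<open>With \<open>c = 0\<close> the form \<open>b'\<close> would vanish at the
        nonzero vector \<open>x\<close>.\<close>
      have "c \<noteq> 0" using b'(2) x c[of x x] by (auto simp: nonisotropic_def)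
      then show "alternating_endos smul b = alternating_endos smul b'"
        by (simp add: alternating_endos_def c)
    qed
  qed
qed

end
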